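(* (i) The magnetic Schrödinger operator $\mathscr H_B$ on the armchair nanotube $\Gamma^N$ is unitarily equivalent to $H^a=\bigoplus_{k\in\mathbb Z_N}H_k^a$, with $a_1=B(R_2-R_1)/4$, $a_2=BR_2/4$, $a=a_1+a_2$. (ii) Let $(a,k)\in\mathbb R\times\mathbb Z_N$. For every $\lambda\in\mathbb C\setminus\sigma_D$ there exist unique fundamental solutions $\vartheta_k^{(\nu)},\varphi_k^{(\nu)}$, $\nu=1,2$. Each of the functions $\vartheta_{k,\alpha}^{(\nu)}(x,\lambda),\varphi_{k,\alpha}^{(\nu)}(x,\lambda)$ is analytic in $\lambda\in\mathbb C\setminus\sigma_D$. For $\lambda\notin\sigma_D$ the eigenvalues of the monodromy matrix $\mathcal M_k(\lambda)$ have the form $\tau_{k,1}^{\pm1},\tau_{k,2}^{\pm1}$, and $$\det\mathcal M_k=1,\qquad \mathcal M_k(\lambda)^\top J\mathcal M_k(\lambda)=J,\quad J=\begin{pmatrix}0&\mathbf j\\-\mathbf j&0\end{pmatrix},\ \mathbf j=\begin{pmatrix}0&1\\1&0\end{pmatrix}.$$ Moreover the matrix-valued function $\mathcal R\mathcal M_k\mathcal R^{-1}$ is entire, where $\mathcal R=I_2\oplus\varphi_1 I_2$.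
   Context: Fix an integer $N\ge1$ and a real potential $q\in L^2(0,1)$. Hill-equation data. For $\lambda\in\mathbb C$, let $\vartheta(t,\lambda),\varphi(t,\lambda)$ solve $-y''+qy=\lambda y$ with $\vartheta(0)=\varphi'(0)=1$ and $\vartheta'(0)=\varphi(0)=0$. Write $\varphi_1=\varphi(1,\cdot)$. Let $\sigma_D=\{\mu_n\}_{n\ge1}$ be the Dirichlet spectrum of $-y''+qy=\lambda y$, $y(0)=y(1)=0$. Nanotube geometry. Put $\phi_m=\pi m/N$, $c_m=\cos\phi_m$, $s_m=\sin\phi_m$ and $R=\sqrt{\cos(\pi/N)+5/4}/\sin(\pi/N)$. Put $R_p=\sqrt{(pR)^2-1}$ for $p=1,2$. Define $\alpha,\beta$ by $\sin\beta=1/R$, $\sin\alpha=1/(2R)$, $0<\alpha<\beta$; these satisfy $\alpha+\beta=\pi/N$. Put $h=\sqrt{2+R_1R_2-2R^2}$ and $\mathbf e_3=(0,0,1)$. For $\omega=(n,j,k)\in\mathcal Z=\mathbb Z\times\{1,\dots,6\}\times\mathbb Z_N$ define the vertices: - $\mathbf r_{n,1,k}=2nh\mathbf e_3+R(c_{2k},s_{2k},0)$; - $\mathbf r_{n,4,k}=2nh\mathbf e_3+R(\cos(2\beta+\phi_{2k}),\sin(2\beta+\phi_{2k}),0)$; - $\mathbf r_{n,2,k}=\mathbf r_{n,5,k}=(2n+1)h\mathbf e_3+R(\cos\zeta_k,\sin\zeta_k,0)$, with $\zeta_k=\beta-\alpha+\phi_{2k}$; - $\mathbf r_{n,3,k}=\mathbf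 r_{n,6,k}=(2n+1)h\mathbf e_3+R(c_{2k+1},s_{2k+1},0)$. Define the edge vectors: - $\mathbf e_{n,j,k}=\mathbf r_{n,j+1,k}-\mathbf r_{n,j,k}$ for $j=1,2,3$; - $\mathbf e_{n,4,k}=\mathbf r_{n,1,k+1}-\mathbf r_{n,4,k}$; - $\mathbf e_{n,5,k}=\mathbf r_{n+1,1,k}-\mathbf r_{n,5,k}$; - $\mathbf e_{n,6,k}=\mathbf r_{n+1,4,k}-\mathbf r_{n,6,k}$. The nanotube is $\Gamma^N=\bigcup_\omega\Gamma_\omega$, where $\Gamma_\omega=\{\mathbf r_\omega+t\mathbf e_\omega:t\in[0,1]\}$, each edge identified with $[0,1]$ via $t$, and $L^2(\Gamma^N)=\bigoplus_\omega L^2(0,1)$. Magnetic operator. Let $B\in\mathbb R$ and $\mathscr A(x)=\frac B2(-x_2,x_1,0)$. Put $a_\omega(t)=(\mathscr A(\mathbf r_\omega+t\mathbf e_\omega),\mathbf e_\omega)$ and $\partial_\omega=\frac d{dt}-ia_\omega$. Then $\mathscr H_B$ acts by $(\mathscr H_Bf)_\omega=-\partial_\omega^2f_\omega+qf_\omega$. Its domain consists of $f$ with $(f_\omega),(f''_\omega)\in L^2(\Gamma^N)$ such that $f$ is continuous on $\Gamma^N$ and, writing $\omega_j=(n,j,k)$, for all $n,k$: - $\partial_{\omega_2}f_{\omega_2}(0)-\partial_{\omega_1}f_{\omega_1}(1)+\partial_{\omega_5}f_{\omega_5}(0)=0$; - $\partial_{\omega_3}f_{\omega_3}(0)-\partial_{\omega_2}f_{\omega_2}(1)+\partial_{\omega_6}f_{\omega_6}(0)=0$;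 - $-\partial_{\omega_3}f_{\omega_3}(1)+\partial_{\omega_4}f_{\omega_4}(0)-\partial_{(n-1,6,k)}f_{n-1,6,k}(1)=0$; - $-\partial_{\omega_4}f_{\omega_4}(1)+\partial_{(n,1,k+1)}f_{n,1,k+1}(0)-\partial_{(n-1,5,k+1)}f_{n-1,5,k+1}(1)=0$. Reduced operators. Let $\Gamma^1$ be the graph with edges $\Gamma_{n,j}$, $(n,j)\in\mathbb Z\times\{1,\dots,6\}$, each identified with $[0,1]$, and $L^2(\Gamma^1)=\bigoplus L^2(0,1)$. For $a_1,a_2\in\mathbb R$, $a=a_1+a_2$, $s=e^{2\pi i/N}$ and $k\in\mathbb Z_N$, the boundary conditions (BC) for a family $f=(f_{n,j})$ are, for all $n\in\mathbb Z$: - $e^{ia_1}f_{n,1}(1)=f_{n,2}(0)=f_{n,5}(0)$; - $e^{ia_2}f_{n,2}(1)=f_{n,3}(0)=f_{n,6}(0)$; - $e^{ia_1}f_{n,3}(1)=f_{n,4}(0)=e^{ia_1}f_{n-1,6}(1)$; - $e^{ia_2}s^kf_{n,4}(1)=f_{n,1}(0)=e^{-ia_1}f_{n-1,5}(1)$; - $e^{ia_1}f'_{n,1}(1)-f'_{n,2}(0)-f'_{n,5}(0)=0$; - $e^{ia_2}f'_{n,2}(1)-f'_{n,3}(0)-f'_{n,6}(0)=0$; - $e^{ia_1}f'_{n,3}(1)-f'_{n,4}(0)+e^{ia_1}f'_{n-1,6}(1)=0$; - $e^{ia_2}s^kf'_{n,4}(1)-f'_{n,1}(0)+e^{-ia_1}f'_{n-1,5}(1)=0$.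 $H_k^a$ acts in $L^2(\Gamma^1)$ by $(H_k^af)_{n,j}=-f''_{n,j}+qf_{n,j}$ on $f$ with $(f_{n,j}),(f''_{n,j})\in L^2(\Gamma^1)$ satisfying (BC). Fundamental solutions and monodromy. Fundamental solutions $\vartheta_k^{(\nu)}=(\vartheta^{(\nu)}_{k,n,j})$ and $\varphi_k^{(\nu)}=(\varphi^{(\nu)}_{k,n,j})$, $\nu=1,2$, are families (not necessarily in $L^2$) solving $-y''+qy=\lambda y$ on each edge, satisfying (BC), and $$\Theta_{k,0}(1,\lambda)=\Phi'_{k,0}(1,\lambda)=I_2,\qquad \Theta'_{k,0}(1,\lambda)=\Phi_{k,0}(1,\lambda)=0,$$ where $$\Theta_{k,n}=\begin{pmatrix}\vartheta^{(1)}_{k,n,5}&\vartheta^{(2)}_{k,n,5}\\ \vartheta^{(1)}_{k,n,6}&\vartheta^{(2)}_{k,n,6}\end{pmatrix},$$ and $\Phi_{k,n}$ is defined likewise from $\varphi^{(\nu)}$. The monodromy matrix is $$\mathcal M_k(\lambda)=\begin{pmatrix}\Theta_{k,1}&\Phi_{k,1}\\ \Theta'_{k,1}&\Phi'_{k,1}\end{pmatrix}(1,\lambda).$$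
   Formalization: Part (i) is stated for N ≥ 2 only, since for N = 1 the radius R = sqrt(cos(π/N)+5/4)/sin(π/N) divides by sin π = 0 and the nanotube is undefined; part (ii) is kept for all N ≥ 1. *)

theory Defs
  imports "HOL-Analysis.Analysis" "Jordan_Normal_Form.Char_Poly"
begin

type_synonym point3 = "real \<times> real \<times> real"

definition Rad :: "nat \<Rightarrow> real" where
  "Rad N = sqrt (cos (pi / real N) + 5/4) / sin (pi / real N)"

definition Rp :: "nat \<Rightarrow> real \<Rightarrow> real" where
  "Rp N p = sqrt ((p * Rad N)\<^sup>2 - 1)"

definition betaN :: "nat \<Rightarrow> real" where "betaN N = arcsin (1 / Rad N)"
definition alphaN :: "nat \<Rightarrow> real" where "alphaN N = arcsin (1 / (2 * Rad N))"

definition hN :: "nat \<Rightarrow> real" where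
  "hN N = sqrt (2 + Rp N 1 * Rp N 2 - 2 * (Rad N)\<^sup>2)"

definition phiN :: "nat \<Rightarrow> real \<Rightarrow> real" where "phiN N m = pi * m / real N"

definition circ_pt :: "nat \<Rightarrow> real \<Rightarrow> real \<Rightarrow> point3" where
  "circ_pt N z ang = (Rad N * cos ang, Rad N * sin ang, z)"

text \<open>Vertices r_(n,j,k); j in 1..6, k in Z_N represented by 0..N-1.\<close>
definition vertex :: "nat \<Rightarrow> int \<times> nat \<times> nat \<Rightarrow> point3" where
  "vertex N \<omega> = (case \<omega> of (n, j, k) \<Rightarrow>
     if j = 1 then circ_pt N (2 * real_of_int n * hN N) (phiN N (2 * real k))
     else if j = 4 then circ_pt N (2 * real_of_int n * hN N) (2 * betaN N + phiN N (2 * real k))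
     else if j = 2 \<or> j = 5 then circ_pt N ((2 * real_of_int n + 1) * hN N)
                                 (betaN N - alphaN N + phiN N (2 * real k))
     else circ_pt N ((2 * real_of_int n + 1) * hN N) (phiN N (2 * real k + 1)))"

definition edge_vec :: "nat \<Rightarrow> int \<times> nat \<times> nat \<Rightarrow> point3" where
  "edge_vec N \<omega> = (case \<omega> of (n, j, k) \<Rightarrow>
     if j \<in> {1,2,3} then vertex N (n, j + 1, k) - vertex N (n, j, k)
     else if j = 4 then vertex N (n, 1, (k + 1) mod N) - vertex N (n, 4, k)
     else if j = 5 then vertex N (n + 1, 1, k) - vertex N (n, 5, k)
     else vertex N (n + 1, 4, k) - vertex N (n, 6, k))"

definition edge_pt :: "nat \<Rightarrow> int \<times> nat \<times> nat \<Rightarrow> real \<Rightarrow> point3" where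
  "edge_pt N \<omega> t = vertex N \<omega> + t *\<^sub>R edge_vec N \<omega>"

definition vec_pot :: "real \<Rightarrow> point3 \<Rightarrow> point3" where
  "vec_pot B x = (B / 2 * (- fst (snd x)), B / 2 * fst x, 0)"

definition inner3 :: "point3 \<Rightarrow> point3 \<Rightarrow> real" where
  "inner3 x y = fst x * fst y + fst (snd x) * fst (snd y) + snd (snd x) * snd (snd y)"

definition mag_pot :: "nat \<Rightarrow> real \<Rightarrow> int \<times> nat \<times> nat \<Rightarrow> real \<Rightarrow> real" where
  "mag_pot N B \<omega> t = inner3 (vec_pot B (edge_pt N \<omega> t)) (edge_vec N \<omega>)"

definition L2_01 :: "(real \<Rightarrow> complex) \<Rightarrow> bool" where
  "L2_01 g \<longleftrightarrow> g measurable_on {0..1} \<and> (\<lambda>t. (cmod (g t))\<^sup>2) integrable_on {0..1}"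

definition L2_01_real :: "(real \<Rightarrow> real) \<Rightarrow> bool" where
  "L2_01_real g \<longleftrightarrow> g measurable_on {0..1} \<and> (\<lambda>t. (g t)\<^sup>2) integrable_on {0..1}"

definition dv :: "(real \<Rightarrow> complex) \<Rightarrow> real \<Rightarrow> complex" where
  "dv f t = vector_derivative f (at t within {0..1})"

text \<open>f in H^2(0,1) with (a.e.) second derivative g: f is C^1 on [0,1], f' absolutely
  continuous with f' = f'(0) + int_0^t g, and g in L^2(0,1).\<close>
definition H2rep :: "(real \<Rightarrow> complex) \<Rightarrow> (real \<Rightarrow> complex) \<Rightarrow> bool" where
  "H2rep f g \<longleftrightarrow>
     (\<forall>t\<in>{0..1}. (f has_vector_derivative dv f t) (at t within {0..1})) \<and>
     L2_01 g \<and> g integrable_on {0..1} \<and>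
     (\<forall>t\<in>{0..1}. dv f t = dv f 0 + integral {0..t} g)"

definition d2 :: "(real \<Rightarrow> complex) \<Rightarrow> real \<Rightarrow> complex" where
  "d2 f = (SOME g. H2rep f g)"

text \<open>Index set Z x {1..6} x Z_N (used both for Gamma^N and for the direct sum over k of
  the spaces L^2(Gamma^1)).\<close>
definition Idx :: "nat \<Rightarrow> (int \<times> nat \<times> nat) set" where
  "Idx N = {(n, j, k). 1 \<le> j \<and> j \<le> 6 \<and> k < N}"

type_synonym fam = "int \<times> nat \<times> nat \<Rightarrow> real \<Rightarrow> complex"

definition l2fam :: "nat \<Rightarrow> fam \<Rightarrow> bool" where
  "l2fam N f \<longleftrightarrow> (\<forall>\<omega>\<in>Idx N. L2_01 (f \<omega>)) \<and>
     (\<lambda>\<omega>. integral {0..1} (\<lambda>t. (cmod (f \<omega> t))\<^sup>2)) summable_on Idx N"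

definition inner_fam :: "nat \<Rightarrow> fam \<Rightarrow> fam \<Rightarrow> complex" where
  "inner_fam N f g = infsum (\<lambda>\<omega>. integral {0..1} (\<lambda>t. f \<omega> t * cnj (g \<omega> t))) (Idx N)"

definition aeq :: "nat \<Rightarrow> fam \<Rightarrow> fam \<Rightarrow> bool" where
  "aeq N f g \<longleftrightarrow> (\<forall>\<omega>\<in>Idx N. negligible {t\<in>{0..1}. f \<omega> t \<noteq> g \<omega> t})"

text \<open>Unitary equivalence of two operators in L^2, given by their graphs
  (sets of pairs (f, Tf) of representatives).\<close>
definition unitarily_equiv :: "nat \<Rightarrow> (fam \<times> fam) set \<Rightarrow> (fam \<times> fam) set \<Rightarrow> bool" where
  "unitarily_equiv N G1 G2 \<longleftrightarrow> (\<exists>U :: fam \<Rightarrow> fam.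
     (\<forall>f. l2fam N f \<longrightarrow> l2fam N (U f)) \<and>
     (\<forall>f g c. l2fam N f \<longrightarrow> l2fam N g \<longrightarrow>
        aeq N (U (\<lambda>\<omega> t. c * f \<omega> t + g \<omega> t)) (\<lambda>\<omega> t. c * U f \<omega> t + U g \<omega> t)) \<and>
     (\<forall>f g. l2fam N f \<longrightarrow> l2fam N g \<longrightarrow> inner_fam N (U f) (U g) = inner_fam N f g) \<and>
     (\<forall>h. l2fam N h \<longrightarrow> (\<exists>f. l2fam N f \<and> aeq N (U f) h)) \<and>
     (\<forall>(f, g)\<in>G1. \<exists>(f', g')\<in>G2. aeq N (U f) f' \<and> aeq N (U g) g') \<and>
     (\<forall>(f', g')\<in>G2. \<exists>(f, g)\<in>G1. aeq N (U f) f' \<and> aeq N (U g) g'))"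

definition mder :: "nat \<Rightarrow> real \<Rightarrow> fam \<Rightarrow> int \<times> nat \<times> nat \<Rightarrow> real \<Rightarrow> complex" where
  "mder N B f \<omega> t = dv (f \<omega>) t - \<i> * complex_of_real (mag_pot N B \<omega> t) * f \<omega> t"

definition dom_HB :: "nat \<Rightarrow> real \<Rightarrow> fam \<Rightarrow> bool" where
  "dom_HB N B f \<longleftrightarrow>
     (\<forall>\<omega>\<in>Idx N. \<exists>g. H2rep (f \<omega>) g) \<and> l2fam N f \<and> l2fam N (\<lambda>\<omega>. d2 (f \<omega>)) \<and>
     (\<forall>\<omega>\<in>Idx N. \<forall>\<omega>'\<in>Idx N. \<forall>t\<in>{0..1}. \<forall>t'\<in>{0..1}.
        edge_pt N \<omega> t = edge_pt N \<omega>' t' \<longrightarrow> f \<omega> t = f \<omega>' t') \<and>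
     (\<forall>n. \<forall>k<N. let k' = (k + 1) mod N; D = mder N B f in
        D (n,2,k) 0 - D (n,1,k) 1 + D (n,5,k) 0 = 0 \<and>
        D (n,3,k) 0 - D (n,2,k) 1 + D (n,6,k) 0 = 0 \<and>
        - D (n,3,k) 1 + D (n,4,k) 0 - D (n-1,6,k) 1 = 0 \<and>
        - D (n,4,k) 1 + D (n,1,k') 0 - D (n-1,5,k') 1 = 0)"

text \<open>(H_B f)_omega = - partial_omega^2 f_omega + q f_omega, with
  partial^2 f = f'' - 2 i a f' - i a' f - a^2 f.\<close>
definition HB_op :: "nat \<Rightarrow> real \<Rightarrow> (real \<Rightarrow> real) \<Rightarrow> fam \<Rightarrow> fam" where
  "HB_op N B q f \<omega> t =
     (let a = complex_of_real (mag_pot N B \<omega> t);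
          a' = complex_of_real (deriv (mag_pot N B \<omega>) t)
      in - (d2 (f \<omega>) t - 2 * \<i> * a * dv (f \<omega>) t - \<i> * a' * f \<omega> t - a\<^sup>2 * f \<omega> t)
         + complex_of_real (q t) * f \<omega> t)"

definition graph_HB :: "nat \<Rightarrow> real \<Rightarrow> (real \<Rightarrow> real) \<Rightarrow> (fam \<times> fam) set" where
  "graph_HB N B q = {(f, HB_op N B q f) | f. dom_HB N B f}"

definition BC :: "nat \<Rightarrow> real \<Rightarrow> real \<Rightarrow> nat \<Rightarrow> (int \<Rightarrow> nat \<Rightarrow> real \<Rightarrow> complex) \<Rightarrow> bool" where
  "BC N a1 a2 k y \<longleftrightarrow> (\<forall>n.
     let s = exp (2 * pi * \<i> / of_nat N); e1 = exp (\<i> * of_real a1); e2 = exp (\<i> * of_real a2);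
         e1' = exp (- \<i> * of_real a1); d = (\<lambda>m j t. dv (y m j) t) in
     e1 * y n 1 1 = y n 2 0 \<and> y n 2 0 = y n 5 0 \<and>
     e2 * y n 2 1 = y n 3 0 \<and> y n 3 0 = y n 6 0 \<and>
     e1 * y n 3 1 = y n 4 0 \<and> y n 4 0 = e1 * y (n - 1) 6 1 \<and>
     e2 * s ^ k * y n 4 1 = y n 1 0 \<and> y n 1 0 = e1' * y (n - 1) 5 1 \<and>
     e1 * d n 1 1 - d n 2 0 - d n 5 0 = 0 \<and>
     e2 * d n 2 1 - d n 3 0 - d n 6 0 = 0 \<and>
     e1 * d n 3 1 - d n 4 0 + e1 * d (n - 1) 6 1 = 0 \<and>
     e2 * s ^ k * d n 4 1 - d n 1 0 + e1' * d (n - 1) 5 1 = 0)"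

definition dom_Ha :: "nat \<Rightarrow> real \<Rightarrow> real \<Rightarrow> fam \<Rightarrow> bool" where
  "dom_Ha N a1 a2 f \<longleftrightarrow>
     (\<forall>\<omega>\<in>Idx N. \<exists>g. H2rep (f \<omega>) g) \<and> l2fam N f \<and> l2fam N (\<lambda>\<omega>. d2 (f \<omega>)) \<and>
     (\<forall>k<N. BC N a1 a2 k (\<lambda>n j. f (n, j, k)))"

definition Ha_op :: "(real \<Rightarrow> real) \<Rightarrow> fam \<Rightarrow> fam" where
  "Ha_op q f \<omega> t = - d2 (f \<omega>) t + complex_of_real (q t) * f \<omega> t"

definition graph_Ha :: "nat \<Rightarrow> real \<Rightarrow> real \<Rightarrow> (real \<Rightarrow> real) \<Rightarrow> (fam \<times> fam) set" where
  "graph_Ha N a1 a2 q = {(f, Ha_op q f) | f. dom_Ha N a1 a2 f}"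

text \<open>y solves -y'' + q y = lambda y on [0,1] (y' absolutely continuous).\<close>
definition sol :: "(real \<Rightarrow> real) \<Rightarrow> complex \<Rightarrow> (real \<Rightarrow> complex) \<Rightarrow> bool" where
  "sol q lam y \<longleftrightarrow>
     (\<forall>t\<in>{0..1}. (y has_vector_derivative dv y t) (at t within {0..1})) \<and>
     (\<forall>t\<in>{0..1}. (\<lambda>s. (complex_of_real (q s) - lam) * y s) integrable_on {0..t} \<and>
        dv y t = dv y 0 + integral {0..t} (\<lambda>s. (complex_of_real (q s) - lam) * y s))"

definition dirichlet_spec :: "(real \<Rightarrow> real) \<Rightarrow> complex set" where
  "dirichlet_spec q = {lam. \<exists>y. sol q lam y \<and> y 0 = 0 \<and> y 1 = 0 \<and> (\<exists>t\<in>{0..1}. y t \<noteq> 0)}"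

definition phi_std :: "(real \<Rightarrow> real) \<Rightarrow> complex \<Rightarrow> real \<Rightarrow> complex" where
  "phi_std q lam = (SOME y. sol q lam y \<and> y 0 = 0 \<and> dv y 0 = 1)"

definition phi1 :: "(real \<Rightarrow> real) \<Rightarrow> complex \<Rightarrow> complex" where
  "phi1 q lam = phi_std q lam 1"

type_synonym gfam = "int \<Rightarrow> nat \<Rightarrow> real \<Rightarrow> complex"

definition gsol :: "nat \<Rightarrow> (real \<Rightarrow> real) \<Rightarrow> real \<Rightarrow> real \<Rightarrow> nat \<Rightarrow> complex \<Rightarrow> gfam \<Rightarrow> bool" where
  "gsol N q a1 a2 k lam y \<longleftrightarrow> (\<forall>n. \<forall>j\<in>{1..6}. sol q lam (y n j)) \<and> BC N a1 a2 k y"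

definition fund_theta :: "nat \<Rightarrow> (real \<Rightarrow> real) \<Rightarrow> real \<Rightarrow> real \<Rightarrow> nat \<Rightarrow> complex \<Rightarrow> nat \<Rightarrow> gfam \<Rightarrow> bool" where
  "fund_theta N q a1 a2 k lam \<nu> y \<longleftrightarrow> gsol N q a1 a2 k lam y \<and>
     y 0 5 1 = (if \<nu> = 1 then 1 else 0) \<and> y 0 6 1 = (if \<nu> = 2 then 1 else 0) \<and>
     dv (y 0 5) 1 = 0 \<and> dv (y 0 6) 1 = 0"

definition fund_phi :: "nat \<Rightarrow> (real \<Rightarrow> real) \<Rightarrow> real \<Rightarrow> real \<Rightarrow> nat \<Rightarrow> complex \<Rightarrow> nat \<Rightarrow> gfam \<Rightarrow> bool" where
  "fund_phi N q a1 a2 k lam \<nu> y \<longleftrightarrow> gsol N q a1 a2 k lam y \<and>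
     y 0 5 1 = 0 \<and> y 0 6 1 = 0 \<and>
     dv (y 0 5) 1 = (if \<nu> = 1 then 1 else 0) \<and> dv (y 0 6) 1 = (if \<nu> = 2 then 1 else 0)"

definition agree :: "gfam \<Rightarrow> gfam \<Rightarrow> bool" where
  "agree y z \<longleftrightarrow> (\<forall>n. \<forall>j\<in>{1..6}. \<forall>t\<in>{0..1}. y n j t = z n j t)"

definition blk :: "(nat \<Rightarrow> gfam) \<Rightarrow> int \<Rightarrow> complex mat" where
  "blk Y n = mat 2 2 (\<lambda>(i, \<nu>). Y (\<nu> + 1) n (5 + i) 1)"

definition blk' :: "(nat \<Rightarrow> gfam) \<Rightarrow> int \<Rightarrow> complex mat" where
  "blk' Y n = mat 2 2 (\<lambda>(i, \<nu>). dv (Y (\<nu> + 1) n (5 + i)) 1)"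

definition monodromy :: "(nat \<Rightarrow> gfam) \<Rightarrow> (nat \<Rightarrow> gfam) \<Rightarrow> complex mat" where
  "monodromy Th Ph = four_block_mat (blk Th 1) (blk Ph 1) (blk' Th 1) (blk' Ph 1)"

definition jmat :: "complex mat" where
  "jmat = mat 2 2 (\<lambda>(i, j). if i = j then 0 else 1)"

definition Jsymp :: "complex mat" where
  "Jsymp = four_block_mat (0\<^sub>m 2 2) jmat (- jmat) (0\<^sub>m 2 2)"

definition Rmat :: "(real \<Rightarrow> real) \<Rightarrow> complex \<Rightarrow> complex mat" where
  "Rmat q lam = four_block_mat (1\<^sub>m 2) (0\<^sub>m 2 2) (0\<^sub>m 2 2) (phi1 q lam \<cdot>\<^sub>m 1\<^sub>m 2)"

definition mat_inv :: "complex mat \<Rightarrow> complex mat" where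
  "mat_inv A = (THE B. B \<in> carrier_mat (dim_row A) (dim_row A) \<and> inverts_mat A B \<and> inverts_mat B A)"

end

theory Submission
  imports Defs "HOL-Complex_Analysis.Cauchy_Integral_Formula"
begin

text \<open>
  Part (i). A magnetic potential of the form \<open>(B/2) (-x2, x1, 0)\<close> is constant along every edge, so multiplying
  \<open>f\<close> by \<open>exp (- \<i> a t)\<close> removes it and leaves only phases in the vertex conditions.  The discrete
  Fourier transform in \<open>k\<close> then diagonalises the rotation \<open>k \<mapsto> k + 1\<close>.  That continuity on the tube is no
  more than continuity at the vertices uses that distinct edges meet in vertices only; this is read
  off the polar angles of their projections.

  Part (ii).  Off the Dirichlet spectrum a solution on an edge is determined by its two end values.
  Written in the vertex values, the Kirchhoff conditions become a three-term recurrence whose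
  coefficients are polynomials in \<open>th(1)\<close> and \<open>ph'(1)\<close>: the denominator \<open>ph(1)\<close> cancels.  Existence,
  uniqueness, analyticity and the entire matrix are immediate from this recurrence.  Each half step of
  it is a reflection \<open>u \<mapsto> S p - u\<close> with \<open>j S\<close> symmetric, which gives the symplectic identity, and
  the transfer matrix \<open>[[C S - 1, - C], [S, - 1]]\<close> has characteristic polynomial
  \<open>det ((x + 1)^2 - x C S)\<close>, a product of two reciprocal quadratics.
\<close>

section \<open>Indefinite integrals on the unit interval\<close>

text \<open>Two weaknesses of the data shape the analysis. The potential is only square integrable,
  so \<open>y'\<close> has a derivative almost everywhere at best; whatever would differentiate
  \<open>y'\<close> pointwise (constancy of the Wronskian, removal of the gauge) goes through one
  integration by parts for indefinite integrals. And the domains control \<open>f\<close> and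
  \<open>f''\<close> in mean square but not \<open>f'\<close>, which enters with every
  gauge-conjugated second derivative; an interpolation inequality whose constants do not depend on
  the edge closes this gap. Since \<open>d2\<close> is a choice among functions that agree almost
  everywhere, the operators are intertwined up to null sets.

  The scaling of the vertex values by \<open>e1\<close> frees the edges that lead to the next level
  from phases, so that the fluxes survive only in \<open>e2\<close> and \<open>kap\<close>. Part (i)
  is claimed for \<open>N \<ge> 2\<close>: at \<open>N = 1\<close> the denominator sin pi of the
  radius vanishes.\<close>

lemma has_vector_derivative_of_modulus:
  fixes f :: "real \<Rightarrow> 'a::real_normed_vector"
  assumes b: "\<And>u. u \<in> S \<Longrightarrow> norm (f u - f t - (u - t) *\<^sub>R D) \<le> \<bar>u - t\<bar> * m u"
    and m: "(m \<longlongrightarrow> 0) (at t within S)"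
  shows "(f has_vector_derivative D) (at t within S)"
  unfolding has_vector_derivative_def has_derivative_within
proof
  show "bounded_linear (\<lambda>x. x *\<^sub>R D)" by (rule bounded_linear_scaleR_left)
  show "((\<lambda>u. (1 / norm (u - t)) *\<^sub>R (f u - (f t + (u - t) *\<^sub>R D))) \<longlongrightarrow> 0) (at t within S)"
  proof (rule Lim_null_comparison[OF _ m], unfold eventually_at_filter, rule always_eventually, safe)
    fix u assume u: "u \<noteq> t" "u \<in> S"
    show "norm ((1 / norm (u - t)) *\<^sub>R (f u - (f t + (u - t) *\<^sub>R D))) \<le> m u"
      using b[OF u(2)] u(1) by (simp add: divide_simps diff_diff_eq mult.commute)
  qed
qed

lemma continuous_mult_absolutely_integrable:
  fixes p h :: "real \<Rightarrow> complex"
  assumes "p absolutely_integrable_on {a..b}" "continuous_on {a..b} h"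
  shows "(\<lambda>s. p s * h s) absolutely_integrable_on {a..b}"
proof -
  have "bilinear (\<lambda>x y :: complex. y * x)"
    by (simp add: bilinear_conv_bounded_bilinear bounded_bilinear.flip[OF bounded_bilinear_mult])
  moreover have "h \<in> borel_measurable (lebesgue_on {a..b})"
    using assms(2) by (intro continuous_imp_measurable_on_sets_lebesgue) auto
  moreover have "bounded (h ` {a..b})"
    using assms(2) by (intro compact_imp_bounded compact_continuous_image) auto
  ultimately show ?thesis
    using absolutely_integrable_bounded_measurable_product[of "\<lambda>x y. y * x" h "{a..b}" p] assms(1) by simp
qed

lemma absolutely_integrable_subinterval:
  fixes p :: "real \<Rightarrow> complex"
  assumes "p absolutely_integrable_on {0..1}" "0 \<le> s" "t \<le> 1"
  shows "p absolutely_integrable_on {s..t}"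
  using assms by (intro absolutely_integrable_on_subinterval[OF assms(1)]) auto

text \<open>The total variation of the indefinite integral of \<open>p\<close>. An integrable
  \<open>p\<close> has no pointwise bound, but increments of \<open>mass p\<close> majorise its
  integrals, and \<open>mass p\<close> is continuous, so these increments serve as the modulus in
  \<open>has_vector_derivative_of_modulus\<close>.\<close>

definition mass :: "(real \<Rightarrow> complex) \<Rightarrow> real \<Rightarrow> real" where
  "mass p t = integral {0..t} (\<lambda>s. cmod (p s))"

lemma mass_diff:
  assumes p: "p absolutely_integrable_on {0..1}" and st: "0 \<le> s" "s \<le> t" "t \<le> 1"
  shows "mass p t - mass p s = integral {s..t} (\<lambda>u. cmod (p u))"
  unfolding mass_def
  using Henstock_Kurzweil_Integration.integral_combine[of 0 s t "\<lambda>u. cmod (p u)"] st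
    absolutely_integrable_subinterval[OF p, of 0 t] by (simp add: absolutely_integrable_on_def)

lemma mass_mono:
  assumes p: "p absolutely_integrable_on {0..1}" and st: "0 \<le> s" "s \<le> t" "t \<le> 1"
  shows "mass p s \<le> mass p t"
  using mass_diff[OF assms] absolutely_integrable_subinterval[OF p st(1,3)]
    integral_nonneg[of "\<lambda>u. cmod (p u)" "{s..t}"] by (simp add: absolutely_integrable_on_def)

lemma mass_0: "mass p 0 = 0"
  by (simp add: mass_def)

lemma mass_continuous:
  assumes p: "p absolutely_integrable_on {0..1}"
  shows "continuous_on {0..1} (mass p)"
  unfolding mass_def
  using assms by (intro indefinite_integral_continuous_1) (simp add: absolutely_integrable_on_def)

lemma mass_diff_tendsto_0:
  assumes p: "p absolutely_integrable_on {0..1}" and t: "t \<in> {0..1}"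
  shows "((\<lambda>u. C * \<bar>mass p u - mass p t\<bar>) \<longlongrightarrow> 0) (at t within {0..1})"
proof -
  have "(mass p \<longlongrightarrow> mass p t) (at t within {0..1})"
    using mass_continuous[OF p] t by (simp add: continuous_on_def)
  then have "((\<lambda>u. C * \<bar>mass p u - mass p t\<bar>) \<longlongrightarrow> C * \<bar>mass p t - mass p t\<bar>) (at t within {0..1})"
    by (intro tendsto_intros)
  then show ?thesis by simp
qed

lemma integral_mult_le_mass:
  assumes p: "p absolutely_integrable_on {0..1}" and st: "0 \<le> s" "s \<le> t" "t \<le> 1"
    and h: "continuous_on {0..1} h" and C: "\<And>u. u \<in> {s..t} \<Longrightarrow> cmod (h u) \<le> C"
  shows "cmod (integral {s..t} (\<lambda>u. p u * h u)) \<le> C * (mass p t - mass p s)"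
proof -
  have a: "p absolutely_integrable_on {s..t}" using absolutely_integrable_subinterval[OF p st(1,3)] .
  have "cmod (integral {s..t} (\<lambda>u. p u * h u)) \<le> integral {s..t} (\<lambda>u. C * cmod (p u))"
  proof (rule integral_norm_bound_integral)
    show "(\<lambda>u. p u * h u) integrable_on {s..t}"
      using continuous_mult_absolutely_integrable[OF a continuous_on_subset[OF h]] st
      by (auto simp: absolutely_integrable_on_def)
    show "(\<lambda>u. C * cmod (p u)) integrable_on {s..t}"
      using a by (intro integrable_on_mult_right) (simp add: absolutely_integrable_on_def)
    show "cmod (p u * h u) \<le> C * cmod (p u)" if "u \<in> {s..t}" for u
      using C[OF that] mult_right_mono[OF C[OF that], of "cmod (p u)"] by (simp add: norm_mult mult.commute)
  qed
  also have "\<dots> = C * (mass p t - mass p s)" by (simp add: mass_diff[OF p st])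
  finally show ?thesis .
qed

lemma integral_diff_le_mass:
  assumes g: "g absolutely_integrable_on {0..1}" and st: "0 \<le> s" "s \<le> t" "t \<le> 1"
  shows "cmod (integral {0..t} g - integral {0..s} g) \<le> mass g t - mass g s"
proof -
  have "integral {0..t} g - integral {0..s} g = integral {s..t} (\<lambda>u. g u * 1)"
    using Henstock_Kurzweil_Integration.integral_combine[of 0 s t g] st
      absolutely_integrable_subinterval[OF g, of 0 t] by (simp add: absolutely_integrable_on_def diff_eq_eq add.commute)
  also have "cmod \<dots> \<le> 1 * (mass g t - mass g s)"
    by (rule integral_mult_le_mass[OF g st]) auto
  finally show ?thesis by simp
qed

lemma continuous_bound01:
  fixes f :: "real \<Rightarrow> complex"
  assumes "continuous_on {0..1} f"
  obtains M where "M \<ge> 0" "\<And>t. t \<in> {0..1} \<Longrightarrow> cmod (f t) \<le> M"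
proof -
  have "bounded (f ` {0..1})" using assms by (intro compact_imp_bounded compact_continuous_image) auto
  then obtain M where "\<forall>x\<in>f ` {0..1}. cmod x \<le> M" unfolding bounded_iff by blast
  then have "cmod (f t) \<le> max M 0" if "t \<in> {0..1}" for t
    using that imageI[OF that, of f] max.cobounded1 order_trans by blast
  then show ?thesis using that[of "max M 0"] by simp
qed

text \<open>Over an interval the difference of the two sides moves by at most the length of the interval times
  the mass of \<open>g\<close>, so its derivative vanishes at every point although \<open>g\<close> is only integrable.\<close>

lemma indefinite_integral_product:
  fixes g G E E' :: "real \<Rightarrow> complex"
  assumes g: "g absolutely_integrable_on {0..1}" and G: "\<And>t. t \<in> {0..1} \<Longrightarrow> G t = G 0 + integral {0..t} g"
    and E: "\<And>t. t \<in> {0..1} \<Longrightarrow> (E has_vector_derivative E' t) (at t within {0..1})"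
    and E': "continuous_on {0..1} E'" and t: "t \<in> {0..1}"
  shows "E t * G t = E 0 * G 0 + integral {0..t} (\<lambda>s. E' s * G s + g s * E s)"
proof -
  have Ec: "continuous_on {0..1} E" by (rule continuous_on_vector_derivative[OF E])
  have "continuous_on {0..1} (\<lambda>t. G 0 + integral {0..t} g)"
    using g by (intro continuous_intros indefinite_integral_continuous_1) (simp add: absolutely_integrable_on_def)
  then have Gc: "continuous_on {0..1} G" by (rule continuous_on_eq) (metis G)
  have sub: "{s..t} \<subseteq> {0..1}" if "0 \<le> s" "t \<le> 1" for s t :: real using that by auto
  have i1: "(\<lambda>s. E' s * G s) integrable_on {s..t}" if "0 \<le> s" "t \<le> 1" for s t
    by (intro integrable_continuous_real continuous_on_mult continuous_on_subset[OF E' sub[OF that]] continuous_on_subset[OF Gc sub[OF that]])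
  have i2: "(\<lambda>s. g s * E s) integrable_on {s..t}" if "0 \<le> s" "t \<le> 1" for s t
    using continuous_mult_absolutely_integrable[OF absolutely_integrable_subinterval[OF g that] continuous_on_subset[OF Ec sub[OF that]]]
    by (simp add: absolutely_integrable_on_def)
  have i3: "g integrable_on {s..t}" if "0 \<le> s" "t \<le> 1" for s t
    using absolutely_integrable_subinterval[OF g that] by (simp add: absolutely_integrable_on_def)
  obtain L where L0: "L \<ge> 0" and L: "\<And>t. t \<in> {0..1} \<Longrightarrow> cmod (E' t) \<le> L" using continuous_bound01[OF E'] by blast
  have ftc: "(E' has_integral E t - E s) {s..t}" if st: "0 \<le> s" "s \<le> t" "t \<le> 1" for s t
    by (rule fundamental_theorem_of_calculus[OF st(2)])
      (use has_vector_derivative_within_subset[OF E sub[OF st(1,3)]] st in auto)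
  have lip: "cmod (E t - E s) \<le> L * (t - s)" if st: "0 \<le> s" "s \<le> t" "t \<le> 1" for s t
  proof -
    have "cmod (E t - E s) \<le> L * measure lborel {s..t}"
      using has_integral_bound_real[OF L0 finite.emptyI ftc[OF st]] L sub[OF st(1,3)] by auto
    then show ?thesis using st by simp
  qed
  have step: "G t - G s = integral {s..t} g" if st: "0 \<le> s" "s \<le> t" "t \<le> 1" for s t
    using Henstock_Kurzweil_Integration.integral_combine[OF st(1,2) i3[of 0 t]] G[of s] G[of t] st
    by (simp add: algebra_simps)
  \<comment> \<open>The defect of the claimed formula, to be shown constant.\<close>
  define K where "K = (\<lambda>t. E t * G t - integral {0..t} (\<lambda>s. E' s * G s + g s * E s))"
  have main: "cmod (K t - K s) \<le> (t - s) * (2 * L * (mass g t - mass g s))" if st: "0 \<le> s" "s \<le> t" "t \<le> 1" for s t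
  proof -
    have f1: "integral {0..s} (\<lambda>s. E' s * G s + g s * E s) + integral {s..t} (\<lambda>s. E' s * G s + g s * E s) = integral {0..t} (\<lambda>s. E' s * G s + g s * E s)"
      using st by (intro Henstock_Kurzweil_Integration.integral_combine integrable_add i1 i2) auto
    have f2: "integral {s..t} (\<lambda>s. E' s * G s + g s * E s) = integral {s..t} (\<lambda>s. E' s * G s) + integral {s..t} (\<lambda>s. g s * E s)"
      using st by (intro integral_add i1 i2) auto
    have f3: "integral {s..t} (\<lambda>u. E' u * (G u - G s)) = integral {s..t} (\<lambda>u. E' u * G u) - (E t - E s) * G s"
    proof -
      have "integral {s..t} (\<lambda>u. E' u * (G u - G s)) = integral {s..t} (\<lambda>u. E' u * G u - E' u * G s)"
        by (intro integral_cong) (simp add: algebra_simps)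
      also have "\<dots> = integral {s..t} (\<lambda>u. E' u * G u) - integral {s..t} (\<lambda>u. E' u * G s)"
        using st ftc[OF st] by (intro integral_diff i1 integrable_on_mult_left) auto
      also have "integral {s..t} (\<lambda>u. E' u * G s) = (E t - E s) * G s"
        using integral_unique[OF ftc[OF st]] by simp
      finally show ?thesis .
    qed
    have f4: "integral {s..t} (\<lambda>u. g u * (E u - E t)) = integral {s..t} (\<lambda>u. g u * E u) - (G t - G s) * E t"
    proof -
      have "integral {s..t} (\<lambda>u. g u * (E u - E t)) = integral {s..t} (\<lambda>u. g u * E u - g u * E t)"
        by (intro integral_cong) (simp add: algebra_simps)
      also have "\<dots> = integral {s..t} (\<lambda>u. g u * E u) - integral {s..t} (\<lambda>u. g u * E t)"
        using st by (intro integral_diff i2 integrable_on_mult_left i3) auto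
      finally show ?thesis unfolding step[OF st] by simp
    qed
    have K: "K t - K s = - (integral {s..t} (\<lambda>u. E' u * (G u - G s)) + integral {s..t} (\<lambda>u. g u * (E u - E t)))"
      unfolding K_def f3 f4 f1[symmetric] f2 by (simp add: algebra_simps)
    have b1: "cmod (integral {s..t} (\<lambda>u. g u * (E u - E t))) \<le> (L * (t - s)) * (mass g t - mass g s)"
    proof (rule integral_mult_le_mass[OF g st])
      show "continuous_on {0..1} (\<lambda>u. E u - E t)" by (intro continuous_intros Ec)
      fix u assume u: "u \<in> {s..t}"
      have "cmod (E u - E t) \<le> L * (t - u)" using lip[of u t] u st by (simp add: norm_minus_commute)
      also have "\<dots> \<le> L * (t - s)" using u L0 by (intro mult_left_mono) auto
      finally show "cmod (E u - E t) \<le> L * (t - s)" .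
    qed
    have "cmod (integral {s..t} (\<lambda>u. E' u * (G u - G s))) \<le> integral {s..t} (\<lambda>u. L * (mass g t - mass g s))"
    proof (rule integral_norm_bound_integral)
      show "(\<lambda>u. E' u * (G u - G s)) integrable_on {s..t}"
        using st by (intro integrable_continuous_real continuous_intros continuous_on_subset[OF E'] continuous_on_subset[OF Gc] sub) auto
      fix u assume u: "u \<in> {s..t}"
      have "cmod (G u - G s) \<le> mass g u - mass g s"
        using integral_diff_le_mass[OF g, of s u] G[of u] G[of s] u st by simp
      also have "\<dots> \<le> mass g t - mass g s" using mass_mono[OF g, of u t] u st by simp
      finally show "cmod (E' u * (G u - G s)) \<le> L * (mass g t - mass g s)"
        unfolding norm_mult using L[of u] L0 u st by (intro mult_mono) auto
    qed (rule integrable_const_ivl)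
    also have "\<dots> = (t - s) * (L * (mass g t - mass g s))" using st by simp
    finally have b2: "cmod (integral {s..t} (\<lambda>u. E' u * (G u - G s))) \<le> (t - s) * (L * (mass g t - mass g s))" .
    have "cmod (K t - K s) \<le> cmod (integral {s..t} (\<lambda>u. E' u * (G u - G s))) + cmod (integral {s..t} (\<lambda>u. g u * (E u - E t)))"
      unfolding K norm_minus_cancel by (rule norm_triangle_ineq)
    also have "\<dots> \<le> (t - s) * (L * (mass g t - mass g s)) + (L * (t - s)) * (mass g t - mass g s)" using b1 b2 by linarith
    also have "\<dots> = (t - s) * (2 * L * (mass g t - mass g s))" by (simp add: algebra_simps)
    finally show ?thesis .
  qed
  have "(K has_vector_derivative 0) (at t within {0..1})" if t: "t \<in> {0..1}" for t
  proof (rule has_vector_derivative_of_modulus[OF _ mass_diff_tendsto_0[OF g t, of "2 * L"]])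
    fix u :: real assume u: "u \<in> {0..1}"
    show "cmod (K u - K t - (u - t) *\<^sub>R 0) \<le> \<bar>u - t\<bar> * (2 * L * \<bar>mass g u - mass g t\<bar>)"
    proof (cases "t \<le> u")
      case True
      then show ?thesis using main[of t u] mass_mono[OF g, of t u] t u by simp
    next
      case False
      then show ?thesis using main[of u t] mass_mono[OF g, of u t] t u by (simp add: norm_minus_commute)
    qed
  qed
  then obtain c where "\<And>t. t \<in> {0..1} \<Longrightarrow> K t = c"
    using has_vector_derivative_zero_constant[of "{0..1::real}" K] by auto
  then have "K t = K 0" using t by simp
  then show ?thesis by (simp add: K_def algebra_simps)
qed

text \<open>Two integrations from 0 merged into one by the kernel \<open>t - s\<close>: the solution
  of \<open>y'' = g\<close>, in integrated form, with value and slope 0 at the left end.\<close>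

definition dint :: "(real \<Rightarrow> complex) \<Rightarrow> real \<Rightarrow> complex" where
  "dint g t = integral {0..t} (\<lambda>s. g s * of_real (t - s))"

lemma of_real_has_vector_derivative: "(complex_of_real has_vector_derivative 1) (at t within S)"
  by (simp add: has_vector_derivative_def has_derivative_of_real scaleR_conv_of_real)

lemma dint_has_derivative:
  assumes g: "g absolutely_integrable_on {0..1}" and t: "t \<in> {0..1}"
  shows "(dint g has_vector_derivative integral {0..t} g) (at t within {0..1})"
proof -
  let ?G = "\<lambda>t. integral {0..t} g"
  have G: "continuous_on {0..1} ?G"
    using g by (intro indefinite_integral_continuous_1) (simp add: absolutely_integrable_on_def)
  have eq: "dint g t = integral {0..t} ?G" if t: "t \<in> {0..1}" for t
  proof -
    have gt: "g absolutely_integrable_on {0..t}" using absolutely_integrable_subinterval[OF g, of 0 t] t by auto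
    have i1: "(\<lambda>s. g s * complex_of_real s) integrable_on {0..t}"
      using continuous_mult_absolutely_integrable[OF gt, of complex_of_real]
      by (simp add: absolutely_integrable_on_def continuous_on_of_real_id)
    have i2: "?G integrable_on {0..t}"
      by (rule integrable_continuous_real[OF continuous_on_subset[OF G]]) (use t in auto)
    have "dint g t = integral {0..t} (\<lambda>s. of_real t * g s - g s * of_real s)"
      unfolding dint_def by (intro integral_cong) (simp add: algebra_simps)
    also have "\<dots> = of_real t * ?G t - integral {0..t} (\<lambda>s. g s * of_real s)"
      using gt i1 by (subst integral_diff) (auto intro!: integrable_on_mult_right simp: absolutely_integrable_on_def)
    \<comment> \<open>Integration by parts against the function \<open>t\<close> turns the kernel
      form into the integral of the continuous \<open>?G\<close>, to which the fundamental theorem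
      applies.\<close>
    also have "of_real t * ?G t = of_real 0 * ?G 0 + integral {0..t} (\<lambda>s. 1 * ?G s + g s * of_real s)"
      by (rule indefinite_integral_product[OF g _ _ _ t]) (auto intro: of_real_has_vector_derivative)
    also have "\<dots> = integral {0..t} ?G + integral {0..t} (\<lambda>s. g s * of_real s)"
      using i1 i2 by (subst integral_add) auto
    finally show ?thesis by simp
  qed
  have "((\<lambda>t. integral {0..t} ?G) has_vector_derivative ?G t) (at t within {0..1})"
    by (rule integral_has_vector_derivative[OF G t])
  from has_vector_derivative_transform[OF t _ this, of "dint g"] show ?thesis using eq by blast
qed

lemma dv_eqI:
  assumes "(f has_vector_derivative D) (at t within {0..1})" "t \<in> {0..1}"
  shows "dv f t = D"
  unfolding dv_def using vector_derivative_within_closed_interval[of 0 1 t f D] assms by simp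

section \<open>The equation on an edge\<close>

text \<open>The predicate \<open>sol\<close> with \<open>q - lam\<close> replaced by an arbitrary
  complex coefficient, so that existence and uniqueness are argued with a single function
  \<open>p\<close>.\<close>

definition lsol :: "(real \<Rightarrow> complex) \<Rightarrow> (real \<Rightarrow> complex) \<Rightarrow> bool" where
  "lsol p y \<longleftrightarrow>
     (\<forall>t\<in>{0..1}. (y has_vector_derivative dv y t) (at t within {0..1})) \<and>
     (\<forall>t\<in>{0..1}. (\<lambda>s. p s * y s) integrable_on {0..t} \<and>
        dv y t = dv y 0 + integral {0..t} (\<lambda>s. p s * y s))"

lemma sol_eq_lsol: "sol q lam y \<longleftrightarrow> lsol (\<lambda>s. complex_of_real (q s) - lam) y"
  by (simp add: sol_def lsol_def)

lemma lsolD: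
  assumes "lsol p y" "t \<in> {0..1}"
  shows "(y has_vector_derivative dv y t) (at t within {0..1})"
    and "(\<lambda>s. p s * y s) integrable_on {0..t}"
    and "dv y t = dv y 0 + integral {0..t} (\<lambda>s. p s * y s)"
  using assms unfolding lsol_def by blast+

lemma lsol_continuous:
  assumes "lsol p y" shows "continuous_on {0..1} y"
proof (rule continuous_on_vector_derivative)
  show "(y has_vector_derivative dv y t) (at t within {0..1})" if "t \<in> {0..1}" for t
    using lsolD(1)[OF assms that] .
qed

lemma lsol_absolutely_integrable:
  assumes "p absolutely_integrable_on {0..1}" "lsol p y"
  shows "(\<lambda>s. p s * y s) absolutely_integrable_on {0..1}"
  using continuous_mult_absolutely_integrable[OF assms(1) lsol_continuous[OF assms(2)]] .

text \<open>The Volterra form can be differentiated at every point by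
  \<open>dint_has_derivative\<close>; this is the bridge from the Picard series to the definition of
  a solution.\<close>

lemma lsol_intro:
  assumes p: "p absolutely_integrable_on {0..1}" and c: "continuous_on {0..1} y"
    and y: "\<And>t. t \<in> {0..1} \<Longrightarrow> y t = a + b * of_real t + dint (\<lambda>s. p s * y s) t"
  shows "lsol p y" "y 0 = a" "\<And>t. t \<in> {0..1} \<Longrightarrow> dv y t = b + integral {0..t} (\<lambda>s. p s * y s)"
proof -
  let ?g = "\<lambda>s. p s * y s"
  have g: "?g absolutely_integrable_on {0..1}" by (rule continuous_mult_absolutely_integrable[OF p c])
  have d: "(y has_vector_derivative b + integral {0..t} ?g) (at t within {0..1})" if t: "t \<in> {0..1}" for t
  proof -
    have "((\<lambda>t. b * of_real t) has_vector_derivative b * 1) (at t within {0..1})"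
      by (intro has_vector_derivative_mult_right) (rule of_real_has_vector_derivative)
    then have "((\<lambda>t. a + b * of_real t + dint ?g t) has_vector_derivative 0 + b * 1 + integral {0..t} ?g) (at t within {0..1})"
      using t by (intro has_vector_derivative_add has_vector_derivative_const dint_has_derivative[OF g]) auto
    then show ?thesis
      using has_vector_derivative_transform[OF t y] by simp
  qed
  show dv: "dv y t = b + integral {0..t} ?g" if "t \<in> {0..1}" for t using dv_eqI[OF d[OF that] that] .
  show "y 0 = a" using y[of 0] by (simp add: dint_def)
  show "lsol p y" unfolding lsol_def
    using d dv absolutely_integrable_subinterval[OF g, of 0]
    by (auto simp: absolutely_integrable_on_def)
qed

lemma lsol_dv_continuous:
  assumes p: "p absolutely_integrable_on {0..1}" and y: "lsol p y"
  shows "continuous_on {0..1} (dv y)"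
proof -
  have "continuous_on {0..1} (\<lambda>t. dv y 0 + integral {0..t} (\<lambda>s. p s * y s))"
    using lsol_absolutely_integrable[OF p y]
    by (intro continuous_intros indefinite_integral_continuous_1) (simp add: absolutely_integrable_on_def)
  moreover have "dv y 0 + integral {0..t} (\<lambda>s. p s * y s) = dv y t" if "t \<in> {0..1}" for t
    using lsolD(3)[OF y that] by (rule sym)
  ultimately show ?thesis by (rule continuous_on_eq)
qed

text \<open>Integration by parts expresses \<open>y z'\<close> and \<open>z y'\<close> as initial
  values plus the integral of the same function \<open>y' z' + p y z\<close>, so their difference
  stays constant.\<close>

lemma wronskian_const:
  assumes p: "p absolutely_integrable_on {0..1}" and y: "lsol p y" and z: "lsol p z" and t: "t \<in> {0..1}"
  shows "y t * dv z t - dv y t * z t = y 0 * dv z 0 - dv y 0 * z 0"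
proof -
  have *: "x t * dv w t = x 0 * dv w 0 + integral {0..t} (\<lambda>s. dv x s * dv w s + p s * w s * x s)"
    if x: "lsol p x" and w: "lsol p w" for x w
    by (rule indefinite_integral_product[OF lsol_absolutely_integrable[OF p w] lsolD(3)[OF w] lsolD(1)[OF x] lsol_dv_continuous[OF p x] t])
  have "integral {0..t} (\<lambda>s. dv z s * dv y s + p s * y s * z s) = integral {0..t} (\<lambda>s. dv y s * dv z s + p s * z s * y s)"
    by (rule integral_cong) (simp add: mult_ac)
  then show ?thesis using *[OF y z] *[OF z y] by (simp add: mult.commute)
qed

text \<open>Uniqueness without a Gronwall estimate: the Wronskians of \<open>x\<close> with
  \<open>y\<close> and \<open>z\<close> are fixed by the data of \<open>x\<close> at 0, and the
  resulting linear system for \<open>x t\<close> and \<open>dv x t\<close> has determinant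
  1.\<close>

lemma wronskian_unit:
  assumes p: "p absolutely_integrable_on {0..1}" and y: "lsol p y" and z: "lsol p z"
    and i: "y 0 = 1" "dv y 0 = 0" "z 0 = 0" "dv z 0 = 1" and x: "lsol p x" and t: "t \<in> {0..1}"
  shows "x t = x 0 * y t + dv x 0 * z t" "dv x t = x 0 * dv y t + dv x 0 * dv z t"
proof -
  have w: "y t * dv z t - dv y t * z t = 1" using wronskian_const[OF p y z t] i by simp
  have a: "x t * dv z t - dv x t * z t = x 0" using wronskian_const[OF p x z t] i by simp
  have b: "y t * dv x t - dv y t * x t = dv x 0" using wronskian_const[OF p y x t] i by simp
  have "x 0 * y t + dv x 0 * z t = x t * (y t * dv z t - dv y t * z t)"
    unfolding a[symmetric] b[symmetric] by (simp add: algebra_simps)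
  then show "x t = x 0 * y t + dv x 0 * z t" using w by simp
  have "x 0 * dv y t + dv x 0 * dv z t = dv x t * (y t * dv z t - dv y t * z t)"
    unfolding a[symmetric] b[symmetric] by (simp add: algebra_simps)
  then show "dv x t = x 0 * dv y t + dv x 0 * dv z t" using w by simp
qed

section \<open>Existence by the Picard series\<close>

primrec picard :: "(real \<Rightarrow> complex) \<Rightarrow> complex \<Rightarrow> complex \<Rightarrow> nat \<Rightarrow> real \<Rightarrow> complex" where
  "picard p a b 0 = (\<lambda>t. a + b * of_real t)"
| "picard p a b (Suc n) = dint (\<lambda>s. p s * picard p a b n s)"

lemma dint_continuous:
  assumes "g absolutely_integrable_on {0..1}" shows "continuous_on {0..1} (dint g)"
  by (rule continuous_on_vector_derivative[OF dint_has_derivative[OF assms]])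

lemma picard_continuous:
  assumes p: "p absolutely_integrable_on {0..1}"
  shows "continuous_on {0..1} (picard p a b n)"
proof (induction n)
  case 0
  then show ?case by (auto intro!: continuous_intros)
next
  case (Suc n)
  then show ?case using dint_continuous[OF continuous_mult_absolutely_integrable[OF p Suc]] by simp
qed

text \<open>Comes from \<open>(n + 1) (t - s) s^n \<le> t^(n + 1) - s^(n + 1)\<close> by induction.
  It bounds the kernel times the preceding Picard bound and is the source of the factorial
  there.\<close>

lemma diff_mult_power_le:
  assumes "0 \<le> s" "s \<le> (t::real)"
  shows "(t - s) * s ^ n \<le> t ^ Suc n / real (Suc n)"
proof -
  have "real (Suc n) * ((t - s) * s ^ n) \<le> t ^ Suc n - s ^ Suc n"
  proof (induction n)
    case (Suc n)
    have "0 \<le> (t - s) * (t ^ Suc n - s ^ Suc n)"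
      using assms power_mono[of s t "Suc n"] by simp
    then have "s * (t ^ Suc n - s ^ Suc n) + (t - s) * s ^ Suc n \<le> t ^ Suc (Suc n) - s ^ Suc (Suc n)"
      by (simp add: algebra_simps)
    moreover have "real (Suc (Suc n)) * ((t - s) * s ^ Suc n) = s * (real (Suc n) * ((t - s) * s ^ n)) + (t - s) * s ^ Suc n"
      by (simp add: algebra_simps)
    ultimately show ?case using mult_left_mono[OF Suc assms(1)] by linarith
  qed simp
  moreover have "0 \<le> s ^ Suc n" using assms by simp
  ultimately have "real (Suc n) * ((t - s) * s ^ n) \<le> t ^ Suc n" by linarith
  then show ?thesis by (subst pos_le_divide_eq) (auto simp: mult.commute)
qed

text \<open>The functions \<open>picard\<close> are the increments of the iteration, to be summed.
  Integration against \<open>p\<close> contributes only a factor \<open>mass p 1\<close>; the factor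
  \<open>1 / (n + 1)\<close> is won pointwise from the kernel, by \<open>diff_mult_power_le\<close>,
  before integrating.\<close>

lemma picard_bound:
  assumes p: "p absolutely_integrable_on {0..1}" and t: "t \<in> {0..1}"
  shows "cmod (picard p a b n t) \<le> (cmod a + cmod b) * mass p 1 ^ n * t ^ n / fact n"
  using t
proof (induction n arbitrary: t)
  case 0
  have "cmod (a + b * of_real t) \<le> cmod a + cmod (b * of_real t)" by (rule norm_triangle_ineq)
  also have "\<dots> \<le> cmod a + cmod b"
    using 0 by (intro add_left_mono) (auto simp: norm_mult mult_left_le)
  finally show ?case by simp
next
  case (Suc n)
  let ?D = "(cmod a + cmod b) * mass p 1 ^ n / fact n"
  have m: "0 \<le> mass p 1" "0 \<le> mass p t" "mass p t \<le> mass p 1"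
    using mass_mono[OF p, of 0 1] mass_mono[OF p, of 0 t] mass_mono[OF p, of t 1] Suc.prems by (auto simp: mass_0)
  have D: "0 \<le> ?D" using m by (intro divide_nonneg_pos mult_nonneg_nonneg) auto
  have "picard p a b (Suc n) t = integral {0..t} (\<lambda>s. p s * (picard p a b n s * of_real (t - s)))"
    by (simp add: dint_def mult.assoc)
  also have "cmod \<dots> \<le> (?D * (t ^ Suc n / real (Suc n))) * (mass p t - mass p 0)"
  proof (rule integral_mult_le_mass[OF p])
    show "continuous_on {0..1} (\<lambda>s. picard p a b n s * of_real (t - s))"
      by (intro continuous_intros picard_continuous p)
    fix s assume s: "s \<in> {0..t}"
    have "cmod (picard p a b n s * of_real (t - s)) \<le> (?D * s ^ n) * (t - s)"
      unfolding norm_mult norm_of_real using s mult_right_mono[OF Suc.IH[of s], of "t - s"] Suc.prems by auto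
    also have "\<dots> = ?D * ((t - s) * s ^ n)" by simp
    also have "\<dots> \<le> ?D * (t ^ Suc n / real (Suc n))"
      using s by (intro mult_left_mono D diff_mult_power_le) auto
    finally show "cmod (picard p a b n s * of_real (t - s)) \<le> ?D * (t ^ Suc n / real (Suc n))" .
  qed (use Suc.prems in auto)
  also have "\<dots> \<le> (?D * (t ^ Suc n / real (Suc n))) * mass p 1"
    using m D Suc.prems by (intro mult_left_mono mult_nonneg_nonneg divide_nonneg_pos) (auto simp: mass_0)
  also have "\<dots> = (cmod a + cmod b) * mass p 1 ^ Suc n * t ^ Suc n / fact (Suc n)"
    by (simp add: field_simps)
  finally show ?case .
qed

text \<open>\<open>M\<close> is any number above the mass, so that one bound can serve all spectral
  parameters of a disc.\<close>

lemma picard_bound':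
  assumes p: "p absolutely_integrable_on {0..1}" and t: "t \<in> {0..1}" and M: "mass p 1 \<le> M"
  shows "cmod (picard p a b n t) \<le> (cmod a + cmod b) * (M ^ n / fact n)"
proof -
  have m: "0 \<le> mass p 1" using mass_mono[OF p, of 0 1] by (simp add: mass_0)
  have "cmod (picard p a b n t) \<le> (cmod a + cmod b) * mass p 1 ^ n * t ^ n / fact n"
    by (rule picard_bound[OF p t])
  also have "\<dots> \<le> (cmod a + cmod b) * M ^ n * 1 / fact n"
    using m M t by (intro divide_right_mono mult_mono power_mono power_le_one mult_nonneg_nonneg) auto
  finally show ?thesis by simp
qed

lemma summable_exp_bound: "summable (\<lambda>n. C * (M ^ n / fact n :: real))"
  using summable_mult[OF summable_exp[of M], of C] by (simp add: divide_inverse mult.commute)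

definition ivp :: "(real \<Rightarrow> complex) \<Rightarrow> complex \<Rightarrow> complex \<Rightarrow> real \<Rightarrow> complex" where
  "ivp p a b t = (\<Sum>n. picard p a b n t)"

lemma picard_uniform_limit:
  assumes p: "p absolutely_integrable_on {0..1}"
  shows "uniform_limit {0..1} (\<lambda>n t. \<Sum>i<n. picard p a b i t) (ivp p a b) sequentially"
  unfolding ivp_def[abs_def]
proof (rule Weierstrass_m_test)
  show "cmod (picard p a b n t) \<le> (cmod a + cmod b) * (mass p 1 ^ n / fact n)" if "t \<in> {0..1}" for n t
    by (rule picard_bound'[OF p that order_refl])
  show "summable (\<lambda>n. (cmod a + cmod b) * (mass p 1 ^ n / fact n))" by (rule summable_exp_bound)
qed

lemma ivp_continuous:
  assumes p: "p absolutely_integrable_on {0..1}"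
  shows "continuous_on {0..1} (ivp p a b)"
proof (rule uniform_limit_theorem[OF _ picard_uniform_limit[OF p]])
  show "\<forall>\<^sub>F n in sequentially. continuous_on {0..1} (\<lambda>t. \<Sum>i<n. picard p a b i t)"
    by (intro always_eventually allI continuous_on_sum picard_continuous[OF p])
qed simp

text \<open>The weight \<open>k\<close> covers two uses: \<open>k s = t - s\<close> yields the
  Volterra equation for the sum, \<open>k = 1\<close> yields its derivative as a series.\<close>

lemma picard_integral_sums:
  assumes p: "p absolutely_integrable_on {0..1}" and t: "t \<in> {0..1}" and k: "continuous_on {0..1} k"
  shows "(\<lambda>n. integral {0..t} (\<lambda>s. p s * picard p a b n s * k s)) sums
         integral {0..t} (\<lambda>s. p s * ivp p a b s * k s)"
  unfolding sums_def
proof (rule tendstoI)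
  fix e :: real assume e: "e > 0"
  let ?S = "\<lambda>n s. \<Sum>i<n. picard p a b i s"
  have pt: "p absolutely_integrable_on {0..t}" using absolutely_integrable_subinterval[OF p, of 0 t] t by auto
  have int: "(\<lambda>s. p s * h s * k s) integrable_on {0..t}" if "continuous_on {0..1} h" for h
  proof -
    have "continuous_on {0..t} (\<lambda>s. h s * k s)" using t
      by (intro continuous_on_subset[of "{0..1}" _ "{0..t}"] continuous_intros that k) auto
    from continuous_mult_absolutely_integrable[OF pt this]
    show ?thesis by (simp add: absolutely_integrable_on_def mult.assoc)
  qed
  obtain K where K: "K \<ge> 0" "\<And>s. s \<in> {0..1} \<Longrightarrow> cmod (k s) \<le> K" using continuous_bound01[OF k] by blast
  have m: "0 \<le> mass p t" using mass_mono[OF p, of 0 t] t by (simp add: mass_0)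
  \<comment> \<open>The summand 1 keeps the denominator positive when the weight or the mass
    vanishes.\<close>
  define d where "d = e / (K * mass p t + 1)"
  have Km: "K * mass p t + 1 > 0" using mult_nonneg_nonneg[OF K(1) m] by linarith
  have d: "d > 0" using e Km by (simp add: d_def)
  have "\<forall>\<^sub>F n in sequentially. \<forall>s\<in>{0..1}. dist (?S n s) (ivp p a b s) < d"
    using picard_uniform_limit[OF p] d by (rule uniform_limitD)
  then show "\<forall>\<^sub>F n in sequentially. dist (\<Sum>i<n. integral {0..t} (\<lambda>s. p s * picard p a b i s * k s))
      (integral {0..t} (\<lambda>s. p s * ivp p a b s * k s)) < e"
  proof (rule eventually_mono)
    fix n assume n: "\<forall>s\<in>{0..1}. dist (?S n s) (ivp p a b s) < d"
    have "(\<Sum>i<n. integral {0..t} (\<lambda>s. p s * picard p a b i s * k s)) =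
        integral {0..t} (\<lambda>s. \<Sum>i<n. p s * picard p a b i s * k s)"
      by (rule integral_sum[symmetric]) (auto intro: int picard_continuous p)
    also have "\<dots> = integral {0..t} (\<lambda>s. p s * ?S n s * k s)"
      by (rule integral_cong) (simp add: sum_distrib_left sum_distrib_right)
    finally have "(\<Sum>i<n. integral {0..t} (\<lambda>s. p s * picard p a b i s * k s)) -
        integral {0..t} (\<lambda>s. p s * ivp p a b s * k s) =
        integral {0..t} (\<lambda>s. p s * ?S n s * k s - p s * ivp p a b s * k s)"
      by (simp add: integral_diff int ivp_continuous p continuous_on_sum picard_continuous)
    also have "\<dots> = integral {0..t} (\<lambda>s. p s * ((?S n s - ivp p a b s) * k s))"
      by (rule integral_cong) (simp add: algebra_simps)
    also have "cmod \<dots> \<le> (d * K) * (mass p t - mass p 0)"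
    proof (rule integral_mult_le_mass[OF p])
      show "continuous_on {0..1} (\<lambda>s. (?S n s - ivp p a b s) * k s)"
        by (intro continuous_intros ivp_continuous picard_continuous p k)
      show "cmod ((?S n s - ivp p a b s) * k s) \<le> d * K" if "s \<in> {0..t}" for s
        unfolding norm_mult using n[rule_format, of s] K(2)[of s] that t K(1) d
        by (intro mult_mono) (auto simp: dist_norm)
    qed (use t in auto)
    also have "\<dots> < d * (K * mass p t + 1)" using d by (simp add: mass_0 algebra_simps)
    also have "\<dots> = e" using Km by (simp add: d_def)
    finally show "dist (\<Sum>i<n. integral {0..t} (\<lambda>s. p s * picard p a b i s * k s))
      (integral {0..t} (\<lambda>s. p s * ivp p a b s * k s)) < e" by (simp add: dist_norm)
  qed
qed

lemma ivp_integral_form: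
  assumes p: "p absolutely_integrable_on {0..1}" and t: "t \<in> {0..1}"
  shows "ivp p a b t = a + b * of_real t + dint (\<lambda>s. p s * ivp p a b s) t"
proof -
  have "(\<lambda>n. picard p a b (Suc n) t) sums dint (\<lambda>s. p s * ivp p a b s) t"
    unfolding picard.simps dint_def
    by (rule picard_integral_sums[OF p t]) (intro continuous_intros)
  from sums_Suc[OF this] show ?thesis
    unfolding ivp_def[of p a b t] by (simp add: sums_iff add.commute)
qed

text \<open>The last claim presents the derivative as a series of integrals of Picard terms, the
  form in which it is later seen to be entire in the spectral parameter.\<close>

lemma ivp_solution:
  assumes p: "p absolutely_integrable_on {0..1}"
  shows "lsol p (ivp p a b)" "ivp p a b 0 = a" "dv (ivp p a b) 0 = b"
    "\<And>t. t \<in> {0..1} \<Longrightarrow> dv (ivp p a b) t = b + (\<Sum>n. integral {0..t} (\<lambda>s. p s * picard p a b n s))"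
proof -
  have form: "ivp p a b t = a + b * of_real t + dint (\<lambda>s. p s * ivp p a b s) t" if "t \<in> {0..1}" for t
    by (rule ivp_integral_form[OF p that])
  show "lsol p (ivp p a b)" by (rule lsol_intro(1)[OF p ivp_continuous[OF p] form])
  show "ivp p a b 0 = a" by (rule lsol_intro(2)[OF p ivp_continuous[OF p] form])
  have d: "dv (ivp p a b) t = b + integral {0..t} (\<lambda>s. p s * ivp p a b s)" if "t \<in> {0..1}" for t
    by (rule lsol_intro(3)[OF p ivp_continuous[OF p] form that])
  show "dv (ivp p a b) 0 = b" using d[of 0] by simp
  fix t :: real assume t: "t \<in> {0..1}"
  have "(\<lambda>n. integral {0..t} (\<lambda>s. p s * picard p a b n s)) sums integral {0..t} (\<lambda>s. p s * ivp p a b s)"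
    using picard_integral_sums[OF p t, of "\<lambda>_. 1" a b] by simp
  then show "dv (ivp p a b) t = b + (\<Sum>n. integral {0..t} (\<lambda>s. p s * picard p a b n s))"
    using d[OF t] by (simp add: sums_iff)
qed

section \<open>Entire dependence on the spectral parameter\<close>

lemma entire_suminf:
  fixes f :: "nat \<Rightarrow> complex \<Rightarrow> complex"
  assumes hol: "\<And>n. f n holomorphic_on UNIV"
    and b: "\<And>r. \<exists>C M. \<forall>n z. cmod z \<le> r \<longrightarrow> cmod (f n z) \<le> C * (M ^ n / fact n)"
  shows "(\<lambda>z. \<Sum>n. f n z) holomorphic_on UNIV"
proof (rule holomorphic_uniform_sequence[where f = "\<lambda>n z. \<Sum>i<n. f i z"])
  show "(\<lambda>z. \<Sum>i<n. f i z) holomorphic_on UNIV" for n by (intro holomorphic_on_sum hol)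
  fix x :: complex
  obtain C M where CM: "\<And>n z. cmod z \<le> cmod x + 1 \<Longrightarrow> cmod (f n z) \<le> C * (M ^ n / fact n)"
    using b[of "cmod x + 1"] by blast
  have "uniform_limit (cball x 1) (\<lambda>n z. \<Sum>i<n. f i z) (\<lambda>z. \<Sum>n. f n z) sequentially"
  proof (rule Weierstrass_m_test[OF _ summable_exp_bound])
    fix n z assume z: "z \<in> cball x 1"
    have "cmod z \<le> cmod x + cmod (z - x)" by (metis add_diff_cancel_left' diff_add_cancel norm_triangle_ineq add.commute)
    then show "cmod (f n z) \<le> C * (M ^ n / fact n)" using z by (intro CM) (simp add: dist_norm norm_minus_commute)
  qed
  then show "\<exists>d>0. cball x d \<subseteq> UNIV \<and> uniform_limit (cball x d) (\<lambda>n z. \<Sum>i<n. f i z) (\<lambda>z. \<Sum>n. f n z) sequentially"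
    by (intro exI[of _ 1]) auto
qed simp

text \<open>Differentiation under the integral sign is avoided: every Picard term is a polynomial in
  \<open>z\<close> with coefficients continuous in \<open>t\<close>, and such a family is integrated
  coefficient by coefficient.\<close>

definition polyfam :: "(real \<Rightarrow> complex \<Rightarrow> complex) \<Rightarrow> bool" where
  "polyfam u \<longleftrightarrow> (\<exists>n c. (\<forall>m. continuous_on {0..1} (c m)) \<and>
     (\<forall>t\<in>{0..1}. \<forall>z. u t z = (\<Sum>m\<le>n. c m t * z ^ m)))"

lemma polynomial_integral:
  fixes Q :: "real \<Rightarrow> complex"
  assumes Q: "Q absolutely_integrable_on {0..1}" and c: "\<And>m. continuous_on {0..1} (c m)"
    and u: "\<And>t z. t \<in> {0..1} \<Longrightarrow> u t z = (\<Sum>m\<le>n. c m t * z ^ m)"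
    and t: "t \<in> {0..1}" and k: "continuous_on {0..1} k"
  shows "integral {0..t} (\<lambda>s. (Q s - z) * u s z * k s) =
    (\<Sum>m\<le>n. integral {0..t} (\<lambda>s. Q s * c m s * k s) * z ^ m) - (\<Sum>m\<le>n. integral {0..t} (\<lambda>s. c m s * k s) * z ^ Suc m)"
proof -
  have ck: "continuous_on {0..t} (\<lambda>s. c m s * k s)" for m
    by (rule continuous_on_subset[of "{0..1}"]) (use t in \<open>auto intro!: continuous_on_mult c k\<close>)
  have i1: "(\<lambda>s. Q s * c m s * k s) integrable_on {0..t}" for m
    using continuous_mult_absolutely_integrable[OF absolutely_integrable_subinterval[OF Q] ck] t
    by (auto simp: absolutely_integrable_on_def mult.assoc)
  have i2: "(\<lambda>s. c m s * k s) integrable_on {0..t}" for m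
    using integrable_continuous_real[OF ck] .
  have "integral {0..t} (\<lambda>s. (Q s - z) * u s z * k s) =
      integral {0..t} (\<lambda>s. (\<Sum>m\<le>n. Q s * c m s * k s * z ^ m) - (\<Sum>m\<le>n. c m s * k s * z ^ Suc m))"
    using t by (intro integral_cong) (simp add: u sum_distrib_left sum_distrib_right sum_subtractf[symmetric] algebra_simps)
  also have "\<dots> = integral {0..t} (\<lambda>s. \<Sum>m\<le>n. Q s * c m s * k s * z ^ m) - integral {0..t} (\<lambda>s. \<Sum>m\<le>n. c m s * k s * z ^ Suc m)"
    by (intro integral_diff integrable_sum integrable_on_mult_left i1 i2) auto
  also have "integral {0..t} (\<lambda>s. \<Sum>m\<le>n. Q s * c m s * k s * z ^ m) = (\<Sum>m\<le>n. integral {0..t} (\<lambda>s. Q s * c m s * k s) * z ^ m)"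
    by (subst integral_sum) (auto intro!: integrable_on_mult_left i1)
  also have "integral {0..t} (\<lambda>s. \<Sum>m\<le>n. c m s * k s * z ^ Suc m) = (\<Sum>m\<le>n. integral {0..t} (\<lambda>s. c m s * k s) * z ^ Suc m)"
    by (subst integral_sum) (auto intro!: integrable_on_mult_left i2 simp del: power_Suc)
  finally show ?thesis .
qed

lemma picard_polyfam:
  assumes Q: "Q absolutely_integrable_on {0..1}"
  shows "polyfam (\<lambda>t z. picard (\<lambda>s. Q s - z) a b n t)"
proof (induction n)
  case 0
  show ?case unfolding polyfam_def
    by (rule exI[of _ 0], rule exI[of _ "\<lambda>_ t. a + b * of_real t"]) (auto intro!: continuous_intros)
next
  case (Suc n)
  let ?u = "\<lambda>t z. picard (\<lambda>s. Q s - z) a b n t"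
  obtain d c where c: "\<And>m. continuous_on {0..1} (c m)"
    and u: "\<And>t z. t \<in> {0..1} \<Longrightarrow> ?u t z = (\<Sum>m\<le>d. c m t * z ^ m)"
    using Suc unfolding polyfam_def by blast
  \<comment> \<open>Multiplication by \<open>Q\<close> keeps the degree and leads to
    \<open>A\<close>; multiplication by \<open>z\<close> raises it by one and leads to
    \<open>B\<close>. Both are padded with zeros so that they share the range up to
    \<open>Suc d\<close>.\<close>
  define A where "A = (\<lambda>m. if m \<le> d then dint (\<lambda>s. Q s * c m s) else (\<lambda>_. 0))"
  define B where "B = (\<lambda>m. case m of 0 \<Rightarrow> (\<lambda>_. 0) | Suc i \<Rightarrow> dint (c i))"
  have "continuous_on {0..1} (A m)" for m unfolding A_def
    using dint_continuous[OF continuous_mult_absolutely_integrable[OF Q c]] by simp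
  moreover have "continuous_on {0..1} (B m)" for m unfolding B_def
    using dint_continuous absolutely_integrable_continuous_real[OF c] by (cases m) auto
  ultimately have cont: "continuous_on {0..1} (\<lambda>t. A m t - B m t)" for m
    by (intro continuous_intros)
  have "picard (\<lambda>s. Q s - z) a b (Suc n) t = (\<Sum>m\<le>Suc d. (A m t - B m t) * z ^ m)" if t: "t \<in> {0..1}" for t z
  proof -
    have "picard (\<lambda>s. Q s - z) a b (Suc n) t = (\<Sum>m\<le>d. dint (\<lambda>s. Q s * c m s) t * z ^ m) - (\<Sum>m\<le>d. dint (c m) t * z ^ Suc m)"
      unfolding picard.simps dint_def
      by (rule polynomial_integral[OF Q c u t]) (auto intro!: continuous_intros)
    moreover have "(\<Sum>m\<le>Suc d. A m t * z ^ m) = (\<Sum>m\<le>d. dint (\<lambda>s. Q s * c m s) t * z ^ m)"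
      by (simp add: A_def)
    moreover have "(\<Sum>m\<le>Suc d. B m t * z ^ m) = (\<Sum>m\<le>d. dint (c m) t * z ^ Suc m)"
      by (subst sum.atMost_Suc_shift) (simp add: B_def)
    ultimately show ?thesis by (simp add: left_diff_distrib sum_subtractf del: sum.atMost_Suc)
  qed
  then show ?case unfolding polyfam_def
    by (intro exI[of _ "Suc d"] exI[of _ "\<lambda>m t. A m t - B m t"]) (use cont in blast)
qed

lemma picard_entire:
  assumes Q: "Q absolutely_integrable_on {0..1}" and t: "t \<in> {0..1}"
  shows "(\<lambda>z. picard (\<lambda>s. Q s - z) a b n t) holomorphic_on UNIV"
    and "(\<lambda>z. integral {0..t} (\<lambda>s. (Q s - z) * picard (\<lambda>s. Q s - z) a b n s)) holomorphic_on UNIV"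
proof -
  let ?u = "\<lambda>t z. picard (\<lambda>s. Q s - z) a b n t"
  obtain d c where c: "\<And>m. continuous_on {0..1} (c m)"
    and u: "\<And>t z. t \<in> {0..1} \<Longrightarrow> ?u t z = (\<Sum>m\<le>d. c m t * z ^ m)"
    using picard_polyfam[OF Q, of a b n] unfolding polyfam_def by blast
  show "(\<lambda>z. ?u t z) holomorphic_on UNIV" unfolding u[OF t] by (intro holomorphic_intros)
  have "integral {0..t} (\<lambda>s. (Q s - z) * ?u s z) =
    (\<Sum>m\<le>d. integral {0..t} (\<lambda>s. Q s * c m s) * z ^ m) - (\<Sum>m\<le>d. integral {0..t} (\<lambda>s. c m s) * z ^ Suc m)" for z
    using polynomial_integral[OF Q c u t, of "\<lambda>_. 1" z] by simp
  then show "(\<lambda>z. integral {0..t} (\<lambda>s. (Q s - z) * ?u s z)) holomorphic_on UNIV"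
    by (simp only:) (intro holomorphic_intros)
qed

lemma absolutely_integrable_diff_const:
  fixes Q :: "real \<Rightarrow> complex"
  assumes "Q absolutely_integrable_on {0..1}"
  shows "(\<lambda>s. Q s - z) absolutely_integrable_on {0..1}"
  using assms by (intro set_integral_diff(1)) auto

lemma mass_diff_const_le:
  assumes Q: "Q absolutely_integrable_on {0..1}"
  shows "mass (\<lambda>s. Q s - z) 1 \<le> mass Q 1 + cmod z"
proof -
  have "integral {0..1} (\<lambda>s. cmod (Q s - z)) \<le> integral {0..1} (\<lambda>s. cmod (Q s) + cmod z)"
  proof (rule integral_le)
    show "(\<lambda>s. cmod (Q s - z)) integrable_on {0..1}"
      using absolutely_integrable_diff_const[OF Q] by (simp add: absolutely_integrable_on_def)
    show "(\<lambda>s. cmod (Q s) + cmod z) integrable_on {0..1}"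
      using Q by (intro integrable_add) (auto simp: absolutely_integrable_on_def)
  qed (rule norm_triangle_ineq4)
  also have "\<dots> = integral {0..1} (\<lambda>s. cmod (Q s)) + integral {0..1::real} (\<lambda>s. cmod z)"
    using Q by (intro integral_add) (auto simp: absolutely_integrable_on_def)
  finally show ?thesis by (simp add: mass_def)
qed

lemma ivp_entire:
  assumes Q: "Q absolutely_integrable_on {0..1}" and t: "t \<in> {0..1}"
  shows "(\<lambda>z. ivp (\<lambda>s. Q s - z) a b t) holomorphic_on UNIV"
    and "(\<lambda>z. dv (ivp (\<lambda>s. Q s - z) a b) t) holomorphic_on UNIV"
proof -
  note P = absolutely_integrable_diff_const[OF Q]
  have m: "mass (\<lambda>s. Q s - z) 1 \<le> mass Q 1 + r" if "cmod z \<le> r" for z r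
    using mass_diff_const_le[OF Q, of z] that by linarith
  show "(\<lambda>z. ivp (\<lambda>s. Q s - z) a b t) holomorphic_on UNIV"
    unfolding ivp_def
  proof (rule entire_suminf)
    show "\<exists>C M. \<forall>n z. cmod z \<le> r \<longrightarrow> cmod (picard (\<lambda>s. Q s - z) a b n t) \<le> C * (M ^ n / fact n)" for r
      using picard_bound'[OF P t m] by blast
  qed (rule picard_entire[OF Q t])
  have "(\<lambda>z. \<Sum>n. integral {0..t} (\<lambda>s. (Q s - z) * picard (\<lambda>s. Q s - z) a b n s)) holomorphic_on UNIV"
  proof (rule entire_suminf)
    fix r :: real
    let ?D = "cmod a + cmod b" and ?M = "mass Q 1 + r"
    have "cmod (integral {0..t} (\<lambda>s. (Q s - z) * picard (\<lambda>s. Q s - z) a b n s)) \<le> ?D * ?M * (?M ^ n / fact n)"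
      if z: "cmod z \<le> r" for n z
    proof -
      let ?p = "\<lambda>s. Q s - z"
      have mt: "0 \<le> mass ?p t" "mass ?p t \<le> mass ?p 1" "0 \<le> mass ?p 1"
        using mass_mono[OF P, of 0 t] mass_mono[OF P, of t 1] mass_mono[OF P, of 0 1] t by (auto simp: mass_0)
      have M: "0 \<le> ?M" using mt m[OF z] by linarith
      have "cmod (integral {0..t} (\<lambda>s. ?p s * picard ?p a b n s)) \<le> (?D * (?M ^ n / fact n)) * (mass ?p t - mass ?p 0)"
        using t by (intro integral_mult_le_mass[OF P] picard_continuous[OF P] picard_bound'[OF P _ m[OF z]]) auto
      also have "\<dots> \<le> (?D * (?M ^ n / fact n)) * ?M"
        using mt m[OF z] M by (intro mult_left_mono mult_nonneg_nonneg divide_nonneg_pos) (auto simp: mass_0)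
      finally show ?thesis by (simp add: mult.commute mult.left_commute)
    qed
    then show "\<exists>C M. \<forall>n z. cmod z \<le> r \<longrightarrow> cmod (integral {0..t} (\<lambda>s. (Q s - z) * picard (\<lambda>s. Q s - z) a b n s)) \<le> C * (M ^ n / fact n)"
      by blast
  qed (rule picard_entire[OF Q t])
  then show "(\<lambda>z. dv (ivp (\<lambda>s. Q s - z) a b) t) holomorphic_on UNIV"
    unfolding ivp_solution(4)[OF P t] by (intro holomorphic_intros)
qed

section \<open>Fundamental solutions of the Hill equation and the Dirichlet spectrum\<close>

locale hill =
  fixes q :: "real \<Rightarrow> real"
  assumes q: "L2_01_real q"
begin

abbreviation pot :: "complex \<Rightarrow> real \<Rightarrow> complex" where
  "pot lam \<equiv> (\<lambda>s. complex_of_real (q s) - lam)"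

lemma q_absolutely_integrable: "(\<lambda>s. complex_of_real (q s)) absolutely_integrable_on {0..1}"
proof (rule measurable_bounded_by_integrable_imp_absolutely_integrable)
  have "q \<in> borel_measurable (lebesgue_on {0..1})"
    using q unfolding L2_01_real_def by (simp add: measurable_on_iff_borel_measurable)
  then show "(\<lambda>s. complex_of_real (q s)) \<in> borel_measurable (lebesgue_on {0..1})" by measurable
  show "(\<lambda>s. 1 + (q s)\<^sup>2) integrable_on {0..1}"
    using q unfolding L2_01_real_def by (intro integrable_add) auto
  show "cmod (complex_of_real (q s)) \<le> 1 + (q s)\<^sup>2" for s
  proof -
    have "0 \<le> (\<bar>q s\<bar> - 1)\<^sup>2" by simp
    then have "2 * \<bar>q s\<bar> \<le> 1 + (q s)\<^sup>2" by (simp add: power2_eq_square algebra_simps)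
    then show ?thesis by simp
  qed
qed simp

lemmas pot_absolutely_integrable = absolutely_integrable_diff_const[OF q_absolutely_integrable]

definition sl :: "complex \<Rightarrow> complex \<Rightarrow> complex \<Rightarrow> real \<Rightarrow> complex" where
  "sl lam a b = ivp (pot lam) a b"

abbreviation th :: "complex \<Rightarrow> real \<Rightarrow> complex" where "th lam \<equiv> sl lam 1 0"
abbreviation ph :: "complex \<Rightarrow> real \<Rightarrow> complex" where "ph lam \<equiv> sl lam 0 1"

lemma sl_sol: "sol q lam (sl lam a b)" and sl_0: "sl lam a b 0 = a" and dv_sl_0: "dv (sl lam a b) 0 = b"
  using ivp_solution(1-3)[OF pot_absolutely_integrable] by (auto simp: sl_def sol_eq_lsol)

lemma sl_entire:
  assumes "t \<in> {0..1}"
  shows "(\<lambda>lam. sl lam a b t) holomorphic_on UNIV" "(\<lambda>lam. dv (sl lam a b) t) holomorphic_on UNIV"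
  unfolding sl_def using ivp_entire[OF q_absolutely_integrable assms] by auto

lemma sol_repr:
  assumes y: "sol q lam y" and t: "t \<in> {0..1}"
  shows "y t = y 0 * th lam t + dv y 0 * ph lam t"
    and "dv y t = y 0 * dv (th lam) t + dv y 0 * dv (ph lam) t"
  using wronskian_unit[OF pot_absolutely_integrable sl_sol[unfolded sol_eq_lsol] sl_sol[unfolded sol_eq_lsol] _ _ _ _ y[unfolded sol_eq_lsol] t]
  by (simp_all add: sl_0 dv_sl_0)

lemma wronskian_1: "th lam 1 * dv (ph lam) 1 - dv (th lam) 1 * ph lam 1 = 1"
  using wronskian_const[OF pot_absolutely_integrable sl_sol[unfolded sol_eq_lsol] sl_sol[unfolded sol_eq_lsol], of 1 lam 1 0 0 1]
  by (simp add: sl_0 dv_sl_0)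

text \<open>Every solution that vanishes at 0 is a multiple of \<open>ph lam\<close>, and
  \<open>ph lam\<close> is not identically zero because its slope at 0 is 1.\<close>

lemma dirichlet_spec_iff: "lam \<in> dirichlet_spec q \<longleftrightarrow> ph lam 1 = 0"
proof
  assume "lam \<in> dirichlet_spec q"
  then obtain y t where y: "sol q lam y" "y 0 = 0" "y 1 = 0" and t: "t \<in> {0..1}" "y t \<noteq> 0"
    unfolding dirichlet_spec_def by blast
  have "dv y 0 \<noteq> 0" using sol_repr(1)[OF y(1) t(1)] t(2) y(2) by auto
  then show "ph lam 1 = 0" using sol_repr(1)[OF y(1), of 1] y by simp
next
  assume *: "ph lam 1 = 0"
  have "\<exists>t\<in>{0..1}. ph lam t \<noteq> 0"
  proof (rule ccontr)
    assume "\<not> (\<exists>t\<in>{0..1}. ph lam t \<noteq> 0)"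
    then have z: "\<And>t. t \<in> {0..1} \<Longrightarrow> ph lam t = 0" by blast
    have "(ph lam has_vector_derivative 0) (at 0 within {0..1})"
      by (rule has_vector_derivative_transform[OF _ z has_vector_derivative_const]) auto
    then have "dv (ph lam) 0 = 0" by (rule dv_eqI) simp
    then show False by (simp add: dv_sl_0)
  qed
  then show "lam \<in> dirichlet_spec q" unfolding dirichlet_spec_def
    using * sl_sol[of lam 0 1] by (auto simp: sl_0)
qed

text \<open>\<open>phi_std\<close> is picked by a choice operator; by uniqueness any admissible
  choice has the same value at 1.\<close>

lemma phi1_eq: "phi1 q lam = ph lam 1"
proof -
  have "sol q lam (phi_std q lam) \<and> phi_std q lam 0 = 0 \<and> dv (phi_std q lam) 0 = 1"
    unfolding phi_std_def by (rule someI[of _ "ph lam"]) (simp add: sl_sol sl_0 dv_sl_0)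
  then show ?thesis unfolding phi1_def using sol_repr(1)[of lam "phi_std q lam" 1] by simp
qed

lemma open_resolvent: "open (- dirichlet_spec q)"
proof -
  have "continuous_on UNIV (\<lambda>lam. ph lam 1)"
    by (rule holomorphic_on_imp_continuous_on[OF sl_entire(1)]) simp
  then have "open ((\<lambda>lam. ph lam 1) -` (- {0}))" by (intro open_vimage) auto
  moreover have "(\<lambda>lam. ph lam 1) -` (- {0}) = - dirichlet_spec q" by (auto simp: dirichlet_spec_iff)
  ultimately show ?thesis by simp
qed

end

section \<open>Solutions on the reduced graph\<close>

locale tube = hill +
  fixes N k :: nat and a1 a2 :: real
begin

definition e1 :: complex where "e1 = exp (\<i> * of_real a1)"
definition e2 :: complex where "e2 = exp (\<i> * of_real a2)"
definition sk :: complex where "sk = exp (2 * pi * \<i> / of_nat N) ^ k"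
text \<open>The phase left on edge 4 after the vertex values have been rescaled: that edge starts at
  \<open>e1 * r n\<close> and ends at \<open>p n / (e1 * e2 * sk)\<close>.\<close>

definition kap :: complex where "kap = e1 * e1 * e2 * sk"

lemma nz: "e1 \<noteq> 0" "e2 \<noteq> 0" "sk \<noteq> 0" "kap \<noteq> 0" by (simp_all add: e1_def e2_def sk_def kap_def)

lemma exp_minus_e1: "exp (- \<i> * of_real a1) = 1 / e1"
  by (simp add: e1_def exp_minus inverse_eq_divide)

text \<open>Diagonal weights of the vertices: an edge that ends at a vertex contributes
  \<open>dv (ph lam) 1\<close>, an edge that starts there contributes \<open>th lam 1\<close>. Two
  edges end and one starts at the vertices of \<open>p\<close> and \<open>r\<close> (weight
  \<open>bb\<close>); one ends and two start at those of \<open>u\<close> and \<open>v\<close>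
  (weight \<open>cc\<close>).\<close>

definition bb :: "complex \<Rightarrow> complex" where "bb lam = 2 * dv (ph lam) 1 + th lam 1"
definition cc :: "complex \<Rightarrow> complex" where "cc lam = dv (ph lam) 1 + 2 * th lam 1"

text \<open>On an edge, Dirichlet data determine the solution off the Dirichlet spectrum.  In terms of the
  values \<open>p = e1 * y(n,1)(0)\<close>, \<open>r = y(n,4)(0) / e1\<close>, \<open>u = y(n,2)(0)\<close>, \<open>v = y(n,3)(0)\<close> at the vertices,
  the Kirchhoff conditions become the following recurrences, in which the denominator \<open>ph lam 1\<close>
  has cancelled.\<close>

definition vrec :: "complex \<Rightarrow> (int \<Rightarrow> complex) \<Rightarrow> (int \<Rightarrow> complex) \<Rightarrow> (int \<Rightarrow> complex) \<Rightarrow> (int \<Rightarrow> complex) \<Rightarrow> bool" where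
  "vrec lam p r u v \<longleftrightarrow> (\<forall>n.
     u n + u (n - 1) = bb lam * p n - kap * r n \<and>
     v n + v (n - 1) = bb lam * r n - p n / kap \<and>
     p (n + 1) + p n = cc lam * u n - v n / e2 \<and>
     r (n + 1) + r n = cc lam * v n - e2 * u n)"

text \<open>The state of level \<open>n\<close> is \<open>(p (n + 1), r (n + 1), u n, v n)\<close>,
  the values at both ends of the edges 5 and 6. These are the edges on which the monodromy matrix is
  read.\<close>

fun stepf :: "complex \<Rightarrow> complex \<times> complex \<times> complex \<times> complex \<Rightarrow> complex \<times> complex \<times> complex \<times> complex" where
  "stepf lam (p, r, u, v) = (let u' = bb lam * p - kap * r - u; v' = bb lam * r - p / kap - v in
     (cc lam * u' - v' / e2 - p, cc lam * v' - e2 * u' - r, u', v'))"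

fun stepb :: "complex \<Rightarrow> complex \<times> complex \<times> complex \<times> complex \<Rightarrow> complex \<times> complex \<times> complex \<times> complex" where
  "stepb lam (p, r, u, v) = (let p' = cc lam * u - v / e2 - p; r' = cc lam * v - e2 * u - r in
     (p', r', bb lam * p' - kap * r' - u, bb lam * r' - p' / kap - v))"

lemma stepf_stepb: "stepf lam (stepb lam x) = x"
  by (cases x) (simp add: Let_def)

lemma stepb_stepf: "stepb lam (stepf lam x) = x"
  by (cases x) (simp add: Let_def)

text \<open>A two-sided orbit, since the step is a composition of two involutions and so invertible
  for every \<open>lam\<close>, on the Dirichlet spectrum as well; only the nonzero constants
  \<open>kap\<close> and \<open>e2\<close> occur in denominators.\<close>

definition st :: "complex \<Rightarrow> complex \<times> complex \<times> complex \<times> complex \<Rightarrow> int \<Rightarrow> complex \<times> complex \<times> complex \<times> complex" where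
  "st lam x n = (if 0 \<le> n then (stepf lam ^^ nat n) x else (stepb lam ^^ nat (- n)) x)"

lemma st_step: "st lam x (n + 1) = stepf lam (st lam x n)"
proof (cases "0 \<le> n")
  case True
  then have "nat (n + 1) = Suc (nat n)" by simp
  then show ?thesis using True by (simp add: st_def)
next
  case False
  then have "nat (- n) = Suc (nat (- (n + 1)))" by simp
  then have "stepf lam (st lam x n) = (stepb lam ^^ nat (- (n + 1))) x"
    using False by (simp add: st_def stepf_stepb)
  then show ?thesis using False by (cases "n + 1 = 0") (auto simp: st_def)
qed

lemma st_0: "st lam x 0 = x"
  by (simp add: st_def)

lemma st_unique:
  assumes s: "\<And>n. z (n + 1) = stepf lam (z n)" and z: "z 0 = x"
  shows "z n = st lam x n"
proof (induction n rule: int_induct[of _ 0])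
  case base
  then show ?case by (simp add: z st_0)
next
  case (step1 i)
  then show ?case by (simp add: s st_step)
next
  case (step2 i)
  have "stepf lam (z (i - 1)) = stepf lam (st lam x (i - 1))"
    using s[of "i - 1"] st_step[of lam x "i - 1"] step2 by simp
  then show ?case by (metis stepb_stepf)
qed

text \<open>The shift of the index: \<open>p\<close> and \<open>r\<close> of level \<open>n\<close>
  are already contained in the state of level \<open>n - 1\<close>.\<close>

definition pS where "pS lam x n = fst (st lam x (n - 1))"
definition rS where "rS lam x n = fst (snd (st lam x (n - 1)))"
definition uS where "uS lam x n = fst (snd (snd (st lam x n)))"
definition vS where "vS lam x n = snd (snd (snd (st lam x n)))"

lemma st_components: "st lam x n = (pS lam x (n + 1), rS lam x (n + 1), uS lam x n, vS lam x n)"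
  by (simp add: pS_def rS_def uS_def vS_def)

lemma vrec_S: "vrec lam (pS lam x) (rS lam x) (uS lam x) (vS lam x)"
proof -
  have "uS lam x n + uS lam x (n - 1) = bb lam * pS lam x n - kap * rS lam x n \<and>
     vS lam x n + vS lam x (n - 1) = bb lam * rS lam x n - pS lam x n / kap \<and>
     pS lam x (n + 1) + pS lam x n = cc lam * uS lam x n - vS lam x n / e2 \<and>
     rS lam x (n + 1) + rS lam x n = cc lam * vS lam x n - e2 * uS lam x n" for n
  proof -
    have "(pS lam x (n + 1), rS lam x (n + 1), uS lam x n, vS lam x n) =
        stepf lam (pS lam x n, rS lam x n, uS lam x (n - 1), vS lam x (n - 1))"
      using st_step[of lam x "n - 1"] unfolding st_components by (simp del: stepf.simps)
    then have u: "uS lam x n = bb lam * pS lam x n - kap * rS lam x n - uS lam x (n - 1)"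
      and v: "vS lam x n = bb lam * rS lam x n - pS lam x n / kap - vS lam x (n - 1)"
      and p: "pS lam x (n + 1) = cc lam * (bb lam * pS lam x n - kap * rS lam x n - uS lam x (n - 1))
        - (bb lam * rS lam x n - pS lam x n / kap - vS lam x (n - 1)) / e2 - pS lam x n"
      and r: "rS lam x (n + 1) = cc lam * (bb lam * rS lam x n - pS lam x n / kap - vS lam x (n - 1))
        - e2 * (bb lam * pS lam x n - kap * rS lam x n - uS lam x (n - 1)) - rS lam x n"
      unfolding stepf.simps Let_def prod.inject by blast+
    show ?thesis using u v p[folded u v] r[folded u v] by (metis diff_add_cancel)
  qed
  then show ?thesis unfolding vrec_def by blast
qed

lemma vrec_unique:
  assumes "vrec lam p r u v"
  shows "(p (n + 1), r (n + 1), u n, v n) = st lam (p 1, r 1, u 0, v 0) n"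
proof (rule st_unique)
  fix n
  have e: "u (n + 1) = bb lam * p (n + 1) - kap * r (n + 1) - u n"
    "v (n + 1) = bb lam * r (n + 1) - p (n + 1) / kap - v n"
    "p (n + 1 + 1) = cc lam * u (n + 1) - v (n + 1) / e2 - p (n + 1)"
    "r (n + 1 + 1) = cc lam * v (n + 1) - e2 * u (n + 1) - r (n + 1)"
  proof -
    have "u (n + 1) + u (n + 1 - 1) = bb lam * p (n + 1) - kap * r (n + 1)"
      "v (n + 1) + v (n + 1 - 1) = bb lam * r (n + 1) - p (n + 1) / kap"
      "p (n + 1 + 1) + p (n + 1) = cc lam * u (n + 1) - v (n + 1) / e2"
      "r (n + 1 + 1) + r (n + 1) = cc lam * v (n + 1) - e2 * u (n + 1)"
      using assms unfolding vrec_def by blast+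
    then show "u (n + 1) = bb lam * p (n + 1) - kap * r (n + 1) - u n"
      "v (n + 1) = bb lam * r (n + 1) - p (n + 1) / kap - v n"
      "p (n + 1 + 1) = cc lam * u (n + 1) - v (n + 1) / e2 - p (n + 1)"
      "r (n + 1 + 1) = cc lam * v (n + 1) - e2 * u (n + 1) - r (n + 1)"
      by (metis add_diff_cancel_right')+
  qed
  show "(p (n + 1 + 1), r (n + 1 + 1), u (n + 1), v (n + 1)) = stepf lam (p (n + 1), r (n + 1), u n, v n)"
    unfolding stepf.simps Let_def e(1)[symmetric] e(2)[symmetric] using e(3,4) by simp
qed simp

section \<open>From vertex values to families on the graph and back\<close>

definition ed :: "complex \<Rightarrow> complex \<Rightarrow> complex \<Rightarrow> real \<Rightarrow> complex" where
  "ed lam A B = sl lam A ((B - th lam 1 * A) / ph lam 1)"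

text \<open>The Dirichlet-to-Neumann map of an edge. For the right end the Wronskian identity
  eliminates \<open>dv (th lam) 1\<close>, which is why the recurrence involves
  \<open>th lam 1\<close> and \<open>dv (ph lam) 1\<close> alone.\<close>

lemma sol_dirichlet:
  assumes lam: "lam \<notin> dirichlet_spec q" and y: "sol q lam y"
  shows "dv y 0 = (y 1 - th lam 1 * y 0) / ph lam 1" "dv y 1 = (dv (ph lam) 1 * y 1 - y 0) / ph lam 1"
proof -
  have nz: "ph lam 1 \<noteq> 0" using lam by (simp add: dirichlet_spec_iff)
  have r: "y 1 = y 0 * th lam 1 + dv y 0 * ph lam 1" "dv y 1 = y 0 * dv (th lam) 1 + dv y 0 * dv (ph lam) 1"
    using sol_repr[OF y, of 1] by auto
  show "dv y 0 = (y 1 - th lam 1 * y 0) / ph lam 1" using r(1) nz by (simp add: field_simps)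
  have "dv (ph lam) 1 * y 1 - y 0 * (th lam 1 * dv (ph lam) 1 - dv (th lam) 1 * ph lam 1) = dv y 1 * ph lam 1"
    unfolding r by (simp add: algebra_simps)
  then show "dv y 1 = (dv (ph lam) 1 * y 1 - y 0) / ph lam 1"
    unfolding wronskian_1 using nz by (simp add: field_simps)
qed

lemma sol_dirichlet_unique:
  assumes "lam \<notin> dirichlet_spec q" "sol q lam y" "sol q lam z" "y 0 = z 0" "y 1 = z 1" "t \<in> {0..1}"
  shows "y t = z t"
  using sol_repr(1)[OF assms(2,6)] sol_repr(1)[OF assms(3,6)] sol_dirichlet(1)[OF assms(1,2)] sol_dirichlet(1)[OF assms(1,3)] assms(4,5)
  by simp

lemma ed_sol: "sol q lam (ed lam A B)" and ed_0: "ed lam A B 0 = A"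
  by (simp_all add: ed_def sl_sol sl_0)

lemma ed_1:
  assumes "lam \<notin> dirichlet_spec q" shows "ed lam A B 1 = B"
  using sol_repr(1)[OF ed_sol, of 1 lam A B] assms
  by (simp add: ed_0 dirichlet_spec_iff) (simp add: ed_def dv_sl_0 field_simps)

lemma dv_ed:
  assumes "lam \<notin> dirichlet_spec q"
  shows "dv (ed lam A B) 0 = (B - th lam 1 * A) / ph lam 1" "dv (ed lam A B) 1 = (dv (ph lam) 1 * B - A) / ph lam 1"
  using sol_dirichlet[OF assms ed_sol[of lam A B]] by (simp_all add: ed_0 ed_1[OF assms])

text \<open>The phases are distributed over the end values so that all conditions of
  \<open>BC\<close> on values hold identically off the Dirichlet spectrum; only the Kirchhoff
  conditions restrict \<open>p\<close>, \<open>r\<close>, \<open>u\<close>,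
  \<open>v\<close>.\<close>

definition gfam_of :: "complex \<Rightarrow> (int \<Rightarrow> complex) \<Rightarrow> (int \<Rightarrow> complex) \<Rightarrow> (int \<Rightarrow> complex) \<Rightarrow> (int \<Rightarrow> complex) \<Rightarrow> gfam" where
  "gfam_of lam p r u v n j =
     (if j = 1 then ed lam (p n / e1) (u n / e1)
      else if j = 2 then ed lam (u n) (v n / e2)
      else if j = 3 then ed lam (v n) (r n)
      else if j = 4 then ed lam (e1 * r n) (p n / (e1 * e2 * sk))
      else if j = 5 then ed lam (u n) (p (n + 1))
      else ed lam (v n) (r (n + 1)))"

lemma gfam_of_simps:
  "gfam_of lam p r u v n 1 = ed lam (p n / e1) (u n / e1)"
  "gfam_of lam p r u v n 2 = ed lam (u n) (v n / e2)"
  "gfam_of lam p r u v n 3 = ed lam (v n) (r n)"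
  "gfam_of lam p r u v n 4 = ed lam (e1 * r n) (p n / (e1 * e2 * sk))"
  "gfam_of lam p r u v n 5 = ed lam (u n) (p (n + 1))"
  "gfam_of lam p r u v n 6 = ed lam (v n) (r (n + 1))"
  by (simp_all add: gfam_of_def)

lemma BC_iff: "BC N a1 a2 k y \<longleftrightarrow> (\<forall>n.
     e1 * y n 1 1 = y n 2 0 \<and> y n 2 0 = y n 5 0 \<and>
     e2 * y n 2 1 = y n 3 0 \<and> y n 3 0 = y n 6 0 \<and>
     e1 * y n 3 1 = y n 4 0 \<and> y n 4 0 = e1 * y (n - 1) 6 1 \<and>
     e2 * sk * y n 4 1 = y n 1 0 \<and> y n 1 0 = 1 / e1 * y (n - 1) 5 1 \<and>
     e1 * dv (y n 1) 1 - dv (y n 2) 0 - dv (y n 5) 0 = 0 \<and>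
     e2 * dv (y n 2) 1 - dv (y n 3) 0 - dv (y n 6) 0 = 0 \<and>
     e1 * dv (y n 3) 1 - dv (y n 4) 0 + e1 * dv (y (n - 1) 6) 1 = 0 \<and>
     e2 * sk * dv (y n 4) 1 - dv (y n 1) 0 + 1 / e1 * dv (y (n - 1) 5) 1 = 0)"
  unfolding BC_def Let_def e1_def[symmetric] e2_def[symmetric] sk_def[symmetric] exp_minus_e1 ..

lemma gfam_of_gsol:
  assumes lam: "lam \<notin> dirichlet_spec q" and rec: "vrec lam p r u v"
  shows "gsol N q a1 a2 k lam (gfam_of lam p r u v)"
proof -
  have P: "ph lam 1 \<noteq> 0" using lam by (simp add: dirichlet_spec_iff)
  let ?T = "th lam 1" and ?P = "ph lam 1" and ?D = "dv (ph lam) 1"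
  have s: "u (n - 1) = bb lam * p n - kap * r n - u n" "v (n - 1) = bb lam * r n - p n / kap - v n"
     "p (n + 1) = cc lam * u n - v n / e2 - p n" "r (n + 1) = cc lam * v n - e2 * u n - r n" for n
    using rec[unfolded vrec_def, rule_format, of n] by (simp_all add: algebra_simps)
  \<comment> \<open>\<open>k1\<close> to \<open>k4\<close> are the Kirchhoff sums at the vertices of
    \<open>u\<close>, \<open>v\<close>, \<open>r\<close> and \<open>p\<close>, with the end
    derivatives from \<open>dv_ed\<close> inserted.\<close>
  have k1: "e1 * ((?D * (u n / e1) - p n / e1) / ?P) - (v n / e2 - ?T * u n) / ?P - (p (n + 1) - ?T * u n) / ?P = 0" for n
    unfolding s cc_def using P nz by (simp add: field_simps)
  have k2: "e2 * ((?D * (v n / e2) - u n) / ?P) - (r n - ?T * v n) / ?P - (r (n + 1) - ?T * v n) / ?P = 0" for n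
    unfolding s cc_def using P nz by (simp add: field_simps)
  have k3: "e1 * ((?D * r n - v n) / ?P) - (p n / (e1 * e2 * sk) - ?T * (e1 * r n)) / ?P + e1 * ((?D * r n - v (n - 1)) / ?P) = 0" for n
    unfolding s bb_def kap_def using P nz by (simp add: field_simps)
  have k4: "e2 * sk * ((?D * (p n / (e1 * e2 * sk)) - e1 * r n) / ?P) - (u n / e1 - ?T * (p n / e1)) / ?P + 1 / e1 * ((?D * p n - u (n - 1)) / ?P) = 0" for n
    unfolding s bb_def kap_def using P nz by (simp add: field_simps)
  have "BC N a1 a2 k (gfam_of lam p r u v)"
    unfolding BC_iff gfam_of_def
    using k1 k2 k3 k4 nz by (simp add: ed_0 ed_1[OF lam] dv_ed[OF lam])
  moreover have "sol q lam (gfam_of lam p r u v n j)" for n j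
    by (simp add: gfam_of_def ed_sol)
  ultimately show ?thesis by (simp add: gsol_def)
qed

text \<open>The converse passage: any solution is recovered from its vertex values. The last two
  claims express the left-end values of the edges 5 and 6 by Cauchy data at their right ends, so
  that these data determine an initial state.\<close>

lemma gsol_vrec:
  assumes lam: "lam \<notin> dirichlet_spec q" and y: "gsol N q a1 a2 k lam y"
  defines "p \<equiv> \<lambda>n. e1 * y n 1 0" and "r \<equiv> \<lambda>n. y n 4 0 / e1" and "u \<equiv> \<lambda>n. y n 2 0" and "v \<equiv> \<lambda>n. y n 3 0"
  shows "vrec lam p r u v" "agree y (gfam_of lam p r u v)"
    "p 1 = y 0 5 1" "r 1 = y 0 6 1"
    "u 0 = dv (ph lam) 1 * y 0 5 1 - ph lam 1 * dv (y 0 5) 1"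
    "v 0 = dv (ph lam) 1 * y 0 6 1 - ph lam 1 * dv (y 0 6) 1"
proof -
  have P: "ph lam 1 \<noteq> 0" using lam by (simp add: dirichlet_spec_iff)
  have sl: "sol q lam (y n j)" if "j \<in> {1..6}" for n j using y that by (simp add: gsol_def)
  note d = sol_dirichlet[OF lam sl]
  have B: "BC N a1 a2 k y" using y by (simp add: gsol_def)
  note b = B[unfolded BC_iff, rule_format]
  have ends: "y n 1 0 = p n / e1" "y n 1 1 = u n / e1" "y n 2 0 = u n" "y n 2 1 = v n / e2"
     "y n 3 0 = v n" "y n 3 1 = r n" "y n 4 0 = e1 * r n" "y n 4 1 = p n / (e1 * e2 * sk)"
     "y n 5 0 = u n" "y n 5 1 = p (n + 1)" "y n 6 0 = v n" "y n 6 1 = r (n + 1)" for n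
  proof -
    have i: "x = w / c" if "c * x = w" "c \<noteq> 0" for x w c :: complex using that by auto
    have bn: "e1 * y n 1 1 = y n 2 0" "y n 2 0 = y n 5 0" "e2 * y n 2 1 = y n 3 0" "y n 3 0 = y n 6 0"
        "e1 * y n 3 1 = y n 4 0" "(e2 * sk) * y n 4 1 = y n 1 0"
      and bm: "y (n + 1) 4 0 = e1 * y (n + 1 - 1) 6 1" "y (n + 1) 1 0 = 1 / e1 * y (n + 1 - 1) 5 1"
      using b by blast+
    show "y n 1 0 = p n / e1" "y n 4 0 = e1 * r n" "y n 2 0 = u n" "y n 3 0 = v n"
      by (simp_all add: p_def r_def u_def v_def nz)
    show "y n 5 0 = u n" "y n 6 0 = v n" using bn by (simp_all add: u_def v_def)
    show "y n 1 1 = u n / e1" unfolding u_def by (rule i[OF bn(1) nz(1)])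
    show "y n 2 1 = v n / e2" unfolding v_def by (rule i[OF bn(3) nz(2)])
    show "y n 3 1 = r n" unfolding r_def by (rule i[OF bn(5) nz(1)])
    have "y n 4 1 = y n 1 0 / (e2 * sk)" using i[OF bn(6)] nz by simp
    then show "y n 4 1 = p n / (e1 * e2 * sk)" using nz(1) by (simp add: p_def mult.assoc)
    show "y n 5 1 = p (n + 1)" using bm nz(1) by (simp add: p_def)
    show "y n 6 1 = r (n + 1)" using bm nz(1) by (simp add: r_def)
  qed
  show "agree y (gfam_of lam p r u v)"
    unfolding agree_def
  proof (intro allI ballI)
    fix n j and t :: real assume j: "j \<in> {1..6::nat}" and t: "t \<in> {0..1}"
    show "y n j t = gfam_of lam p r u v n j t"
    proof (rule sol_dirichlet_unique[OF lam sl[OF j] _ _ _ t])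
      show "sol q lam (gfam_of lam p r u v n j)" by (simp add: gfam_of_def ed_sol)
      have "j = 1 \<or> j = 2 \<or> j = 3 \<or> j = 4 \<or> j = 5 \<or> j = 6" using j by auto
      then show "y n j 0 = gfam_of lam p r u v n j 0" "y n j 1 = gfam_of lam p r u v n j 1"
        by (elim disjE; hypsubst; simp only: gfam_of_simps ends ed_0 ed_1[OF lam])+
    qed
  qed
  let ?T = "th lam 1" and ?P = "ph lam 1" and ?D = "dv (ph lam) 1"
  show "vrec lam p r u v" unfolding vrec_def
  proof
    fix n
    have e: "p (n - 1 + 1) = p n" "r (n - 1 + 1) = r n" by simp_all
    have dd: "dv (y n j) 0 = (y n j 1 - ?T * y n j 0) / ?P" "dv (y n j) 1 = (?D * y n j 1 - y n j 0) / ?P"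
      if "j \<in> {1..6}" for n j using d[OF that] by auto
    have m: "(1::nat) \<in> {1..6}" "(2::nat) \<in> {1..6}" "(3::nat) \<in> {1..6}" "(4::nat) \<in> {1..6}" "(5::nat) \<in> {1..6}" "(6::nat) \<in> {1..6}"
      by auto
    note bd = b[of n, unfolded dd[OF m(1)] dd[OF m(2)] dd[OF m(3)] dd[OF m(4)] dd[OF m(5)] dd[OF m(6)] ends e]
    have k: "e1 * ((?D * (u n / e1) - p n / e1) / ?P) - (v n / e2 - ?T * u n) / ?P - (p (n + 1) - ?T * u n) / ?P = 0"
      "e2 * ((?D * (v n / e2) - u n) / ?P) - (r n - ?T * v n) / ?P - (r (n + 1) - ?T * v n) / ?P = 0"
      "e1 * ((?D * r n - v n) / ?P) - (p n / (e1 * e2 * sk) - ?T * (e1 * r n)) / ?P + e1 * ((?D * r n - v (n - 1)) / ?P) = 0"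
      "e2 * sk * ((?D * (p n / (e1 * e2 * sk)) - e1 * r n) / ?P) - (u n / e1 - ?T * (p n / e1)) / ?P + 1 / e1 * ((?D * p n - u (n - 1)) / ?P) = 0"
      using bd by blast+
    show "u n + u (n - 1) = bb lam * p n - kap * r n \<and> v n + v (n - 1) = bb lam * r n - p n / kap \<and>
        p (n + 1) + p n = cc lam * u n - v n / e2 \<and> r (n + 1) + r n = cc lam * v n - e2 * u n"
    \<comment> \<open>Each recurrence is one Kirchhoff sum multiplied by \<open>?P\<close> and,
      where phases occur, by \<open>e1\<close> or its inverse.\<close>
    proof (intro conjI)
      show "u n + u (n - 1) = bb lam * p n - kap * r n"
      proof -
        have "bb lam * p n - kap * r n - (u n + u (n - 1)) = (e1 * ?P) * (e2 * sk * ((?D * (p n / (e1 * e2 * sk)) - e1 * r n) / ?P)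
            - (u n / e1 - ?T * (p n / e1)) / ?P + 1 / e1 * ((?D * p n - u (n - 1)) / ?P))"
          unfolding bb_def kap_def using P nz by (simp add: field_simps)
        then show ?thesis unfolding k(4) by simp
      qed
      show "v n + v (n - 1) = bb lam * r n - p n / kap"
      proof -
        have "bb lam * r n - p n / kap - (v n + v (n - 1)) = (?P / e1) * (e1 * ((?D * r n - v n) / ?P) - (p n / (e1 * e2 * sk) - ?T * (e1 * r n)) / ?P + e1 * ((?D * r n - v (n - 1)) / ?P))"
          unfolding bb_def kap_def using P nz by (simp add: field_simps)
        then show ?thesis unfolding k(3) by simp
      qed
      show "p (n + 1) + p n = cc lam * u n - v n / e2"
      proof -
        have "cc lam * u n - v n / e2 - (p (n + 1) + p n) = ?P * (e1 * ((?D * (u n / e1) - p n / e1) / ?P) - (v n / e2 - ?T * u n) / ?P - (p (n + 1) - ?T * u n) / ?P)"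
          unfolding cc_def using P nz by (simp add: field_simps)
        then show ?thesis unfolding k(1) by simp
      qed
      show "r (n + 1) + r n = cc lam * v n - e2 * u n"
      proof -
        have "cc lam * v n - e2 * u n - (r (n + 1) + r n) = ?P * (e2 * ((?D * (v n / e2) - u n) / ?P) - (r n - ?T * v n) / ?P - (r (n + 1) - ?T * v n) / ?P)"
          unfolding cc_def using P nz by (simp add: field_simps)
        then show ?thesis unfolding k(2) by simp
      qed
    qed
  qed
  show "p 1 = y 0 5 1" "r 1 = y 0 6 1" unfolding ends by simp_all
  show "u 0 = ?D * y 0 5 1 - ?P * dv (y 0 5) 1" "v 0 = ?D * y 0 6 1 - ?P * dv (y 0 6) 1"
    using P d(2)[of 5 0] d(2)[of 6 0] ends[of 0] by simp_all
qed

text \<open>The parameters are Cauchy data at the right ends of the edges 5 and 6 of level 0. The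
  last two entries of the initial state are the left-end values, found by solving
  \<open>sol_dirichlet\<close> for them.\<close>

definition gs :: "complex \<Rightarrow> complex \<Rightarrow> complex \<Rightarrow> complex \<Rightarrow> complex \<Rightarrow> gfam" where
  "gs lam x5 x6 d5 d6 = (let x = (x5, x6, dv (ph lam) 1 * x5 - ph lam 1 * d5, dv (ph lam) 1 * x6 - ph lam 1 * d6)
     in gfam_of lam (pS lam x) (rS lam x) (uS lam x) (vS lam x))"

lemma gs_gsol:
  assumes lam: "lam \<notin> dirichlet_spec q"
  shows "gsol N q a1 a2 k lam (gs lam x5 x6 d5 d6)"
  unfolding gs_def Let_def by (rule gfam_of_gsol[OF lam vrec_S])

lemma gs_data:
  assumes lam: "lam \<notin> dirichlet_spec q"
  shows "gs lam x5 x6 d5 d6 0 5 1 = x5" "gs lam x5 x6 d5 d6 0 6 1 = x6"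
    "dv (gs lam x5 x6 d5 d6 0 5) 1 = d5" "dv (gs lam x5 x6 d5 d6 0 6) 1 = d6"
  using lam st_components[of lam _ 0]
  by (simp_all add: gs_def gfam_of_def Let_def ed_1 dv_ed dirichlet_spec_iff pS_def rS_def uS_def vS_def st_0 field_simps)

lemma gs_unique:
  assumes lam: "lam \<notin> dirichlet_spec q" and y: "gsol N q a1 a2 k lam y"
    and d: "y 0 5 1 = x5" "y 0 6 1 = x6" "dv (y 0 5) 1 = d5" "dv (y 0 6) 1 = d6"
  shows "agree y (gs lam x5 x6 d5 d6)"
proof -
  let ?p = "\<lambda>n. e1 * y n 1 0" and ?r = "\<lambda>n. y n 4 0 / e1" and ?u = "\<lambda>n. y n 2 0" and ?v = "\<lambda>n. y n 3 0"
  let ?x = "(x5, x6, dv (ph lam) 1 * x5 - ph lam 1 * d5, dv (ph lam) 1 * x6 - ph lam 1 * d6)"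
  note g = gsol_vrec[OF lam y]
  have *: "(?p (n + 1), ?r (n + 1), ?u n, ?v n) = st lam ?x n" for n
    using vrec_unique[OF g(1), of n] unfolding g(3-6) d .
  have "?p n = pS lam ?x n" "?r n = rS lam ?x n" "?u n = uS lam ?x n" "?v n = vS lam ?x n" for n
    using *[of "n - 1"] *[of n] unfolding st_components by simp_all
  then have "?p = pS lam ?x" "?r = rS lam ?x" "?u = uS lam ?x" "?v = vS lam ?x" by blast+
  then show ?thesis using g(2) unfolding gs_def Let_def by simp
qed

lemma gs_level_1:
  assumes lam: "lam \<notin> dirichlet_spec q"
    and s: "stepf lam (x5, x6, dv (ph lam) 1 * x5 - ph lam 1 * d5, dv (ph lam) 1 * x6 - ph lam 1 * d6) = (p, r, u, v)"
  shows "gs lam x5 x6 d5 d6 1 5 1 = p" "gs lam x5 x6 d5 d6 1 6 1 = r"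
    "dv (gs lam x5 x6 d5 d6 1 5) 1 = (dv (ph lam) 1 * p - u) / ph lam 1"
    "dv (gs lam x5 x6 d5 d6 1 6) 1 = (dv (ph lam) 1 * r - v) / ph lam 1"
proof -
  let ?x = "(x5, x6, dv (ph lam) 1 * x5 - ph lam 1 * d5, dv (ph lam) 1 * x6 - ph lam 1 * d6)"
  have "st lam ?x 1 = (p, r, u, v)" using st_step[of lam ?x 0] s by (simp add: st_0)
  then show "gs lam x5 x6 d5 d6 1 5 1 = p" "gs lam x5 x6 d5 d6 1 6 1 = r"
    "dv (gs lam x5 x6 d5 d6 1 5) 1 = (dv (ph lam) 1 * p - u) / ph lam 1"
    "dv (gs lam x5 x6 d5 d6 1 6) 1 = (dv (ph lam) 1 * r - v) / ph lam 1"
    by (simp_all add: gs_def gfam_of_def Let_def ed_1[OF lam] dv_ed[OF lam] pS_def rS_def uS_def vS_def)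
qed

section \<open>Analyticity off the Dirichlet spectrum\<close>

lemma holomorphic_data:
  "(\<lambda>lam. th lam 1) holomorphic_on A" "(\<lambda>lam. ph lam 1) holomorphic_on A"
  "(\<lambda>lam. dv (ph lam) 1) holomorphic_on A" "bb holomorphic_on A" "cc holomorphic_on A"
proof -
  show t: "(\<lambda>lam. th lam 1) holomorphic_on A" "(\<lambda>lam. ph lam 1) holomorphic_on A"
    and d: "(\<lambda>lam. dv (ph lam) 1) holomorphic_on A"
    by (rule holomorphic_on_subset[OF sl_entire(1)]; simp | rule holomorphic_on_subset[OF sl_entire(2)]; simp)+
  show "bb holomorphic_on A" "cc holomorphic_on A"
    unfolding bb_def[abs_def] cc_def[abs_def] by (intro holomorphic_intros t d)+
qed

definition holo4 :: "complex set \<Rightarrow> (complex \<Rightarrow> complex \<times> complex \<times> complex \<times> complex) \<Rightarrow> bool" where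
  "holo4 A x \<longleftrightarrow> (\<exists>p r u v. x = (\<lambda>z. (p z, r z, u z, v z)) \<and>
     p holomorphic_on A \<and> r holomorphic_on A \<and> u holomorphic_on A \<and> v holomorphic_on A)"

text \<open>The coefficients \<open>bb\<close> and \<open>cc\<close> are entire and all divisors are
  nonzero constants, so the recurrence itself creates no poles.\<close>

lemma holo4_step:
  assumes "holo4 A x"
  shows "holo4 A (\<lambda>z. stepf z (x z))" "holo4 A (\<lambda>z. stepb z (x z))"
proof -
  obtain p r u v where x: "x = (\<lambda>z. (p z, r z, u z, v z))"
    and h: "p holomorphic_on A" "r holomorphic_on A" "u holomorphic_on A" "v holomorphic_on A"
    using assms unfolding holo4_def by blast
  show "holo4 A (\<lambda>z. stepf z (x z))" "holo4 A (\<lambda>z. stepb z (x z))"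
    unfolding holo4_def x stepf.simps stepb.simps Let_def
    by (rule exI, rule exI, rule exI, rule exI, intro conjI, rule refl;
        intro holomorphic_intros h holomorphic_data; simp add: nz)+
qed

lemma holo4_st:
  assumes "holo4 A x"
  shows "holo4 A (\<lambda>z. st z (x z) n)"
proof -
  have "holo4 A (\<lambda>z. (stepf z ^^ m) (x z))" "holo4 A (\<lambda>z. (stepb z ^^ m) (x z))" for m
    by (induction m) (use assms holo4_step in auto)
  then show ?thesis unfolding st_def by (cases "0 \<le> n") auto
qed

lemma holo4_S:
  assumes "holo4 A x"
  shows "(\<lambda>z. pS z (x z) n) holomorphic_on A" "(\<lambda>z. rS z (x z) n) holomorphic_on A"
    "(\<lambda>z. uS z (x z) n) holomorphic_on A" "(\<lambda>z. vS z (x z) n) holomorphic_on A"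
  unfolding pS_def rS_def uS_def vS_def
  using holo4_st[OF assms, of n] holo4_st[OF assms, of "n - 1"] unfolding holo4_def
  by (auto simp: fun_eq_iff)

text \<open>Here the poles enter: the slope at 0 divides by \<open>ph lam 1\<close>, whose zeros are
  exactly the Dirichlet spectrum.\<close>

lemma ed_holomorphic:
  assumes "A holomorphic_on - dirichlet_spec q" "B holomorphic_on - dirichlet_spec q" "t \<in> {0..1}"
  shows "(\<lambda>lam. ed lam (A lam) (B lam) t) holomorphic_on - dirichlet_spec q"
proof -
  have e: "ed lam (A lam) (B lam) t = A lam * th lam t + (B lam - th lam 1 * A lam) / ph lam 1 * ph lam t" for lam
    using sol_repr(1)[OF ed_sol assms(3), of lam "A lam" "B lam"] by (simp add: ed_0) (simp add: ed_def dv_sl_0)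
  have h: "(\<lambda>lam. th lam t) holomorphic_on - dirichlet_spec q" "(\<lambda>lam. ph lam t) holomorphic_on - dirichlet_spec q"
    using sl_entire(1)[OF assms(3)] holomorphic_on_subset by blast+
  show ?thesis unfolding e
    by (intro holomorphic_intros h holomorphic_data assms) (simp add: dirichlet_spec_iff)
qed

lemma gs_analytic:
  assumes "t \<in> {0..1}"
  shows "(\<lambda>lam. gs lam x5 x6 d5 d6 n j t) analytic_on - dirichlet_spec q"
proof -
  let ?x = "\<lambda>lam. (x5, x6, dv (ph lam) 1 * x5 - ph lam 1 * d5, dv (ph lam) 1 * x6 - ph lam 1 * d6)"
  have "holo4 (- dirichlet_spec q) ?x"
    unfolding holo4_def
    by (rule exI, rule exI, rule exI, rule exI, intro conjI, rule refl; intro holomorphic_intros holomorphic_data)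
  note S = holo4_S[OF this]
  note h = ed_holomorphic[OF _ _ assms] holomorphic_on_mult holomorphic_on_divide holomorphic_on_const S
  consider "j = 1" | "j = 2" | "j = 3" | "j = 4" | "j = 5" | "j \<noteq> 1" "j \<noteq> 2" "j \<noteq> 3" "j \<noteq> 4" "j \<noteq> 5" by blast
  then have "(\<lambda>lam. gs lam x5 x6 d5 d6 n j t) holomorphic_on - dirichlet_spec q"
    unfolding gs_def Let_def gfam_of_def
    by cases (simp, intro h; simp add: nz)+
  then show ?thesis by (simp add: analytic_on_open open_resolvent)
qed

definition Th :: "nat \<Rightarrow> complex \<Rightarrow> gfam" where
  "Th \<nu> lam = gs lam (if \<nu> = 1 then 1 else 0) (if \<nu> = 2 then 1 else 0) 0 0"

definition Ph :: "nat \<Rightarrow> complex \<Rightarrow> gfam" where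
  "Ph \<nu> lam = gs lam 0 0 (if \<nu> = 1 then 1 else 0) (if \<nu> = 2 then 1 else 0)"

lemma fundamental_solutions:
  assumes lam: "lam \<notin> dirichlet_spec q"
  shows "fund_theta N q a1 a2 k lam \<nu> (Th \<nu> lam)" "fund_theta N q a1 a2 k lam \<nu> y \<Longrightarrow> agree y (Th \<nu> lam)"
    "fund_phi N q a1 a2 k lam \<nu> (Ph \<nu> lam)" "fund_phi N q a1 a2 k lam \<nu> y \<Longrightarrow> agree y (Ph \<nu> lam)"
proof -
  show "fund_theta N q a1 a2 k lam \<nu> (Th \<nu> lam)" "fund_phi N q a1 a2 k lam \<nu> (Ph \<nu> lam)"
    unfolding fund_theta_def fund_phi_def Th_def Ph_def using gs_gsol[OF lam] gs_data[OF lam] by auto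
  show "agree y (Th \<nu> lam)" if "fund_theta N q a1 a2 k lam \<nu> y"
    using that unfolding fund_theta_def Th_def by (intro gs_unique[OF lam]) auto
  show "agree y (Ph \<nu> lam)" if "fund_phi N q a1 a2 k lam \<nu> y"
    using that unfolding fund_phi_def Ph_def by (intro gs_unique[OF lam]) auto
qed

end

section \<open>The monodromy matrix\<close>

lemma less_4_cases: "i < (4::nat) \<Longrightarrow> i = 0 \<or> i = 1 \<or> i = 2 \<or> i = 3"
  by auto

lemma sum_4: "sum f {0..<4::nat} = f 0 + f 1 + f 2 + (f 3 :: complex)"
  by (simp add: eval_nat_numeral)

lemma sum_2: "sum f {0..<2::nat} = f 0 + (f 1 :: 'a :: comm_monoid_add)"
  by (simp add: eval_nat_numeral)

lemma mult_index_4: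
  assumes "A \<in> carrier_mat 4 4" "B \<in> carrier_mat 4 (4::nat)" "i < 4" "j < 4"
  shows "(A * B) $$ (i, j) = A $$ (i, 0) * B $$ (0, j) + A $$ (i, 1) * B $$ (1, j) + A $$ (i, 2) * B $$ (2, j) + A $$ (i, 3) * (B $$ (3, j) :: complex)"
  using assms by (simp add: scalar_prod_def sum_4)

lemma eq_mat_4I:
  assumes "A \<in> carrier_mat 4 4" "B \<in> carrier_mat 4 4"
    and "\<And>j. j \<in> {0, 1, 2, 3} \<Longrightarrow> A $$ (0, j) = B $$ (0, j) \<and> A $$ (1, j) = B $$ (1, j) \<and> A $$ (2, j) = B $$ (2, j) \<and> A $$ (3, j) = B $$ (3, j)"
  shows "A = B"
proof (rule eq_matI)
  fix i j assume "i < dim_row B" "j < dim_col B"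
  then have "i < 4" "j < 4" using assms(2) by auto
  then show "A $$ (i, j) = B $$ (i, j)" using assms(3)[of j] less_4_cases[of i] less_4_cases[of j] by auto
qed (use assms in auto)

lemma det_2x2:
  assumes A: "A \<in> carrier_mat 2 2"
  shows "Determinant.det A = A $$ (0, 0) * A $$ (1, 1) - A $$ (0, 1) * (A $$ (1, 0) :: 'a :: comm_ring_1)"
proof -
  have d: "mat_delete A 0 j \<in> carrier_mat 1 1" for j using mat_delete_carrier[OF A, of 0 j] by simp
  have "Determinant.det A = (\<Sum>j<2. A $$ (0, j) * cofactor A 0 j)" by (rule laplace_expansion_row[OF A]) simp
  also have "\<dots> = A $$ (0, 0) * cofactor A 0 0 + A $$ (0, 1) * cofactor A 0 1" by (simp add: eval_nat_numeral)
  also have "cofactor A 0 0 = A $$ (1, 1)" unfolding cofactor_def det_single[OF d] using A by (simp add: mat_delete_def)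
  also have "cofactor A 0 1 = - A $$ (1, 0)" unfolding cofactor_def det_single[OF d] using A by (simp add: mat_delete_def)
  finally show ?thesis by simp
qed

lemma ex_quadratic_pair: "\<exists>x y :: complex. x + y = t \<and> x * y = d"
proof -
  let ?c = "csqrt (t\<^sup>2 - 4 * d)"
  have "?c\<^sup>2 = t\<^sup>2 - 4 * d" by simp
  then have "(t + ?c) / 2 * ((t - ?c) / 2) = d" by (simp add: power2_eq_square algebra_simps)
  moreover have "(t + ?c) / 2 + (t - ?c) / 2 = t" by (simp add: field_simps)
  ultimately show ?thesis by blast
qed

text \<open>The quadratic is \<open>(x + 1)^2 - m x\<close>; its constant term 1 makes the two roots
  reciprocal. It will be used with \<open>m\<close> an eigenvalue of
  \<open>cmat lam * smat lam\<close>.\<close>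

lemma reciprocal_factor:
  obtains \<tau> :: complex where "\<tau> \<noteq> 0" "[:- \<tau>, 1:] * [:- inverse \<tau>, 1:] = [:1, 2 - m, 1:]"
proof -
  obtain x y :: complex where xy: "x + y = m - 2" "x * y = 1" using ex_quadratic_pair by blast
  then have "x \<noteq> 0" "y = inverse x" using inverse_unique[of x y] by auto
  moreover have "[:- x, 1:] * [:- y, 1:] = [:1, 2 - m, 1:]"
    using xy by (simp add: algebra_simps eq_diff_eq)
  ultimately show ?thesis using that by blast
qed

context tube
begin

abbreviation monmat :: "complex \<Rightarrow> complex mat" where
  "monmat lam \<equiv> monodromy (\<lambda>\<nu>. Th \<nu> lam) (\<lambda>\<nu>. Ph \<nu> lam)"

text \<open>The two half steps in matrix form: with \<open>P n = (p n, r n)\<close> and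
  \<open>Q n = (u n, v n)\<close> the recurrence reads \<open>Q n + Q (n - 1) = S (P n)\<close> for
  \<open>S = smat lam\<close> and \<open>P (n + 1) + P n = C (Q n)\<close> for
  \<open>C = cmat lam\<close>.\<close>

definition cmat :: "complex \<Rightarrow> complex mat" where
  "cmat lam = mat 2 2 (\<lambda>(i, j). [[cc lam, - 1 / e2], [- e2, cc lam]] ! i ! j)"

definition smat :: "complex \<Rightarrow> complex mat" where
  "smat lam = mat 2 2 (\<lambda>(i, j). [[bb lam, - kap], [- 1 / kap, bb lam]] ! i ! j)"

text \<open>\<open>tmat\<close> advances the vertex values by one level; \<open>lmat\<close> passes between vertex values and
  the values and derivatives at the right ends of the edges.\<close>

definition tmat :: "complex \<Rightarrow> complex mat" where
  "tmat lam = four_block_mat (cmat lam * smat lam - 1\<^sub>m 2) (- cmat lam) (smat lam) (- 1\<^sub>m 2)"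

definition lmat :: "complex \<Rightarrow> complex \<Rightarrow> complex mat" where
  "lmat x y = four_block_mat (1\<^sub>m 2) (0\<^sub>m 2 2) (x \<cdot>\<^sub>m 1\<^sub>m 2) (y \<cdot>\<^sub>m 1\<^sub>m 2)"

lemma carriers [simp]:
  "cmat lam \<in> carrier_mat 2 2" "smat lam \<in> carrier_mat 2 2" "tmat lam \<in> carrier_mat 4 4"
  "lmat x y \<in> carrier_mat 4 4" "monmat lam \<in> carrier_mat 4 4" "Jsymp \<in> carrier_mat 4 4" "Rmat q lam \<in> carrier_mat 4 4"
proof -
  show c: "cmat lam \<in> carrier_mat 2 2" "smat lam \<in> carrier_mat 2 2"
    by (simp_all add: cmat_def smat_def)
  have f: "four_block_mat A B C D \<in> carrier_mat 4 4" if "A \<in> carrier_mat 2 2" "D \<in> carrier_mat 2 2" for A B C D :: "complex mat"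
    using four_block_carrier_mat[OF that, of B C] by simp
  show "tmat lam \<in> carrier_mat 4 4" unfolding tmat_def by (rule f) (use c in auto)
  show "lmat x y \<in> carrier_mat 4 4" unfolding lmat_def by (rule f) auto
  show "monmat lam \<in> carrier_mat 4 4" unfolding monodromy_def by (rule f) (auto simp: blk_def blk'_def)
  show "Jsymp \<in> carrier_mat 4 4" unfolding Jsymp_def by (rule f) auto
  show "Rmat q lam \<in> carrier_mat 4 4" unfolding Rmat_def by (rule f) auto
qed

lemma tmat_entries:
  "tmat lam $$ (0, 0) = cc lam * bb lam + 1 / (e2 * kap) - 1" "tmat lam $$ (0, 1) = - cc lam * kap - bb lam / e2"
  "tmat lam $$ (0, 2) = - cc lam" "tmat lam $$ (0, 3) = 1 / e2"
  "tmat lam $$ (1, 0) = - e2 * bb lam - cc lam / kap" "tmat lam $$ (1, 1) = e2 * kap + cc lam * bb lam - 1"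
  "tmat lam $$ (1, 2) = e2" "tmat lam $$ (1, 3) = - cc lam"
  "tmat lam $$ (2, 0) = bb lam" "tmat lam $$ (2, 1) = - kap" "tmat lam $$ (2, 2) = - 1" "tmat lam $$ (2, 3) = 0"
  "tmat lam $$ (3, 0) = - 1 / kap" "tmat lam $$ (3, 1) = bb lam" "tmat lam $$ (3, 2) = 0" "tmat lam $$ (3, 3) = - 1"
  by (simp_all add: tmat_def cmat_def smat_def scalar_prod_def sum_2)

lemma lmat_entries:
  "lmat x y $$ (0, 0) = 1" "lmat x y $$ (0, 1) = 0" "lmat x y $$ (0, 2) = 0" "lmat x y $$ (0, 3) = 0"
  "lmat x y $$ (1, 0) = 0" "lmat x y $$ (1, 1) = 1" "lmat x y $$ (1, 2) = 0" "lmat x y $$ (1, 3) = 0"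
  "lmat x y $$ (2, 0) = x" "lmat x y $$ (2, 1) = 0" "lmat x y $$ (2, 2) = y" "lmat x y $$ (2, 3) = 0"
  "lmat x y $$ (3, 0) = 0" "lmat x y $$ (3, 1) = x" "lmat x y $$ (3, 2) = 0" "lmat x y $$ (3, 3) = y"
  by (simp_all add: lmat_def)

text \<open>The composition law of the affine maps sending \<open>z\<close> to
  \<open>x + y z\<close>; inverses and all later cancellations are read off from it.\<close>

lemma lmat_mult: "lmat x y * lmat x' y' = lmat (x + y * x') (y * y')"
  by (rule eq_mat_4I[OF mult_carrier_mat]; (rule carriers)?)
     (auto simp: mult_index_4[OF carriers(4) carriers(4)] lmat_entries simp del: One_nat_def)

lemma lmat_one: "lmat 0 1 = 1\<^sub>m 4"
  by (rule eq_mat_4I) (auto simp: lmat_entries simp del: One_nat_def)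

lemma Rmat_eq: "Rmat q lam = lmat 0 (ph lam 1)"
proof -
  have "0 \<cdot>\<^sub>m 1\<^sub>m 2 = (0\<^sub>m 2 2 :: complex mat)" by (rule eq_matI) auto
  then show ?thesis by (simp add: Rmat_def lmat_def phi1_eq)
qed

text \<open>\<open>mat_inv\<close> is a definite description, so uniqueness of the inverse is part
  of the claim.\<close>

lemma Rmat_inv:
  assumes lam: "lam \<notin> dirichlet_spec q"
  shows "mat_inv (Rmat q lam) = lmat 0 (1 / ph lam 1)"
proof -
  have P: "ph lam 1 \<noteq> 0" using lam by (simp add: dirichlet_spec_iff)
  let ?R = "Rmat q lam" and ?S = "lmat 0 (1 / ph lam 1)"
  have dim: "dim_row ?R = 4" "dim_row ?S = 4" using carriers(7)[of lam] carriers(4) by (metis carrier_matD(1))+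
  have i: "?R * ?S = 1\<^sub>m 4" "?S * ?R = 1\<^sub>m 4"
    using P by (simp_all add: Rmat_eq lmat_mult lmat_one)
  show ?thesis unfolding mat_inv_def inverts_mat_def dim
  proof (rule the_equality)
    show "?S \<in> carrier_mat 4 4 \<and> ?R * ?S = 1\<^sub>m 4 \<and> ?S * ?R = 1\<^sub>m (dim_row ?S)" using i dim by simp
    fix B assume B: "B \<in> carrier_mat 4 4 \<and> ?R * B = 1\<^sub>m 4 \<and> B * ?R = 1\<^sub>m (dim_row B)"
    have "B = (?S * ?R) * B" using B i left_mult_one_mat[of B 4 4] by simp
    also have "\<dots> = ?S * (?R * B)" using B by (intro assoc_mult_mat[of _ 4 4 _ 4 _ 4]) auto
    also have "\<dots> = ?S" using B right_mult_one_mat[OF carriers(4)] by simp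
    finally show "B = ?S" .
  qed
qed

lemma gs_level_1':
  fixes x5 x6 d5 d6 :: complex
  assumes lam: "lam \<notin> dirichlet_spec q"
  defines "u \<equiv> bb lam * x5 - kap * x6 - (dv (ph lam) 1 * x5 - ph lam 1 * d5)"
    and "v \<equiv> bb lam * x6 - x5 / kap - (dv (ph lam) 1 * x6 - ph lam 1 * d6)"
  shows "gs lam x5 x6 d5 d6 1 5 1 = cc lam * u - v / e2 - x5" "gs lam x5 x6 d5 d6 1 6 1 = cc lam * v - e2 * u - x6"
    "dv (gs lam x5 x6 d5 d6 1 5) 1 = (dv (ph lam) 1 * (cc lam * u - v / e2 - x5) - u) / ph lam 1"
    "dv (gs lam x5 x6 d5 d6 1 6) 1 = (dv (ph lam) 1 * (cc lam * v - e2 * u - x6) - v) / ph lam 1"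
  unfolding u_def v_def by (rule gs_level_1[OF lam], simp only: stepf.simps Let_def)+

lemma mono_entries:
  "monmat lam $$ (0, 0) = gs lam 1 0 0 0 1 5 1" "monmat lam $$ (0, 1) = gs lam 0 1 0 0 1 5 1"
  "monmat lam $$ (0, 2) = gs lam 0 0 1 0 1 5 1" "monmat lam $$ (0, 3) = gs lam 0 0 0 1 1 5 1"
  "monmat lam $$ (1, 0) = gs lam 1 0 0 0 1 6 1" "monmat lam $$ (1, 1) = gs lam 0 1 0 0 1 6 1"
  "monmat lam $$ (1, 2) = gs lam 0 0 1 0 1 6 1" "monmat lam $$ (1, 3) = gs lam 0 0 0 1 1 6 1"
  "monmat lam $$ (2, 0) = dv (gs lam 1 0 0 0 1 5) 1" "monmat lam $$ (2, 1) = dv (gs lam 0 1 0 0 1 5) 1"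
  "monmat lam $$ (2, 2) = dv (gs lam 0 0 1 0 1 5) 1" "monmat lam $$ (2, 3) = dv (gs lam 0 0 0 1 1 5) 1"
  "monmat lam $$ (3, 0) = dv (gs lam 1 0 0 0 1 6) 1" "monmat lam $$ (3, 1) = dv (gs lam 0 1 0 0 1 6) 1"
  "monmat lam $$ (3, 2) = dv (gs lam 0 0 1 0 1 6) 1" "monmat lam $$ (3, 3) = dv (gs lam 0 0 0 1 1 6) 1"
  by (simp_all add: monodromy_def blk_def blk'_def Th_def Ph_def)

text \<open>The right factor converts values and derivatives at the right ends into the state
  \<open>(p, r, u, v)\<close>, where \<open>u\<close> is \<open>dv (ph lam) 1\<close> times the
  value minus \<open>ph lam 1\<close> times the derivative. The left factor is its inverse, so this
  is a conjugation of \<open>tmat lam\<close>.\<close>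

lemma mono_eq:
  assumes lam: "lam \<notin> dirichlet_spec q"
  shows "monmat lam = lmat (dv (ph lam) 1 / ph lam 1) (- 1 / ph lam 1) * tmat lam * lmat (dv (ph lam) 1) (- ph lam 1)"
proof -
  define W where "W = lmat (dv (ph lam) 1 / ph lam 1) (- 1 / ph lam 1)"
  define V where "V = lmat (dv (ph lam) 1) (- ph lam 1)"
  note W = lmat_entries[of "dv (ph lam) 1 / ph lam 1" "- 1 / ph lam 1", folded W_def]
  note V = lmat_entries[of "dv (ph lam) 1" "- ph lam 1", folded V_def]
  have car: "W \<in> carrier_mat 4 4" "V \<in> carrier_mat 4 4" unfolding W_def V_def by (rule carriers)+
  have P: "ph lam 1 \<noteq> 0" using lam by (simp add: dirichlet_spec_iff)
  have c: "W * tmat lam \<in> carrier_mat 4 4" by (rule mult_carrier_mat[OF car(1) carriers(3)])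
  have "monmat lam = W * tmat lam * V"
  proof (rule eq_mat_4I)
    show "W * tmat lam * V \<in> carrier_mat 4 4" by (rule mult_carrier_mat[OF c car(2)])
    fix j :: nat assume "j \<in> {0, 1, 2, 3}"
    then show "monmat lam $$ (0, j) = (W * tmat lam * V) $$ (0, j) \<and> monmat lam $$ (1, j) = (W * tmat lam * V) $$ (1, j) \<and>
        monmat lam $$ (2, j) = (W * tmat lam * V) $$ (2, j) \<and> monmat lam $$ (3, j) = (W * tmat lam * V) $$ (3, j)"
      using P nz
      by (auto simp: mult_index_4[OF c car(2)] mult_index_4[OF car(1) carriers(3)] W V tmat_entries
          mono_entries gs_level_1'[OF lam] field_simps simp del: One_nat_def index_mult_mat(1))
  qed simp
  then show ?thesis unfolding W_def V_def .
qed

section \<open>The symplectic identity\<close>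

lemma Jsymp_entries:
  "Jsymp $$ (0, 0) = 0" "Jsymp $$ (0, 1) = 0" "Jsymp $$ (0, 2) = 0" "Jsymp $$ (0, 3) = 1"
  "Jsymp $$ (1, 0) = 0" "Jsymp $$ (1, 1) = 0" "Jsymp $$ (1, 2) = 1" "Jsymp $$ (1, 3) = 0"
  "Jsymp $$ (2, 0) = 0" "Jsymp $$ (2, 1) = - 1" "Jsymp $$ (2, 2) = 0" "Jsymp $$ (2, 3) = 0"
  "Jsymp $$ (3, 0) = - 1" "Jsymp $$ (3, 1) = 0" "Jsymp $$ (3, 2) = 0" "Jsymp $$ (3, 3) = 0"
  by (simp_all add: Jsymp_def jmat_def)

definition symplectic :: "complex \<Rightarrow> complex mat \<Rightarrow> bool" where
  "symplectic a A \<longleftrightarrow> A \<in> carrier_mat 4 4 \<and> A\<^sup>T * Jsymp * A = a \<cdot>\<^sub>m Jsymp"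

lemma symplectic_mult:
  assumes A: "symplectic a A" and B: "symplectic b B"
  shows "symplectic (a * b) (A * B)"
proof -
  have c: "A \<in> carrier_mat 4 4" "B \<in> carrier_mat 4 4" "A\<^sup>T \<in> carrier_mat 4 4" "B\<^sup>T \<in> carrier_mat 4 4"
    using A B by (auto simp: symplectic_def)
  note assoc = assoc_mult_mat[where ?n\<^sub>1 = 4 and ?n\<^sub>2 = 4 and ?n\<^sub>3 = 4 and ?n\<^sub>4 = 4]
  have "(A * B)\<^sup>T * Jsymp * (A * B) = B\<^sup>T * (A\<^sup>T * Jsymp * A) * B"
    using c by (simp add: transpose_mult[of _ 4 4 _ 4] assoc mult_carrier_mat[of _ 4 4 _ 4])
  also have "\<dots> = a \<cdot>\<^sub>m (B\<^sup>T * Jsymp * B)"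
    using A c by (simp add: symplectic_def mult_smult_distrib[of _ 4 4 _ 4] mult_smult_assoc_mat[of _ 4 4 _ 4] mult_carrier_mat[of _ 4 4 _ 4])
  also have "\<dots> = (a * b) \<cdot>\<^sub>m Jsymp"
    using B by (intro eq_matI) (auto simp: symplectic_def)
  finally show ?thesis using c by (auto simp: symplectic_def)
qed

text \<open>The form pairs index 0 with 3 and index 1 with 2; the left side of \<open>f\<close> is
  the form evaluated on columns \<open>i\<close> and \<open>j\<close>.\<close>

lemma symplecticI:
  assumes A: "A \<in> carrier_mat 4 4"
    and f: "\<And>i j. i \<in> {0, 1, 2, 3} \<Longrightarrow> j \<in> {0, 1, 2, 3} \<Longrightarrow>
      A $$ (0, i) * A $$ (3, j) + A $$ (1, i) * A $$ (2, j) - A $$ (2, i) * A $$ (1, j) - A $$ (3, i) * A $$ (0, j) = a * Jsymp $$ (i, j)"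
  shows "symplectic a A"
proof -
  have T: "A\<^sup>T \<in> carrier_mat 4 4" and TJ: "A\<^sup>T * Jsymp \<in> carrier_mat 4 4" using A by auto
  have "A\<^sup>T * Jsymp * A = a \<cdot>\<^sub>m Jsymp"
  proof (rule eq_matI)
    fix i j assume "i < dim_row (a \<cdot>\<^sub>m Jsymp)" "j < dim_col (a \<cdot>\<^sub>m Jsymp)"
    then have ij: "i < 4" "j < 4" using carriers(6) by auto
    have "(A\<^sup>T * Jsymp * A) $$ (i, j) = A $$ (0, i) * A $$ (3, j) + A $$ (1, i) * A $$ (2, j) - A $$ (2, i) * A $$ (1, j) - A $$ (3, i) * A $$ (0, j)"
      unfolding mult_index_4[OF TJ A ij] using ij A
      by (simp add: mult_index_4[OF T carriers(6)] Jsymp_entries[unfolded One_nat_def] del: index_mult_mat(1))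
    also have "\<dots> = a * Jsymp $$ (i, j)" using ij less_4_cases by (intro f) auto
    finally show "(A\<^sup>T * Jsymp * A) $$ (i, j) = (a \<cdot>\<^sub>m Jsymp) $$ (i, j)" using ij carrier_matD[OF carriers(6)] by simp
  qed (use A carrier_matD[OF carriers(6)] in auto)
  then show ?thesis using A by (simp add: symplectic_def)
qed

text \<open>The lower left block is scalar, hence commutes with \<open>jmat\<close>, and its two
  contributions cancel.\<close>

lemma symplectic_lmat: "symplectic y (lmat x y)"
  by (rule symplecticI) (auto simp: lmat_entries Jsymp_entries simp del: One_nat_def)

lemma symplectic_tmat: "symplectic 1 (tmat lam)"
  by (rule symplecticI) (use nz in \<open>auto simp: tmat_entries Jsymp_entries field_simps simp del: One_nat_def\<close>)

lemma mono_symplectic: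
  assumes lam: "lam \<notin> dirichlet_spec q"
  shows "(monmat lam)\<^sup>T * Jsymp * monmat lam = Jsymp"
proof -
  have "ph lam 1 \<noteq> 0" using lam by (simp add: dirichlet_spec_iff)
  then have one: "- 1 / ph lam 1 * 1 * - ph lam 1 = 1" by simp
  have "symplectic (- 1 / ph lam 1 * 1 * - ph lam 1) (monmat lam)"
    unfolding mono_eq[OF lam] by (intro symplectic_mult symplectic_lmat symplectic_tmat)
  then have "(monmat lam)\<^sup>T * Jsymp * monmat lam = 1 \<cdot>\<^sub>m Jsymp" unfolding one symplectic_def by blast
  also have "\<dots> = Jsymp" by (rule eq_matI) auto
  finally show ?thesis .
qed

lemma mono_similar:
  assumes lam: "lam \<notin> dirichlet_spec q"
  shows "similar_mat (monmat lam) (tmat lam)"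
proof -
  have P: "ph lam 1 \<noteq> 0" using lam by (simp add: dirichlet_spec_iff)
  have "similar_mat_wit (monmat lam) (tmat lam) (lmat (dv (ph lam) 1 / ph lam 1) (- 1 / ph lam 1)) (lmat (dv (ph lam) 1) (- ph lam 1))"
  proof (rule similar_mat_witI)
    show "lmat (dv (ph lam) 1 / ph lam 1) (- 1 / ph lam 1) * lmat (dv (ph lam) 1) (- ph lam 1) = 1\<^sub>m 4"
      "lmat (dv (ph lam) 1) (- ph lam 1) * lmat (dv (ph lam) 1 / ph lam 1) (- 1 / ph lam 1) = 1\<^sub>m 4"
      using P by (simp_all add: lmat_mult lmat_one)
    show "monmat lam = lmat (dv (ph lam) 1 / ph lam 1) (- 1 / ph lam 1) * tmat lam * lmat (dv (ph lam) 1) (- ph lam 1)"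
      by (rule mono_eq[OF lam])
  qed (rule carriers)+
  then show ?thesis unfolding similar_mat_def by blast
qed

text \<open>The two lower blocks commute, so the determinant is that of
  \<open>(C S - 1) (- 1) + C S\<close>, which is the identity.\<close>

lemma tmat_det: "Determinant.det (tmat lam) = 1"
proof -
  have "Determinant.det (tmat lam) = Determinant.det ((cmat lam * smat lam - 1\<^sub>m 2) * (- 1\<^sub>m 2) - (- cmat lam) * smat lam)"
    unfolding tmat_def
  proof (rule det_four_block_mat)
    show "smat lam * - 1\<^sub>m 2 = - 1\<^sub>m 2 * smat lam"
      by (rule eq_matI) (auto simp: smat_def scalar_prod_def sum_2 less_2_cases_iff)
  qed auto
  also have "(cmat lam * smat lam - 1\<^sub>m 2) * (- 1\<^sub>m 2) - (- cmat lam) * smat lam = 1\<^sub>m 2"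
    by (rule eq_matI) (auto simp: smat_def cmat_def scalar_prod_def sum_2 less_2_cases_iff)
  finally show ?thesis by simp
qed

lemma tmat_char_poly:
  "\<exists>\<tau>1 \<tau>2 :: complex. \<tau>1 \<noteq> 0 \<and> \<tau>2 \<noteq> 0 \<and>
     char_poly (tmat lam) = [:- \<tau>1, 1:] * [:- inverse \<tau>1, 1:] * [:- \<tau>2, 1:] * [:- inverse \<tau>2, 1:]"
proof -
  \<comment> \<open>The entries of the product \<open>cmat lam * smat lam\<close>.\<close>
  define c00 c01 c10 c11 where c: "c00 = cc lam * bb lam + 1 / (e2 * kap)" "c01 = - cc lam * kap - bb lam / e2"
    "c10 = - e2 * bb lam - cc lam / kap" "c11 = e2 * kap + cc lam * bb lam"
  \<comment> \<open>\<open>A\<close>, \<open>B\<close>, \<open>C\<close>, \<open>D\<close> are the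
    blocks of \<open>x - tmat lam\<close>. The block \<open>D\<close> is the scalar matrix
    \<open>x + 1\<close>, so it commutes with \<open>C\<close> and the determinant reduces to that
    of \<open>A * D - B * C\<close>.\<close>
  define A where "A = mat 2 2 (\<lambda>(i, j). [[[:1 - c00, 1:], [:- c01:]], [[:- c10:], [:1 - c11, 1:]]] ! i ! j)"
  define B where "B = mat 2 2 (\<lambda>(i, j). [[[:cc lam:], [:- 1 / e2:]], [[:- e2:], [:cc lam:]]] ! i ! j)"
  define C where "C = mat 2 2 (\<lambda>(i, j). [[[:- bb lam:], [:kap:]], [[:1 / kap:], [:- bb lam:]]] ! i ! j)"
  define D where "D = ([:1, 1:] :: complex poly) \<cdot>\<^sub>m 1\<^sub>m 2"
  \<comment> \<open>\<open>(x + 1)^2 - x C S\<close>, entry by entry.\<close>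
  define E where "E = mat 2 2 (\<lambda>(i, j). [[[:1, 2 - c00, 1:], [:0, - c01:]], [[:0, - c10:], [:1, 2 - c11, 1:]]] ! i ! j)"
  note defs = A_def B_def C_def D_def E_def
  have car: "A \<in> carrier_mat 2 2" "B \<in> carrier_mat 2 2" "C \<in> carrier_mat 2 2" "D \<in> carrier_mat 2 2" "E \<in> carrier_mat 2 2"
    by (simp_all add: defs)
  have dims: "dim_row (tmat lam) = 4" "dim_col (tmat lam) = 4" using carrier_matD[OF carriers(3)] by auto
  have "char_poly_matrix (tmat lam) = four_block_mat A B C D"
  proof (rule eq_matI)
    have dr: "dim_row (four_block_mat A B C D) = 4" "dim_col (four_block_mat A B C D) = 4" using car by auto
    show "dim_row (char_poly_matrix (tmat lam)) = dim_row (four_block_mat A B C D)"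
      "dim_col (char_poly_matrix (tmat lam)) = dim_col (four_block_mat A B C D)"
      unfolding dr using dims by (auto simp: char_poly_matrix_def)
    fix i j assume "i < dim_row (four_block_mat A B C D)" "j < dim_col (four_block_mat A B C D)"
    then have ij: "i < 4" "j < 4" unfolding dr .
    have "char_poly_matrix (tmat lam) $$ (i, j) = (if i = j then [:0, 1:] else 0) + [:- tmat lam $$ (i, j):]"
      using ij dims by (simp add: char_poly_matrix_def)
    also have "\<dots> = four_block_mat A B C D $$ (i, j)"
      using less_4_cases[OF ij(1)] less_4_cases[OF ij(2)]
      by (elim disjE) (simp_all add: tmat_entries[unfolded One_nat_def] defs c)
    finally show "char_poly_matrix (tmat lam) $$ (i, j) = four_block_mat A B C D $$ (i, j)" .
  qed
  moreover have "C * D = D * C"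
    using car by (simp add: D_def mult_smult_distrib[of _ 2 2 _ 2] mult_smult_assoc_mat[of _ 2 2 _ 2])
  moreover have "A * D - B * C = E"
  proof -
    have "A * D = [:1, 1:] \<cdot>\<^sub>m A" using car by (simp add: D_def mult_smult_distrib[of _ 2 2 _ 2])
    moreover have "[:1, 1:] \<cdot>\<^sub>m A - B * C = E"
      by (rule eq_matI) (auto simp: defs scalar_prod_def less_2_cases_iff sum_2 c algebra_simps)
    ultimately show ?thesis by simp
  qed
  ultimately have "char_poly (tmat lam) = Determinant.det E"
    unfolding char_poly_def using det_four_block_mat[OF car(1-4)] by simp
  also have "\<dots> = [:1, 2 - c00, 1:] * [:1, 2 - c11, 1:] - [:0, - c01:] * [:0, - c10:]"
    by (simp add: det_2x2[OF car(5)] del: One_nat_def) (simp add: E_def)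
  finally have p: "char_poly (tmat lam) = [:1, 2 - c00, 1:] * [:1, 2 - c11, 1:] - [:0, - c01:] * [:0, - c10:]" .
  \<comment> \<open>The eigenvalues of \<open>C S\<close>, prescribed by trace and determinant;
    \<open>det E\<close> is the product of the quadratics \<open>(x + 1)^2 - m1 x\<close> and
    \<open>(x + 1)^2 - m2 x\<close>.\<close>
  obtain m1 m2 where m: "m1 + m2 = c00 + c11" "m1 * m2 = c00 * c11 - c01 * c10"
    using ex_quadratic_pair by blast
  have m1: "m1 = c00 + c11 - m2" using m(1) by (simp add: algebra_simps)
  have m2: "m2 * m2 = m2 * c00 + m2 * c11 - c00 * c11 + c01 * c10" using m(2) unfolding m1 by (simp add: algebra_simps)
  obtain t1 where t1: "t1 \<noteq> 0" "[:- t1, 1:] * [:- inverse t1, 1:] = [:1, 2 - m1, 1:]" by (rule reciprocal_factor)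
  obtain t2 where t2: "t2 \<noteq> 0" "[:- t2, 1:] * [:- inverse t2, 1:] = [:1, 2 - m2, 1:]" by (rule reciprocal_factor)
  have "[:1, 2 - c00, 1:] * [:1, 2 - c11, 1:] - [:0, - c01:] * [:0, - c10:] = [:1, 2 - m1, 1:] * [:1, 2 - m2, 1:]"
    unfolding m1 using m2 by (simp add: algebra_simps)
  then have "char_poly (tmat lam) = [:- t1, 1:] * [:- inverse t1, 1:] * ([:- t2, 1:] * [:- inverse t2, 1:])"
    unfolding p t1(2) t2(2) .
  then show ?thesis using t1(1) t2(1) by (metis mult.assoc)
qed

lemma mono_det:
  assumes lam: "lam \<notin> dirichlet_spec q"
  shows "Determinant.det (monmat lam) = 1"
  using det_similar[OF mono_similar[OF lam]] by (simp add: tmat_det)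

definition holo_mat :: "(complex \<Rightarrow> complex mat) \<Rightarrow> bool" where
  "holo_mat F \<longleftrightarrow> (\<forall>z. F z \<in> carrier_mat 4 4) \<and> (\<forall>i<4. \<forall>j<4. (\<lambda>z. F z $$ (i, j)) holomorphic_on UNIV)"

lemma holo_mat_mult:
  assumes F: "holo_mat F" and G: "holo_mat G"
  shows "holo_mat (\<lambda>z. F z * G z)"
  unfolding holo_mat_def
proof (intro conjI allI impI)
  have c: "F z \<in> carrier_mat 4 4" "G z \<in> carrier_mat 4 4" for z using F G by (auto simp: holo_mat_def)
  show "F z * G z \<in> carrier_mat 4 4" for z using c by (rule mult_carrier_mat)
  fix i j :: nat assume ij: "i < 4" "j < 4"
  show "(\<lambda>z. (F z * G z) $$ (i, j)) holomorphic_on UNIV"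
    unfolding mult_index_4[OF c ij]
    using F G ij by (intro holomorphic_intros) (auto simp: holo_mat_def)
qed

lemma holo_mat_factors: "holo_mat tmat" "holo_mat (\<lambda>z. lmat (dv (ph z) 1) (- 1))"
proof -
  show "holo_mat tmat" unfolding holo_mat_def
  proof (intro conjI allI impI)
    fix i j :: nat assume "i < 4" "j < 4"
    then show "(\<lambda>z. tmat z $$ (i, j)) holomorphic_on UNIV"
      by (auto dest!: less_4_cases simp: tmat_entries nz simp del: One_nat_def intro!: holomorphic_intros holomorphic_data)
  qed simp
  show "holo_mat (\<lambda>z. lmat (dv (ph z) 1) (- 1))" unfolding holo_mat_def
  proof (intro conjI allI impI)
    fix i j :: nat assume "i < 4" "j < 4"
    then show "(\<lambda>z. lmat (dv (ph z) 1) (- 1) $$ (i, j)) holomorphic_on UNIV"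
      by (auto dest!: less_4_cases simp: lmat_entries simp del: One_nat_def intro!: holomorphic_intros holomorphic_data)
  qed simp
qed

text \<open>By the composition law \<open>Rmat q lam\<close> absorbs every division by
  \<open>ph lam 1\<close> from the two outer factors of \<open>mono_eq\<close>, and both become the
  same matrix with entire entries.\<close>

lemma mono_conjugate:
  assumes lam: "lam \<notin> dirichlet_spec q"
  shows "Rmat q lam * monmat lam * mat_inv (Rmat q lam) = lmat (dv (ph lam) 1) (- 1) * tmat lam * lmat (dv (ph lam) 1) (- 1)"
proof -
  have P: "ph lam 1 \<noteq> 0" using lam by (simp add: dirichlet_spec_iff)
  let ?P = "ph lam 1" and ?D = "dv (ph lam) 1"
  note a = assoc_mult_mat[where ?n\<^sub>1 = 4 and ?n\<^sub>2 = 4 and ?n\<^sub>3 = 4 and ?n\<^sub>4 = 4]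
  have "Rmat q lam * monmat lam * mat_inv (Rmat q lam) =
      (lmat 0 ?P * lmat (?D / ?P) (- 1 / ?P)) * tmat lam * (lmat ?D (- ?P) * lmat 0 (1 / ?P))"
    unfolding Rmat_inv[OF lam] unfolding mono_eq[OF lam] Rmat_eq by (simp add: a mult_carrier_mat[of _ 4 4 _ 4])
  also have "\<dots> = lmat ?D (- 1) * tmat lam * lmat ?D (- 1)" using P by (simp add: lmat_mult)
  finally show ?thesis .
qed

end

section \<open>Square integrable functions and second derivatives\<close>

definition nsq :: "(real \<Rightarrow> complex) \<Rightarrow> real" where
  "nsq g = integral {0..1} (\<lambda>t. (cmod (g t))\<^sup>2)"

lemma L2_01_iff:
  "L2_01 g \<longleftrightarrow> g \<in> borel_measurable (lebesgue_on {0..1}) \<and> (\<lambda>t. (cmod (g t))\<^sup>2) integrable_on {0..1}"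
  unfolding L2_01_def by (simp add: measurable_on_iff_borel_measurable)

lemma L2_measurable: "L2_01 g \<Longrightarrow> g \<in> borel_measurable (lebesgue_on {0..1})"
  and L2_integrable_sq: "L2_01 g \<Longrightarrow> (\<lambda>t. (cmod (g t))\<^sup>2) integrable_on {0..1}"
  by (simp_all add: L2_01_iff)

lemma nsq_nonneg: "0 \<le> nsq g"
  unfolding nsq_def by (cases "(\<lambda>t. (cmod (g t))\<^sup>2) integrable_on {0..1}")
    (auto intro: integral_nonneg simp: not_integrable_integral)

text \<open>Second derivatives are known only up to null sets, so membership and norm must not
  depend on the representative.\<close>

lemma L2_spike:
  assumes f: "L2_01 f" and n: "negligible {t\<in>{0..1}. f t \<noteq> g t}"
  shows "L2_01 g" "nsq g = nsq f"
proof -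
  let ?Z = "{t\<in>{0..1}. f t \<noteq> g t}"
  obtain Z h where h: "negligible Z" "\<And>n. continuous_on UNIV (h n)"
    "\<And>x. x \<notin> Z \<Longrightarrow> (\<lambda>n. h n x) \<longlonglongrightarrow> (if x \<in> {0..1} then f x else 0)"
    using f unfolding L2_01_def measurable_on_def by blast
  have "g measurable_on {0..1}" unfolding measurable_on_def
  proof (intro exI[of _ "Z \<union> ?Z"] exI[of _ h] conjI allI impI)
    show "negligible (Z \<union> ?Z)" using h(1) n by (rule negligible_Un)
    show "(\<lambda>n. h n x) \<longlonglongrightarrow> (if x \<in> {0..1} then g x else 0)" if "x \<notin> Z \<union> ?Z" for x
    proof -
      have "(if x \<in> {0..1} then g x else 0) = (if x \<in> {0..1} then f x else 0)" using that by auto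
      then show ?thesis using h(3)[of x] that by auto
    qed
  qed (rule h(2))
  moreover have "(\<lambda>t. (cmod (g t))\<^sup>2) integrable_on {0..1}"
    by (rule integrable_spike[OF L2_integrable_sq[OF f] n]) auto
  ultimately show "L2_01 g" unfolding L2_01_def by blast
  show "nsq g = nsq f" unfolding nsq_def by (rule integral_spike[OF n]) auto
qed

lemma L2_dominated:
  assumes g: "g \<in> borel_measurable (lebesgue_on {0..1})" and h: "h integrable_on {0..1}"
    and b: "\<And>t. t \<in> {0..1} \<Longrightarrow> (cmod (g t))\<^sup>2 \<le> h t"
  shows "L2_01 g" "nsq g \<le> integral {0..1} h"
proof -
  have i: "(\<lambda>t. (cmod (g t))\<^sup>2) integrable_on {0..1}"
  proof (rule measurable_bounded_by_integrable_imp_integrable[OF _ h])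
    show "(\<lambda>t. (cmod (g t))\<^sup>2) \<in> borel_measurable (lebesgue_on {0..1})" using g by measurable
  qed (use b in auto)
  then show "L2_01 g" using g by (simp add: L2_01_iff)
  show "nsq g \<le> integral {0..1} h" unfolding nsq_def by (rule integral_le[OF i h b])
qed

text \<open>The factor \<open>N\<close> is the cost of Cauchy-Schwarz. The weights depend on
  \<open>t\<close> because Fourier coefficients will be multiplied by gauge factors.\<close>

lemma L2_sum:
  assumes f: "\<And>k. k < N \<Longrightarrow> L2_01 (f k)" and c: "\<And>k t. k < N \<Longrightarrow> t \<in> {0..1} \<Longrightarrow> cmod (c k t) \<le> 1"
    and cc: "\<And>k. k < N \<Longrightarrow> continuous_on {0..1} (c k)"
  shows "L2_01 (\<lambda>t. \<Sum>k<N. c k t * f k t)" "nsq (\<lambda>t. \<Sum>k<N. c k t * f k t) \<le> real N * (\<Sum>k<N. nsq (f k))"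
proof -
  have m: "(\<lambda>t. c k t * f k t) \<in> borel_measurable (lebesgue_on {0..1})" if "k < N" for k
    using continuous_imp_measurable_on_sets_lebesgue[OF cc[OF that]] L2_measurable[OF f[OF that]]
    by (intro borel_measurable_times) auto
  have g: "(\<lambda>t. \<Sum>k<N. c k t * f k t) \<in> borel_measurable (lebesgue_on {0..1})"
    by (rule borel_measurable_sum) (use m in auto)
  have h: "(\<lambda>t. real N * (\<Sum>k<N. (cmod (f k t))\<^sup>2)) integrable_on {0..1}"
    by (intro integrable_on_mult_right integrable_sum) (auto intro: L2_integrable_sq f)
  have b: "(cmod (\<Sum>k<N. c k t * f k t))\<^sup>2 \<le> real N * (\<Sum>k<N. (cmod (f k t))\<^sup>2)" if t: "t \<in> {0..1}" for t
  proof -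
    have "cmod (\<Sum>k<N. c k t * f k t) \<le> (\<Sum>k<N. cmod (f k t))"
      by (rule order_trans[OF norm_sum]) (use c t in \<open>auto intro!: sum_mono mult_left_le_one_le simp: norm_mult\<close>)
    then have "(cmod (\<Sum>k<N. c k t * f k t))\<^sup>2 \<le> (\<Sum>k<N. cmod (f k t))\<^sup>2" by (intro power_mono) auto
    also have "\<dots> \<le> (\<Sum>k<N. (cmod (f k t))\<^sup>2) * card {..<N}" by (rule sum_squared_le_sum_of_squares)
    finally show ?thesis by (simp add: mult.commute)
  qed
  show "L2_01 (\<lambda>t. \<Sum>k<N. c k t * f k t)" by (rule L2_dominated(1)[OF g h b])
  have "nsq (\<lambda>t. \<Sum>k<N. c k t * f k t) \<le> integral {0..1} (\<lambda>t. real N * (\<Sum>k<N. (cmod (f k t))\<^sup>2))"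
    by (rule L2_dominated(2)[OF g h b])
  also have "\<dots> = real N * (\<Sum>k<N. nsq (f k))"
    unfolding nsq_def integral_mult_right by (subst integral_sum) (auto intro: L2_integrable_sq f)
  finally show "nsq (\<lambda>t. \<Sum>k<N. c k t * f k t) \<le> real N * (\<Sum>k<N. nsq (f k))" .
qed

lemma L2_add:
  assumes f: "L2_01 f" and g: "L2_01 g"
  shows "L2_01 (\<lambda>t. f t + g t)" "nsq (\<lambda>t. f t + g t) \<le> 2 * (nsq f + nsq g)"
  using L2_sum[of 2 "\<lambda>k. if k = 0 then f else g" "\<lambda>_ _. 1"] f g by (simp_all add: eval_nat_numeral)

lemma L2_scale:
  assumes f: "L2_01 f"
  shows "L2_01 (\<lambda>t. c * f t)" "nsq (\<lambda>t. c * f t) = (cmod c)\<^sup>2 * nsq f"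
proof -
  have m: "(\<lambda>t. c * f t) \<in> borel_measurable (lebesgue_on {0..1})" using L2_measurable[OF f] by measurable
  have h: "(\<lambda>t. (cmod c)\<^sup>2 * (cmod (f t))\<^sup>2) integrable_on {0..1}"
    by (intro integrable_on_mult_right L2_integrable_sq f)
  show "L2_01 (\<lambda>t. c * f t)" by (rule L2_dominated(1)[OF m h]) (simp add: norm_mult power_mult_distrib)
  show "nsq (\<lambda>t. c * f t) = (cmod c)\<^sup>2 * nsq f" by (simp add: nsq_def norm_mult power_mult_distrib)
qed

lemma L2_continuous:
  assumes "continuous_on {0..1} f" shows "L2_01 f"
  using assms by (auto simp: L2_01_iff intro!: continuous_imp_measurable_on_sets_lebesgue integrable_continuous_real continuous_intros)

lemma L2_inner:
  assumes f: "L2_01 f" and g: "L2_01 g"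
  shows "(\<lambda>t. f t * cnj (g t)) integrable_on {0..1}"
    "cmod (integral {0..1} (\<lambda>t. f t * cnj (g t))) \<le> nsq f + nsq g"
proof -
  have cnj: "cnj \<in> borel_measurable borel" by (intro borel_measurable_continuous_onI continuous_intros)
  have m: "(\<lambda>t. f t * cnj (g t)) \<in> borel_measurable (lebesgue_on {0..1})"
    using L2_measurable[OF f] measurable_compose[OF L2_measurable[OF g] cnj] by (intro borel_measurable_times) auto
  have h: "(\<lambda>t. (cmod (f t))\<^sup>2 + (cmod (g t))\<^sup>2) integrable_on {0..1}"
    by (intro integrable_add L2_integrable_sq f g)
  have b: "cmod (f t * cnj (g t)) \<le> (cmod (f t))\<^sup>2 + (cmod (g t))\<^sup>2" for t
  proof -
    have "2 * (cmod (f t) * cmod (g t)) \<le> (cmod (f t))\<^sup>2 + (cmod (g t))\<^sup>2"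
      using sum_squares_bound[of "cmod (f t)" "cmod (g t)"] by simp
    moreover have "0 \<le> cmod (f t) * cmod (g t)" by simp
    ultimately have "cmod (f t) * cmod (g t) \<le> (cmod (f t))\<^sup>2 + (cmod (g t))\<^sup>2" by linarith
    then show ?thesis by (simp add: norm_mult)
  qed
  show i: "(\<lambda>t. f t * cnj (g t)) integrable_on {0..1}"
    by (rule measurable_bounded_by_integrable_imp_integrable[OF m h]) (use b in auto)
  have "cmod (integral {0..1} (\<lambda>t. f t * cnj (g t))) \<le> integral {0..1} (\<lambda>t. (cmod (f t))\<^sup>2 + (cmod (g t))\<^sup>2)"
    by (rule integral_norm_bound_integral[OF i h b])
  also have "\<dots> = nsq f + nsq g" unfolding nsq_def by (intro integral_add L2_integrable_sq f g)
  finally show "cmod (integral {0..1} (\<lambda>t. f t * cnj (g t))) \<le> nsq f + nsq g" .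
qed

lemma L2_absolutely_integrable:
  assumes f: "L2_01 f" shows "f absolutely_integrable_on {0..1}"
proof (rule measurable_bounded_by_integrable_imp_absolutely_integrable[OF L2_measurable[OF f]])
  show "(\<lambda>t. 1 + (cmod (f t))\<^sup>2) integrable_on {0..1}"
    by (intro integrable_add L2_integrable_sq f) auto
  show "cmod (f t) \<le> 1 + (cmod (f t))\<^sup>2" for t
  proof -
    have "0 \<le> (cmod (f t) - 1)\<^sup>2" by simp
    then have "2 * cmod (f t) \<le> 1 + (cmod (f t))\<^sup>2" by (simp add: power2_eq_square algebra_simps)
    then show ?thesis using norm_ge_zero[of "f t"] by linarith
  qed
qed simp

text \<open>The variance of \<open>cmod (f t)\<close> is nonnegative: the integral of
  \<open>(cmod (f t) - mass f 1)^2\<close> is expanded.\<close>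

lemma mass_sq_le_nsq:
  assumes f: "L2_01 f" shows "(mass f 1)\<^sup>2 \<le> nsq f"
proof -
  let ?m = "mass f 1"
  have i: "(\<lambda>t. cmod (f t)) integrable_on {0..1}"
    using L2_absolutely_integrable[OF f] by (simp add: absolutely_integrable_on_def)
  have i2: "(\<lambda>t. (cmod (f t))\<^sup>2 - 2 * ?m * cmod (f t)) integrable_on {0..1}"
    by (intro integrable_diff integrable_on_mult_right L2_integrable_sq f i)
  have "0 \<le> integral {0..1} (\<lambda>t. ((cmod (f t))\<^sup>2 - 2 * ?m * cmod (f t)) + ?m\<^sup>2)"
  proof (rule integral_nonneg)
    show "0 \<le> ((cmod (f t))\<^sup>2 - 2 * ?m * cmod (f t)) + ?m\<^sup>2" for t
      using zero_le_power2[of "cmod (f t) - ?m"] by (simp add: power2_eq_square algebra_simps)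
  qed (rule Henstock_Kurzweil_Integration.integrable_add[OF i2 integrable_const_ivl])
  also have "\<dots> = integral {0..1} (\<lambda>t. (cmod (f t))\<^sup>2 - 2 * ?m * cmod (f t)) + integral {0..1::real} (\<lambda>t. ?m\<^sup>2)"
    by (intro integral_add i2 integrable_const_ivl)
  also have "\<dots> = (nsq f - integral {0..1} (\<lambda>t. 2 * ?m * cmod (f t))) + ?m\<^sup>2"
    unfolding nsq_def by (subst integral_diff) (auto intro!: integrable_on_mult_right L2_integrable_sq f i)
  also have "integral {0..1} (\<lambda>t. 2 * ?m * cmod (f t)) = 2 * ?m * ?m" by (simp add: mass_def)
  finally show ?thesis by (simp add: power2_eq_square)
qed

text \<open>Lebesgue differentiation: at almost every point \<open>g\<close> is the limit of mean
  values over short intervals to the right, and these means vanish.\<close>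

lemma integral_zero_imp_negligible:
  fixes g :: "real \<Rightarrow> complex"
  assumes g: "g integrable_on {0..1}" and z: "\<And>t. t \<in> {0..1} \<Longrightarrow> integral {0..t} g = 0"
  shows "negligible {t\<in>{0..1}. g t \<noteq> 0}"
proof -
  define f where "f = (\<lambda>x. if x \<in> {0..1} then g x else 0)"
  have fi: "f integrable_on cbox a b" for a b
    unfolding f_def using integrable_restrict_UNIV[of "{0..1}" g] g integrable_on_subcbox[of _ UNIV] by blast
  obtain Z where Z: "negligible Z" and d: "\<And>x e. \<lbrakk>x \<notin> Z; 0 < e\<rbrakk> \<Longrightarrow>
      \<exists>d>0. \<forall>h. 0 < h \<and> h < d \<longrightarrow> norm (integral (cbox x (x + h *\<^sub>R One)) f /\<^sub>R h ^ DIM(real) - f x) < e"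
    using integrable_ccontinuous_explicit[of f, OF fi] by blast
  have "{t\<in>{0..1}. g t \<noteq> 0} \<subseteq> Z \<union> {1}"
  proof (rule subsetI, rule ccontr)
    fix x assume x: "x \<in> {t\<in>{0..1}. g t \<noteq> 0}" and n: "x \<notin> Z \<union> {1}"
    then have x1: "0 \<le> x" "x < 1" "g x \<noteq> 0" by auto
    obtain d where d0: "d > 0" and dd: "\<And>h. 0 < h \<Longrightarrow> h < d \<Longrightarrow> norm (integral (cbox x (x + h *\<^sub>R One)) f /\<^sub>R h ^ DIM(real) - f x) < cmod (g x)"
      using d[of x "cmod (g x)"] n x1 by auto
    \<comment> \<open>Halving keeps \<open>h\<close> below \<open>d\<close> and \<open>x + h\<close>
      inside the interval; the point 1, where no step to the right fits, belongs to the exceptional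
      set.\<close>
    define h where "h = min d (1 - x) / 2"
    have h: "0 < h" "h < d" "x + h \<le> 1" using d0 x1 by (auto simp: h_def min_def field_simps)
    have "integral {x..x+h} f = integral {x..x+h} g"
      by (rule integral_cong) (use x1 h in \<open>auto simp: f_def\<close>)
    also have "\<dots> = integral {0..x+h} g - integral {0..x} g"
    proof -
      have "g integrable_on {0..x+h}" by (rule integrable_on_subinterval[OF g]) (use x1 h in auto)
      from Henstock_Kurzweil_Integration.integral_combine[OF _ _ this, of x] x1 h show ?thesis by (simp add: algebra_simps)
    qed
    also have "\<dots> = 0" using z x1 h by auto
    finally have "integral (cbox x (x + h *\<^sub>R One)) f = 0" by (simp add: cbox_interval)
    with dd[OF h(1,2)] x1 show False by (simp add: f_def)
  qed
  then show ?thesis using Z negligible_subset by (metis negligible_Un negligible_sing)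
qed

section \<open>Functions with square integrable second derivative\<close>

lemma H2D:
  assumes "H2rep f g"
  shows "\<And>t. t \<in> {0..1} \<Longrightarrow> (f has_vector_derivative dv f t) (at t within {0..1})"
    "L2_01 g" "g absolutely_integrable_on {0..1}"
    "\<And>t. t \<in> {0..1} \<Longrightarrow> dv f t = dv f 0 + integral {0..t} g"
    "continuous_on {0..1} f" "continuous_on {0..1} (dv f)"
proof -
  show d: "\<And>t. t \<in> {0..1} \<Longrightarrow> (f has_vector_derivative dv f t) (at t within {0..1})"
    using assms unfolding H2rep_def by blast
  show "L2_01 g" using assms unfolding H2rep_def by blast
  then show a: "g absolutely_integrable_on {0..1}" by (rule L2_absolutely_integrable)
  show e: "\<And>t. t \<in> {0..1} \<Longrightarrow> dv f t = dv f 0 + integral {0..t} g"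
    using assms unfolding H2rep_def by blast
  show "continuous_on {0..1} f" by (rule continuous_on_vector_derivative[OF d])
  have "continuous_on {0..1} (\<lambda>t. dv f 0 + integral {0..t} g)"
    using a by (intro continuous_intros indefinite_integral_continuous_1) (simp add: absolutely_integrable_on_def)
  then show "continuous_on {0..1} (dv f)" by (rule continuous_on_eq) (rule e[symmetric])
qed

lemma H2I:
  assumes d: "\<And>t. t \<in> {0..1} \<Longrightarrow> (f has_vector_derivative D t) (at t within {0..1})"
    and D: "\<And>t. t \<in> {0..1} \<Longrightarrow> D t = D 0 + integral {0..t} g" and g: "L2_01 g"
  shows "H2rep f g" "\<And>t. t \<in> {0..1} \<Longrightarrow> dv f t = D t"
proof -
  show dv: "dv f t = D t" if "t \<in> {0..1}" for t using dv_eqI[OF d[OF that] that] .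
  show "H2rep f g" unfolding H2rep_def
  proof (intro conjI ballI)
    show "(f has_vector_derivative dv f t) (at t within {0..1})" if "t \<in> {0..1}" for t
      using d[OF that] by (simp only: dv[OF that])
    show "g integrable_on {0..1}" using L2_absolutely_integrable[OF g] by (simp add: absolutely_integrable_on_def)
    show "dv f t = dv f 0 + integral {0..t} g" if "t \<in> {0..1}" for t
      using D[OF that] dv[OF that] dv[of 0] by simp
  qed (rule g)
qed

lemma H2_unique:
  assumes f: "H2rep f g" and f': "H2rep f g'"
  shows "negligible {t\<in>{0..1}. g t \<noteq> g' t}"
proof -
  have i: "g integrable_on {0..t}" "g' integrable_on {0..t}" if "t \<in> {0..1}" for t
    using absolutely_integrable_subinterval[OF H2D(3)[OF f], of 0 t] absolutely_integrable_subinterval[OF H2D(3)[OF f'], of 0 t] that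
    by (auto simp: absolutely_integrable_on_def)
  have "negligible {t\<in>{0..1}. g t - g' t \<noteq> 0}"
  proof (rule integral_zero_imp_negligible)
    show "(\<lambda>t. g t - g' t) integrable_on {0..1}" using i[of 1] by (intro integrable_diff) auto
    show "integral {0..t} (\<lambda>t. g t - g' t) = 0" if t: "t \<in> {0..1}" for t
      using H2D(4)[OF f t] H2D(4)[OF f' t] i[OF t] by (simp add: integral_diff)
  qed
  then show ?thesis by simp
qed

text \<open>\<open>d2 f\<close> is some second derivative; this transfers what is known about a
  concrete one to the chosen one.\<close>

lemma H2_d2:
  assumes "H2rep f g"
  shows "H2rep f (d2 f)" "negligible {t\<in>{0..1}. d2 f t \<noteq> g t}" "L2_01 (d2 f)" "nsq (d2 f) = nsq g"
proof -
  show h: "H2rep f (d2 f)" unfolding d2_def by (rule someI[of _ g]) (rule assms)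
  show n: "negligible {t\<in>{0..1}. d2 f t \<noteq> g t}" by (rule H2_unique[OF h assms])
  show "L2_01 (d2 f)" by (rule H2D(2)[OF h])
  have "negligible {t\<in>{0..1}. g t \<noteq> d2 f t}" using n by (simp add: eq_commute)
  then show "nsq (d2 f) = nsq g" by (rule L2_spike(2)[OF H2D(2)[OF assms]])
qed

lemma H2_sum:
  fixes N :: nat
  assumes f: "\<And>k. k < N \<Longrightarrow> H2rep (f k) (g k)"
  shows "H2rep (\<lambda>t. \<Sum>k<N. c k * f k t) (\<lambda>t. \<Sum>k<N. c k * g k t)"
    "\<And>t. t \<in> {0..1} \<Longrightarrow> dv (\<lambda>t. \<Sum>k<N. c k * f k t) t = (\<Sum>k<N. c k * dv (f k) t)"
proof -
  let ?D = "\<lambda>t. \<Sum>k<N. c k * dv (f k) t"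
  have d: "((\<lambda>t. \<Sum>k<N. c k * f k t) has_vector_derivative ?D t) (at t within {0..1})" if "t \<in> {0..1}" for t
    using H2D(1)[OF f that] by (intro has_vector_derivative_sum has_vector_derivative_mult_right) auto
  have D: "?D t = ?D 0 + integral {0..t} (\<lambda>t. \<Sum>k<N. c k * g k t)" if t: "t \<in> {0..1}" for t
  proof -
    have i: "g k integrable_on {0..t}" if "k < N" for k
      using absolutely_integrable_subinterval[OF H2D(3)[OF f[OF that]], of 0 t] t by (auto simp: absolutely_integrable_on_def)
    have "integral {0..t} (\<lambda>t. \<Sum>k<N. c k * g k t) = (\<Sum>k<N. c k * integral {0..t} (g k))"
      by (subst integral_sum) (auto intro!: integrable_on_mult_right i)
    moreover have "?D t = (\<Sum>k<N. c k * (dv (f k) 0 + integral {0..t} (g k)))"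
    proof (rule sum.cong[OF refl])
      fix k assume "k \<in> {..<N}"
      then have "k < N" by simp
      from H2D(4)[OF f[OF this] t] show "c k * dv (f k) t = c k * (dv (f k) 0 + integral {0..t} (g k))" by (rule arg_cong)
    qed
    ultimately show ?thesis by (simp add: distrib_left sum.distrib)
  qed
  have L: "L2_01 (\<lambda>t. \<Sum>k<N. c k * g k t)"
    using L2_sum(1)[of N "\<lambda>k t. c k * g k t" "\<lambda>_ _. 1"] L2_scale(1)[OF H2D(2)[OF f]] by simp
  show "H2rep (\<lambda>t. \<Sum>k<N. c k * f k t) (\<lambda>t. \<Sum>k<N. c k * g k t)" by (rule H2I(1)[OF d D L])
  show "dv (\<lambda>t. \<Sum>k<N. c k * f k t) t = ?D t" if "t \<in> {0..1}" for t by (rule H2I(2)[OF d D L that])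
qed

lemma has_vector_derivative_exp_of_real:
  fixes c :: complex
  shows "((\<lambda>t. exp (c * of_real t)) has_vector_derivative c * exp (c * of_real t)) (at t within S)"
proof -
  have "((\<lambda>z. exp (c * z)) has_field_derivative c * exp (c * of_real t)) (at (of_real t))"
    by (auto intro!: derivative_eq_intros)
  then show ?thesis by (rule has_vector_derivative_real_field)
qed

text \<open>Conjugation by \<open>exp (c t)\<close> replaces \<open>d/dt\<close> by
  \<open>d/dt + c\<close>, hence \<open>f''\<close> by \<open>f'' + 2 c f' + c^2 f\<close>; the
  second differentiation holds only in integrated form.\<close>

lemma H2_gauge:
  assumes f: "H2rep f g"
  shows "H2rep (\<lambda>t. exp (c * of_real t) * f t) (\<lambda>t. exp (c * of_real t) * (g t + 2 * c * dv f t + c\<^sup>2 * f t))"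
    "\<And>t. t \<in> {0..1} \<Longrightarrow> dv (\<lambda>t. exp (c * of_real t) * f t) t = exp (c * of_real t) * (dv f t + c * f t)"
proof -
  let ?E = "\<lambda>t::real. exp (c * of_real t)"
  let ?D = "\<lambda>t. ?E t * (dv f t + c * f t)"
  let ?g = "\<lambda>t. ?E t * (g t + 2 * c * dv f t + c\<^sup>2 * f t)"
  have d: "((\<lambda>t. ?E t * f t) has_vector_derivative ?D t) (at t within {0..1})" if t: "t \<in> {0..1}" for t
  proof -
    have "((\<lambda>t. ?E t * f t) has_vector_derivative ?E t * dv f t + c * ?E t * f t) (at t within {0..1})"
      by (intro has_vector_derivative_mult has_vector_derivative_exp_of_real H2D(1)[OF f t])
    then show ?thesis by (simp add: algebra_simps)
  qed
  have Ec: "continuous_on {0..1} ?E" by (intro continuous_intros)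
  have cg: "continuous_on {0..1} (\<lambda>t. 2 * c * dv f t + c\<^sup>2 * f t)"
    by (intro continuous_intros H2D(5,6)[OF f])
  have L: "L2_01 (\<lambda>t. g t + (2 * c * dv f t + c\<^sup>2 * f t))"
    by (intro L2_add(1) H2D(2)[OF f] L2_continuous cg)
  obtain M where M: "M \<ge> 0" "\<And>t. t \<in> {0..1} \<Longrightarrow> cmod (?E t) \<le> M" using continuous_bound01[OF Ec] by blast
  have Lg: "L2_01 ?g"
  proof (rule L2_dominated(1))
    show "(\<lambda>t. ?E t * (g t + 2 * c * dv f t + c\<^sup>2 * f t)) \<in> borel_measurable (lebesgue_on {0..1})"
      using continuous_imp_measurable_on_sets_lebesgue[OF Ec] L2_measurable[OF L]
      by (intro borel_measurable_times) (auto simp: add.assoc)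
    show "(\<lambda>t. M\<^sup>2 * (cmod (g t + (2 * c * dv f t + c\<^sup>2 * f t)))\<^sup>2) integrable_on {0..1}"
      by (intro integrable_on_mult_right L2_integrable_sq L)
    show "(cmod (?g t))\<^sup>2 \<le> M\<^sup>2 * (cmod (g t + (2 * c * dv f t + c\<^sup>2 * f t)))\<^sup>2" if "t \<in> {0..1}" for t
      using power_mono[OF M(2)[OF that], of 2]
      by (simp add: norm_mult power_mult_distrib add.assoc mult_right_mono)
  qed
  have D: "?D t = ?D 0 + integral {0..t} ?g" if t: "t \<in> {0..1}" for t
  proof -
    have cdv: "continuous_on {0..1} (\<lambda>s. c * dv f s)" by (intro continuous_intros H2D(6)[OF f])
    have gi: "(\<lambda>s. g s + c * dv f s) absolutely_integrable_on {0..1}"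
      by (intro L2_absolutely_integrable L2_add(1) H2D(2)[OF f] L2_continuous cdv)
    have G: "dv f t + c * f t = (dv f 0 + c * f 0) + integral {0..t} (\<lambda>s. g s + c * dv f s)" if t: "t \<in> {0..1}" for t
    proof -
      have ft: "(dv f has_integral f t - f 0) {0..t}"
        by (rule fundamental_theorem_of_calculus)
          (use t in \<open>auto intro!: has_vector_derivative_within_subset[OF H2D(1)[OF f], of _ "{0..t}"]\<close>)
      have gt: "g integrable_on {0..t}"
        using absolutely_integrable_subinterval[OF H2D(3)[OF f], of 0 t] t by (auto simp: absolutely_integrable_on_def)
      have "integral {0..t} (\<lambda>s. g s + c * dv f s) = integral {0..t} g + c * (f t - f 0)"
        using gt ft integral_unique[OF ft] by (subst integral_add) (auto intro!: integrable_on_mult_right)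
      moreover have "dv f t = dv f 0 + integral {0..t} g" by (rule H2D(4)[OF f t])
      ultimately show ?thesis by (simp add: right_diff_distrib)
    qed
    \<comment> \<open>The product formula for the exponential and \<open>f' + c f\<close>, whose
      density is \<open>g + c f'\<close>; the two terms with \<open>c f'\<close> account for the
      factor 2.\<close>
    have "?E t * (dv f t + c * f t) = ?E 0 * (dv f 0 + c * f 0) +
        integral {0..t} (\<lambda>s. c * ?E s * (dv f s + c * f s) + (g s + c * dv f s) * ?E s)"
    proof (rule indefinite_integral_product[OF gi _ _ _ t])
      show "dv f t + c * f t = dv f 0 + c * f 0 + integral {0..t} (\<lambda>s. g s + c * dv f s)" if "t \<in> {0..1}" for t
        by (rule G[OF that])
      show "(?E has_vector_derivative c * ?E t) (at t within {0..1})" for t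
        by (rule has_vector_derivative_exp_of_real)
      show "continuous_on {0..1} (\<lambda>t. c * ?E t)" by (intro continuous_intros)
    qed
    also have "integral {0..t} (\<lambda>s. c * ?E s * (dv f s + c * f s) + (g s + c * dv f s) * ?E s) = integral {0..t} ?g"
      by (rule integral_cong) (simp add: algebra_simps power2_eq_square)
    finally show ?thesis .
  qed
  show "H2rep (\<lambda>t. ?E t * f t) ?g" by (rule H2I(1)[OF d D Lg])
  show "dv (\<lambda>t. ?E t * f t) t = ?D t" if "t \<in> {0..1}" for t by (rule H2I(2)[OF d D Lg that])
qed

text \<open>Averaging \<open>f'\<close> against the weight \<open>6 u (1 - u)\<close> and integrating by parts bounds \<open>f'\<close> by \<open>f\<close> and \<open>f''\<close>.\<close>

lemma H2_nsq_dv_le: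
  assumes f: "H2rep f g"
  shows "L2_01 (dv f)" "nsq (dv f) \<le> 72 * nsq f + 2 * nsq g"
proof -
  show Ld: "L2_01 (dv f)" by (rule L2_continuous[OF H2D(6)[OF f]])
  have Lf: "L2_01 f" by (rule L2_continuous[OF H2D(5)[OF f]])
  \<comment> \<open>The weight vanishes at both ends, so no boundary terms arise; the factor 6 gives
    it integral 1, and its derivative is bounded by 6.\<close>
  let ?w = "\<lambda>u::real. complex_of_real (6 * u * (1 - u))" and ?w' = "\<lambda>u::real. complex_of_real (6 - 12 * u)"
  have w: "(?w has_vector_derivative ?w' u) (at u within {0..1})" for u
  proof -
    have "((\<lambda>z::complex. 6 * z * (1 - z)) has_field_derivative 6 - 12 * of_real u) (at (of_real u))"
      by (auto intro!: derivative_eq_intros simp: algebra_simps)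
    from has_vector_derivative_real_field[OF this] show ?thesis by simp
  qed
  have "((\<lambda>u. ?w u * dv f u + ?w' u * f u) has_integral ?w 1 * f 1 - ?w 0 * f 0) {0..1}"
    by (rule fundamental_theorem_of_calculus) (auto intro!: has_vector_derivative_mult w H2D(1)[OF f] simp del: of_real_mult of_real_diff)
  then have ibp: "((\<lambda>u. ?w u * dv f u + ?w' u * f u) has_integral 0) {0..1}" by simp
  have c: "continuous_on {0..1} (\<lambda>u. ?w u * dv f u)" "continuous_on {0..1} (\<lambda>u. ?w' u * f u)"
    by (intro continuous_intros H2D(5,6)[OF f])+
  have "((\<lambda>u. complex_of_real (3 * u\<^sup>2 - 2 * u ^ 3)) has_vector_derivative ?w u) (at u within {0..1})" for u :: real
  proof -
    have "((\<lambda>z::complex. 3 * z\<^sup>2 - 2 * z ^ 3) has_field_derivative 6 * of_real u * (1 - of_real u)) (at (of_real u))"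
      by (auto intro!: derivative_eq_intros simp: algebra_simps power2_eq_square)
    from has_vector_derivative_real_field[OF this] show ?thesis by simp
  qed
  then have "(?w has_integral complex_of_real (3 * 1\<^sup>2 - 2 * 1 ^ 3) - complex_of_real (3 * 0\<^sup>2 - 2 * 0 ^ 3)) {0..1}"
    by (intro fundamental_theorem_of_calculus) auto
  then have w1: "(?w has_integral 1) {0..1}" by simp
  \<comment> \<open>\<open>f'(t)\<close> is the weighted mean of \<open>f'(t) - f'(u)\<close> minus
    the integral of \<open>?w' u * f u\<close>. The mean is at most \<open>mass g 1\<close>, the
    integral at most \<open>6 * mass f 1\<close>.\<close>
  have b: "cmod (dv f t) \<le> 6 * mass f 1 + mass g 1 * 1" if t: "t \<in> {0..1}" for t
  proof -
    have 1: "((\<lambda>u. ?w u * dv f t) has_integral 1 * dv f t) {0..1}" by (intro has_integral_mult_left w1)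
    have 2: "((\<lambda>u. ?w u * dv f u) has_integral - integral {0..1} (\<lambda>u. ?w' u * f u)) {0..1}"
      using has_integral_diff[OF ibp integrable_integral[OF integrable_continuous_real[OF c(2)]]] by simp
    have i3: "((\<lambda>u. ?w u * dv f t - ?w u * dv f u) has_integral 1 * dv f t - - integral {0..1} (\<lambda>u. ?w' u * f u)) {0..1}"
      by (rule has_integral_diff[OF 1 2])
    have dd: "cmod (dv f t - dv f u) \<le> mass g 1" if u: "u \<in> {0..1}" for u
    proof -
      have *: "cmod (dv f t - dv f u) \<le> mass g 1" if "u \<le> t" "t \<in> {0..1}" "u \<in> {0..1}" for t u
      proof -
        have "dv f t - dv f u = integral {0..t} g - integral {0..u} g"
          using H2D(4)[OF f that(2)] H2D(4)[OF f that(3)] by (metis add_diff_cancel_left)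
        also have "cmod \<dots> \<le> mass g t - mass g u"
          using that by (intro integral_diff_le_mass[OF H2D(3)[OF f]]) auto
        also have "\<dots> \<le> mass g 1"
          using mass_mono[OF H2D(3)[OF f], of t 1] mass_mono[OF H2D(3)[OF f], of 0 u] that by (simp add: mass_0)
        finally show ?thesis .
      qed
      show ?thesis
      proof (cases "u \<le> t")
        case True then show ?thesis using * t u by blast
      next
        case False then show ?thesis using *[of t u] t u by (simp add: norm_minus_commute)
      qed
    qed
    have "cmod (1 * dv f t - - integral {0..1} (\<lambda>u. ?w' u * f u)) \<le> mass g 1 * 1"
    proof -
      have wr: "((\<lambda>u. 6 * u * (1 - u)) has_integral 1) {0..1::real}"
        using has_integral_Re[OF w1] by simp
      have "cmod (integral {0..1} (\<lambda>u. ?w u * dv f t - ?w u * dv f u)) \<le> integral {0..1} (\<lambda>u. mass g 1 * (6 * u * (1 - u)))"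
      proof (rule integral_norm_bound_integral)
        show "(\<lambda>u. ?w u * dv f t - ?w u * dv f u) integrable_on {0..1}" using i3 by blast
        show "(\<lambda>u. mass g 1 * (6 * u * (1 - u))) integrable_on {0..1}" using wr by (intro integrable_on_mult_right) auto
        fix u :: real assume u: "u \<in> {0..1}"
        have "cmod (?w u * dv f t - ?w u * dv f u) = (6 * u * (1 - u)) * cmod (dv f t - dv f u)"
          using u unfolding right_diff_distrib[symmetric] norm_mult norm_of_real by simp
        also have "\<dots> \<le> (6 * u * (1 - u)) * mass g 1" using u dd[OF u] by (intro mult_left_mono) auto
        finally show "cmod (?w u * dv f t - ?w u * dv f u) \<le> mass g 1 * (6 * u * (1 - u))" by (simp add: mult.commute)
      qed
      also have "\<dots> = mass g 1 * 1" using integral_unique[OF wr] by simp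
      finally show ?thesis using integral_unique[OF i3] by simp
    qed
    moreover have "cmod (integral {0..1} (\<lambda>u. ?w' u * f u)) \<le> 6 * mass f 1"
    proof -
      have af: "f absolutely_integrable_on {0..1}" by (rule L2_absolutely_integrable[OF Lf])
      have "cmod (integral {0..1} (\<lambda>u. f u * ?w' u)) \<le> 6 * (mass f 1 - mass f 0)"
        by (rule integral_mult_le_mass[OF af]) (auto intro!: continuous_intros simp flip: of_real_diff of_real_mult simp: abs_le_iff)
      then show ?thesis by (simp add: mass_0 mult.commute)
    qed
    moreover have "cmod (dv f t) \<le> cmod (1 * dv f t - - integral {0..1} (\<lambda>u. ?w' u * f u)) + cmod (integral {0..1} (\<lambda>u. ?w' u * f u))"
      using norm_triangle_ineq4[of "1 * dv f t - - integral {0..1} (\<lambda>u. ?w' u * f u)" "integral {0..1} (\<lambda>u. ?w' u * f u)"] by simp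
    ultimately show ?thesis by linarith
  qed
  have "(cmod (dv f t))\<^sup>2 \<le> 72 * nsq f + 2 * nsq g" if t: "t \<in> {0..1}" for t
  proof -
    have "(cmod (dv f t))\<^sup>2 \<le> (6 * mass f 1 + mass g 1)\<^sup>2" using b[OF t] by (intro power_mono) auto
    \<comment> \<open>From \<open>(x + y)^2 \<le> 2 x^2 + 2 y^2\<close>; hence the constant 72,
      which is \<open>2 * 6^2\<close>.\<close>
    also have "\<dots> \<le> 2 * (6 * mass f 1)\<^sup>2 + 2 * (mass g 1)\<^sup>2"
      using zero_le_power2[of "6 * mass f 1 - mass g 1"] by (simp add: power2_eq_square algebra_simps)
    also have "\<dots> \<le> 72 * nsq f + 2 * nsq g"
      using mass_sq_le_nsq[OF Lf] mass_sq_le_nsq[OF H2D(2)[OF f]] by (simp add: power_mult_distrib)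
    finally show ?thesis .
  qed
  then have "nsq (dv f) \<le> integral {0..1::real} (\<lambda>t. 72 * nsq f + 2 * nsq g)"
    by (intro L2_dominated(2)[OF L2_measurable[OF Ld]]) auto
  then show "nsq (dv f) \<le> 72 * nsq f + 2 * nsq g" by simp
qed

section \<open>Gauge transformation and discrete Fourier transform\<close>

definition Eidx :: "(int \<times> nat) set" where "Eidx = {(n, j). 1 \<le> j \<and> j \<le> 6}"

lemma Idx_iff: "(n, j, k) \<in> Idx N \<longleftrightarrow> (n, j) \<in> Eidx \<and> k < N"
  by (auto simp: Idx_def Eidx_def)

lemma Idx_Suc: "Idx (Suc N) = Idx N \<union> (\<lambda>(n, j). (n, j, N)) ` Eidx" "Idx N \<inter> (\<lambda>(n, j). (n, j, N)) ` Eidx = {}"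
  by (auto simp: Idx_def Eidx_def less_Suc_eq)

lemma inj_slice: "inj_on (\<lambda>(n, j). (n, j, k)) A"
  by (auto simp: inj_on_def)

lemma slice_summable:
  fixes \<phi> :: "int \<times> nat \<times> nat \<Rightarrow> 'a::banach"
  assumes "\<phi> summable_on Idx N" "k < N"
  shows "(\<lambda>(n, j). \<phi> (n, j, k)) summable_on Eidx"
proof -
  have "\<phi> summable_on (\<lambda>(n, j). (n, j, k)) ` Eidx"
    by (rule summable_on_subset_banach[OF assms(1)]) (use assms(2) in \<open>auto simp: Idx_def Eidx_def\<close>)
  then show ?thesis by (subst (asm) summable_on_reindex[OF inj_slice]) (simp add: o_def case_prod_unfold)
qed

text \<open>The index set is a disjoint union of \<open>N\<close> copies of \<open>Eidx\<close>, one
  for each \<open>k\<close>; the finite sum over \<open>k\<close> can then be interchanged with the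
  infinite one over edges.\<close>

lemma Idx_slices:
  fixes \<phi> :: "int \<times> nat \<times> nat \<Rightarrow> 'a::banach"
  assumes "\<And>k. k < N \<Longrightarrow> (\<lambda>(n, j). \<phi> (n, j, k)) summable_on Eidx"
  shows "\<phi> summable_on Idx N" "infsum \<phi> (Idx N) = (\<Sum>k<N. infsum (\<lambda>(n, j). \<phi> (n, j, k)) Eidx)"
proof -
  have "\<phi> summable_on Idx N \<and> infsum \<phi> (Idx N) = (\<Sum>k<N. infsum (\<lambda>(n, j). \<phi> (n, j, k)) Eidx)"
    using assms
  proof (induction N)
    case 0
    have "Idx 0 = {}" by (auto simp: Idx_def)
    then show ?case by simp
  next
    case (Suc N)
    have IH: "\<phi> summable_on Idx N" "infsum \<phi> (Idx N) = (\<Sum>k<N. infsum (\<lambda>(n, j). \<phi> (n, j, k)) Eidx)"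
      using Suc by auto
    have s: "\<phi> summable_on (\<lambda>(n, j). (n, j, N)) ` Eidx"
      using Suc.prems[of N] by (subst summable_on_reindex[OF inj_slice]) (simp add: o_def case_prod_unfold)
    have i: "infsum \<phi> ((\<lambda>(n, j). (n, j, N)) ` Eidx) = infsum (\<lambda>(n, j). \<phi> (n, j, N)) Eidx"
      by (subst infsum_reindex[OF inj_slice]) (simp add: o_def case_prod_unfold)
    show ?case unfolding Idx_Suc(1)
      using summable_on_Un_disjoint[OF IH(1) s Idx_Suc(2)] infsum_Un_disjoint[OF IH(1) s Idx_Suc(2)] IH(2) i by simp
  qed
  then show "\<phi> summable_on Idx N" "infsum \<phi> (Idx N) = (\<Sum>k<N. infsum (\<lambda>(n, j). \<phi> (n, j, k)) Eidx)" by auto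
qed

lemma summable_infsum_sum:
  fixes f :: "nat \<Rightarrow> 'b \<Rightarrow> 'a::banach"
  assumes "\<And>k. k < N \<Longrightarrow> f k summable_on A"
  shows "(\<lambda>x. \<Sum>k<N. f k x) summable_on A" "infsum (\<lambda>x. \<Sum>k<N. f k x) A = (\<Sum>k<N. infsum (f k) A)"
proof -
  have "(\<lambda>x. \<Sum>k<N. f k x) summable_on A \<and> infsum (\<lambda>x. \<Sum>k<N. f k x) A = (\<Sum>k<N. infsum (f k) A)"
    using assms
  proof (induction N)
    case (Suc N)
    then have "(\<lambda>x. \<Sum>k<N. f k x) summable_on A" "f N summable_on A" "infsum (\<lambda>x. \<Sum>k<N. f k x) A = (\<Sum>k<N. infsum (f k) A)"
      by auto
    then show ?case by (simp add: summable_on_add infsum_add)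
  qed simp
  then show "(\<lambda>x. \<Sum>k<N. f k x) summable_on A" "infsum (\<lambda>x. \<Sum>k<N. f k x) A = (\<Sum>k<N. infsum (f k) A)" by auto
qed

lemma l2fam_iff: "l2fam N f \<longleftrightarrow> (\<forall>\<omega>\<in>Idx N. L2_01 (f \<omega>)) \<and> (\<lambda>\<omega>. nsq (f \<omega>)) summable_on Idx N"
  by (simp add: l2fam_def nsq_def)

lemma l2fam_dominated:
  assumes "\<And>\<omega>. \<omega> \<in> Idx N \<Longrightarrow> L2_01 (g \<omega>) \<and> nsq (g \<omega>) \<le> \<phi> \<omega>" "\<phi> summable_on Idx N"
  shows "l2fam N g"
  unfolding l2fam_iff
proof
  show "(\<lambda>\<omega>. nsq (g \<omega>)) summable_on Idx N"
    by (rule summable_on_comparison_test[OF assms(2)]) (use assms(1) nsq_nonneg in auto)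
qed (use assms in auto)

lemma l2fam_add:
  assumes "l2fam N f" "l2fam N g" shows "l2fam N (\<lambda>\<omega> t. f \<omega> t + g \<omega> t)"
proof (rule l2fam_dominated)
  show "(\<lambda>\<omega>. 2 * (nsq (f \<omega>) + nsq (g \<omega>))) summable_on Idx N"
    using assms by (intro summable_on_cmult_right summable_on_add) (auto simp: l2fam_iff)
  show "L2_01 (\<lambda>t. f \<omega> t + g \<omega> t) \<and> nsq (\<lambda>t. f \<omega> t + g \<omega> t) \<le> 2 * (nsq (f \<omega>) + nsq (g \<omega>))" if "\<omega> \<in> Idx N" for \<omega>
    using assms that L2_add[of "f \<omega>" "g \<omega>"] unfolding l2fam_iff by blast
qed

lemma l2fam_scale:
  assumes f: "l2fam N f" and C: "\<And>\<omega>. cmod (c \<omega>) \<le> C"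
  shows "l2fam N (\<lambda>\<omega> t. c \<omega> * f \<omega> t)"
proof (rule l2fam_dominated)
  show "(\<lambda>\<omega>. C\<^sup>2 * nsq (f \<omega>)) summable_on Idx N"
    using f by (intro summable_on_cmult_right) (auto simp: l2fam_iff)
  fix \<omega> assume "\<omega> \<in> Idx N"
  then have L: "L2_01 (f \<omega>)" using f by (auto simp: l2fam_iff)
  have "(cmod (c \<omega>))\<^sup>2 * nsq (f \<omega>) \<le> C\<^sup>2 * nsq (f \<omega>)"
    using C[of \<omega>] by (intro mult_right_mono power_mono nsq_nonneg) auto
  then show "L2_01 (\<lambda>t. c \<omega> * f \<omega> t) \<and> nsq (\<lambda>t. c \<omega> * f \<omega> t) \<le> C\<^sup>2 * nsq (f \<omega>)"
    using L2_scale[OF L, of "c \<omega>"] by simp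
qed

lemma l2fam_aeq:
  assumes "l2fam N f" "aeq N f g" shows "l2fam N g"
  unfolding l2fam_iff
proof
  have s: "L2_01 (g \<omega>)" "nsq (g \<omega>) = nsq (f \<omega>)" if "\<omega> \<in> Idx N" for \<omega>
    using assms that L2_spike[of "f \<omega>" "g \<omega>"] unfolding l2fam_iff aeq_def by blast+
  then show "\<forall>\<omega>\<in>Idx N. L2_01 (g \<omega>)" by blast
  show "(\<lambda>\<omega>. nsq (g \<omega>)) summable_on Idx N"
    using assms(1) s(2) unfolding l2fam_iff by (metis (no_types, lifting) summable_on_cong)
qed

text \<open>A gauge factor that depends only on the type \<open>j\<close> of the edge, followed by a
  matrix acting on the index \<open>k\<close>. The unitary operator and its inverse both have this
  form.\<close>

definition mix :: "nat \<Rightarrow> (nat \<Rightarrow> nat \<Rightarrow> complex) \<Rightarrow> (nat \<Rightarrow> complex) \<Rightarrow> fam \<Rightarrow> fam" where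
  "mix N c b f = (\<lambda>(n, j, m) t. \<Sum>k<N. c m k * (exp (b j * of_real t) * f (n, j, k) t))"

lemma mix_apply: "mix N c b f (n, j, m) t = (\<Sum>k<N. c m k * (exp (b j * of_real t) * f (n, j, k) t))"
  by (simp add: mix_def)

text \<open>Instantiated twice, for the unitary and for its inverse. \<open>unitary\<close> states
  orthonormality of the columns; \<open>C\<close> bounds the gauge rates uniformly, as summation
  over infinitely many edges requires.\<close>

locale mixing =
  fixes N :: nat and c :: "nat \<Rightarrow> nat \<Rightarrow> complex" and b :: "nat \<Rightarrow> complex" and C :: real
  assumes b: "\<And>j. Re (b j) = 0" and bC: "\<And>j. cmod (b j) \<le> C"
    and unitary: "\<And>k l. k < N \<Longrightarrow> l < N \<Longrightarrow> (\<Sum>m<N. c m k * cnj (c m l)) = (if k = l then 1 else 0)"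
begin

lemma cmod_exp_b: "cmod (exp (b j * of_real t)) = 1"
  by (simp add: norm_exp_eq_Re b)

lemma exp_b_cnj: "exp (b j * of_real t) * cnj (exp (b j * of_real t)) = 1"
  using complex_norm_square[of "exp (b j * of_real t)"] unfolding cmod_exp_b by simp

lemma cmod_c_le:
  assumes "m < N" "k < N" shows "cmod (c m k) \<le> 1"
proof -
  have "complex_of_real (\<Sum>m<N. (cmod (c m k))\<^sup>2) = (\<Sum>m<N. c m k * cnj (c m k))"
    unfolding of_real_sum complex_norm_square ..
  also have "\<dots> = 1" using unitary[of k k] assms by simp
  finally have "(\<Sum>m<N. (cmod (c m k))\<^sup>2) = 1" using of_real_eq_1_iff by blast
  moreover have "(cmod (c m k))\<^sup>2 \<le> (\<Sum>m<N. (cmod (c m k))\<^sup>2)"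
    using assms by (intro member_le_sum) auto
  ultimately have "(cmod (c m k))\<^sup>2 \<le> 1" by simp
  then show ?thesis using power2_le_imp_le[of "cmod (c m k)" 1] by simp
qed

lemma mix_L2:
  assumes f: "l2fam N f" and w: "(n, j, m) \<in> Idx N"
  shows "L2_01 (mix N c b f (n, j, m))" "nsq (mix N c b f (n, j, m)) \<le> real N * (\<Sum>k<N. nsq (f (n, j, k)))"
proof -
  have e: "mix N c b f (n, j, m) = (\<lambda>t. \<Sum>k<N. (c m k * exp (b j * of_real t)) * f (n, j, k) t)"
    by (auto simp: mix_apply mult.assoc)
  have L: "L2_01 (f (n, j, k))" if "k < N" for k using f w that by (auto simp: l2fam_iff Idx_iff)
  have "cmod (c m k * exp (b j * of_real t)) \<le> 1" if "k < N" for k t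
    unfolding norm_mult cmod_exp_b using cmod_c_le[OF _ that, of m] w by (simp add: Idx_iff)
  moreover have "continuous_on {0..1} (\<lambda>t::real. c m k * exp (b j * of_real t))" for k by (intro continuous_intros)
  ultimately show "L2_01 (mix N c b f (n, j, m))" "nsq (mix N c b f (n, j, m)) \<le> real N * (\<Sum>k<N. nsq (f (n, j, k)))"
    unfolding e using L2_sum[of N "\<lambda>k. f (n, j, k)" "\<lambda>k t. c m k * exp (b j * of_real t)"] L by auto
qed

lemma mix_l2fam:
  assumes f: "l2fam N f" shows "l2fam N (mix N c b f)"
proof (rule l2fam_dominated)
  have "(\<lambda>(n, j). nsq (f (n, j, k))) summable_on Eidx" if "k < N" for k
    using slice_summable[OF _ that, of "\<lambda>\<omega>. nsq (f \<omega>)"] f by (auto simp: l2fam_iff)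
  then have "(\<lambda>x. \<Sum>k<N. (\<lambda>(n, j). nsq (f (n, j, k))) x) summable_on Eidx" by (rule summable_infsum_sum)
  then have "(\<lambda>x. real N * (\<Sum>k<N. (\<lambda>(n, j). nsq (f (n, j, k))) x)) summable_on Eidx" by (rule summable_on_cmult_right)
  then show "(\<lambda>(n, j, m). real N * (\<Sum>k<N. nsq (f (n, j, k)))) summable_on Idx N"
    by (intro Idx_slices) (simp add: case_prod_unfold)
  show "L2_01 (mix N c b f \<omega>) \<and> nsq (mix N c b f \<omega>) \<le> (case \<omega> of (n, j, m) \<Rightarrow> real N * (\<Sum>k<N. nsq (f (n, j, k))))"
    if "\<omega> \<in> Idx N" for \<omega>
    using mix_L2[OF f] that by (cases \<omega>) auto
qed

lemma inner_summable:
  assumes f: "l2fam N f" and g: "l2fam N g" and k: "k < N"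
  shows "(\<lambda>(n, j). integral {0..1} (\<lambda>t. f (n, j, k) t * cnj (g (n, j, k) t))) summable_on Eidx"
proof -
  have "(\<lambda>\<omega>. integral {0..1} (\<lambda>t. f \<omega> t * cnj (g \<omega> t))) summable_on Idx N"
  proof (rule Infinite_Sum.abs_summable_summable, rule Infinite_Sum.abs_summable_on_comparison_test')
    show "(\<lambda>\<omega>. nsq (f \<omega>) + nsq (g \<omega>)) summable_on Idx N"
      using f g by (intro summable_on_add) (auto simp: l2fam_iff)
    show "cmod (integral {0..1} (\<lambda>t. f \<omega> t * cnj (g \<omega> t))) \<le> nsq (f \<omega>) + nsq (g \<omega>)" if "\<omega> \<in> Idx N" for \<omega>
      using f g that by (intro L2_inner) (auto simp: l2fam_iff)
  qed
  from slice_summable[OF this k] show ?thesis .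
qed

lemma inner_fam_slices:
  assumes f: "l2fam N f" and g: "l2fam N g"
  shows "inner_fam N f g = infsum (\<lambda>(n, j). \<Sum>k<N. integral {0..1} (\<lambda>t. f (n, j, k) t * cnj (g (n, j, k) t))) Eidx"
proof -
  note s = inner_summable[OF f g]
  have "inner_fam N f g = (\<Sum>k<N. infsum (\<lambda>(n, j). integral {0..1} (\<lambda>t. f (n, j, k) t * cnj (g (n, j, k) t))) Eidx)"
    unfolding inner_fam_def by (rule Idx_slices(2)[OF s])
  also have "\<dots> = infsum (\<lambda>x. \<Sum>k<N. (\<lambda>(n, j). integral {0..1} (\<lambda>t. f (n, j, k) t * cnj (g (n, j, k) t))) x) Eidx"
    by (rule summable_infsum_sum(2)[OF s, symmetric])
  finally show ?thesis by (simp add: case_prod_unfold)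
qed

text \<open>For fixed \<open>n\<close>, \<open>j\<close> and \<open>t\<close> the map is unitary in
  the \<open>N\<close> values over \<open>k\<close>; the identity of inner products thus holds
  before integration and before summation over the edges.\<close>

lemma mix_inner:
  assumes f: "l2fam N f" and g: "l2fam N g"
  shows "inner_fam N (mix N c b f) (mix N c b g) = inner_fam N f g"
  unfolding inner_fam_slices[OF f g] inner_fam_slices[OF mix_l2fam[OF f] mix_l2fam[OF g]]
proof (rule infsum_cong, clarify)
  fix n j assume nj: "(n, j) \<in> Eidx"
  have L: "L2_01 (f (n, j, k))" "L2_01 (g (n, j, k))" "L2_01 (mix N c b f (n, j, k))" "L2_01 (mix N c b g (n, j, k))" if "k < N" for k
    using f g mix_l2fam[OF f] mix_l2fam[OF g] nj that by (auto simp: l2fam_iff Idx_iff)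
  have pt: "(\<Sum>m<N. mix N c b f (n, j, m) t * cnj (mix N c b g (n, j, m) t)) = (\<Sum>k<N. f (n, j, k) t * cnj (g (n, j, k) t))" for t
  proof -
    let ?e = "exp (b j * of_real t)"
    have "(\<Sum>m<N. mix N c b f (n, j, m) t * cnj (mix N c b g (n, j, m) t)) =
        (\<Sum>m<N. \<Sum>k<N. \<Sum>l<N. (c m k * cnj (c m l)) * ((?e * cnj ?e) * (f (n, j, k) t * cnj (g (n, j, l) t))))"
      unfolding mix_apply cnj_sum sum_product by (simp add: algebra_simps)
    also have "\<dots> = (\<Sum>m<N. \<Sum>k<N. \<Sum>l<N. (c m k * cnj (c m l)) * (f (n, j, k) t * cnj (g (n, j, l) t)))"
      by (simp only: exp_b_cnj mult_1)
    also have "\<dots> = (\<Sum>k<N. \<Sum>m<N. \<Sum>l<N. (c m k * cnj (c m l)) * (f (n, j, k) t * cnj (g (n, j, l) t)))"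
      by (rule sum.swap)
    also have "\<dots> = (\<Sum>k<N. \<Sum>l<N. \<Sum>m<N. (c m k * cnj (c m l)) * (f (n, j, k) t * cnj (g (n, j, l) t)))"
      by (intro sum.cong refl sum.swap)
    also have "\<dots> = (\<Sum>k<N. \<Sum>l<N. (if k = l then 1 else 0) * (f (n, j, k) t * cnj (g (n, j, l) t)))"
      unfolding sum_distrib_right[symmetric] by (intro sum.cong refl) (simp add: unitary)
    also have "\<dots> = (\<Sum>k<N. f (n, j, k) t * cnj (g (n, j, k) t))"
      by (simp add: if_distrib[of "\<lambda>x. x * _"] cong: if_cong)
    finally show ?thesis .
  qed
  have "(\<Sum>m<N. integral {0..1} (\<lambda>t. mix N c b f (n, j, m) t * cnj (mix N c b g (n, j, m) t))) =
      integral {0..1} (\<lambda>t. \<Sum>m<N. mix N c b f (n, j, m) t * cnj (mix N c b g (n, j, m) t))"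
    by (rule integral_sum[symmetric]) (auto intro: L2_inner L)
  also have "\<dots> = (\<Sum>k<N. integral {0..1} (\<lambda>t. f (n, j, k) t * cnj (g (n, j, k) t)))"
    unfolding pt by (rule integral_sum) (auto intro: L2_inner L)
  finally show "(\<Sum>m<N. integral {0..1} (\<lambda>t. mix N c b f (n, j, m) t * cnj (mix N c b g (n, j, m) t))) =
      (\<Sum>k<N. integral {0..1} (\<lambda>t. f (n, j, k) t * cnj (g (n, j, k) t)))" .
qed

lemma mix_inverse:
  assumes "(n, j, k) \<in> Idx N"
  shows "mix N (\<lambda>k m. cnj (c m k)) (\<lambda>j. - b j) (mix N c b f) (n, j, k) = f (n, j, k)"
proof
  fix t
  have k: "k < N" using assms by (simp add: Idx_iff)
  have e: "exp (- b j * of_real t) * exp (b j * of_real t) = 1" by (simp flip: exp_add)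
  have "mix N (\<lambda>k m. cnj (c m k)) (\<lambda>j. - b j) (mix N c b f) (n, j, k) t =
      (\<Sum>m<N. \<Sum>l<N. (c m l * cnj (c m k)) * ((exp (- b j * of_real t) * exp (b j * of_real t)) * f (n, j, l) t))"
    unfolding mix_apply sum_distrib_left by (intro sum.cong refl) (simp add: algebra_simps)
  also have "\<dots> = (\<Sum>m<N. \<Sum>l<N. (c m l * cnj (c m k)) * f (n, j, l) t)" by (simp only: e mult_1)
  also have "\<dots> = (\<Sum>l<N. \<Sum>m<N. (c m l * cnj (c m k)) * f (n, j, l) t)" by (rule sum.swap)
  also have "\<dots> = (\<Sum>l<N. (if l = k then 1 else 0) * f (n, j, l) t)"
    unfolding sum_distrib_right[symmetric] using k by (intro sum.cong refl) (simp add: unitary)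
  also have "\<dots> = f (n, j, k) t" using k by (simp add: if_distrib[of "\<lambda>x. x * _"] cong: if_cong)
  finally show "mix N (\<lambda>k m. cnj (c m k)) (\<lambda>j. - b j) (mix N c b f) (n, j, k) t = f (n, j, k) t" .
qed

lemma mix_add: "mix N c b (\<lambda>\<omega> t. z * f \<omega> t + g \<omega> t) \<omega> t = z * mix N c b f \<omega> t + mix N c b g \<omega> t"
proof -
  obtain n j m where \<omega>: "\<omega> = (n, j, m)" by (cases \<omega>) auto
  show ?thesis unfolding \<omega> mix_apply sum_distrib_left sum.distrib[symmetric]
    by (intro sum.cong refl) (simp add: algebra_simps)
qed

text \<open>The second derivative conjugated by \<open>exp (b t)\<close>. For
  \<open>b = - \<i> a\<close> with constant \<open>a\<close> it is the square of the magnetic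
  derivative.\<close>

definition gauged :: "fam \<Rightarrow> fam" where
  "gauged f = (\<lambda>\<omega> t. (d2 (f \<omega>) t + 2 * b (fst (snd \<omega>)) * dv (f \<omega>) t) + (b (fst (snd \<omega>)))\<^sup>2 * f \<omega> t)"

lemma mix_H2:
  assumes f: "\<And>\<omega>. \<omega> \<in> Idx N \<Longrightarrow> \<exists>g. H2rep (f \<omega>) g" and w: "(n, j, m) \<in> Idx N"
  shows "H2rep (mix N c b f (n, j, m)) (mix N c b (gauged f) (n, j, m))"
    "\<And>t. t \<in> {0..1} \<Longrightarrow> dv (mix N c b f (n, j, m)) t = (\<Sum>k<N. c m k * (exp (b j * of_real t) * (dv (f (n, j, k)) t + b j * f (n, j, k) t)))"
proof -
  have h: "H2rep (f (n, j, k)) (d2 (f (n, j, k)))" if "k < N" for k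
    using f[of "(n, j, k)"] w that H2_d2(1) by (auto simp: Idx_iff)
  note g = H2_gauge[OF h, where c = "b j"]
  show "H2rep (mix N c b f (n, j, m)) (mix N c b (gauged f) (n, j, m))"
    using H2_sum(1)[OF g(1), where N = N and c = "c m"] unfolding mix_def gauged_def by simp
  fix t :: real assume t: "t \<in> {0..1}"
  show "dv (mix N c b f (n, j, m)) t = (\<Sum>k<N. c m k * (exp (b j * of_real t) * (dv (f (n, j, k)) t + b j * f (n, j, k) t)))"
    using H2_sum(2)[OF g(1) t, where N = N and c = "c m"] g(2)[OF _ t] unfolding mix_def by simp
qed

text \<open>The middle term contains \<open>f'\<close>, about which the domain says nothing; it is
  controlled edge by edge through \<open>H2_nsq_dv_le\<close>.\<close>

lemma gauged_l2fam:
  assumes f: "\<And>\<omega>. \<omega> \<in> Idx N \<Longrightarrow> \<exists>g. H2rep (f \<omega>) g" and l: "l2fam N f" "l2fam N (\<lambda>\<omega>. d2 (f \<omega>))"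
  shows "l2fam N (gauged f)"
proof -
  have dvl: "l2fam N (\<lambda>\<omega>. dv (f \<omega>))"
  proof (rule l2fam_dominated)
    show "(\<lambda>\<omega>. 72 * nsq (f \<omega>) + 2 * nsq (d2 (f \<omega>))) summable_on Idx N"
      using l by (intro summable_on_add summable_on_cmult_right) (auto simp: l2fam_iff)
    show "L2_01 (dv (f \<omega>)) \<and> nsq (dv (f \<omega>)) \<le> 72 * nsq (f \<omega>) + 2 * nsq (d2 (f \<omega>))" if "\<omega> \<in> Idx N" for \<omega>
      using f[OF that] H2_d2(1) H2_nsq_dv_le by blast
  qed
  have C1: "cmod (2 * b j) \<le> 2 * C" for j using bC[of j] by (simp add: norm_mult)
  have C2: "cmod ((b j)\<^sup>2) \<le> C\<^sup>2" for j using bC[of j] by (simp add: norm_power power_mono)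
  show ?thesis unfolding gauged_def
    by (intro l2fam_add l(2) l2fam_scale[OF dvl C1] l2fam_scale[OF l(1) C2])
qed

lemma mix_d2:
  assumes f: "\<And>\<omega>. \<omega> \<in> Idx N \<Longrightarrow> \<exists>g. H2rep (f \<omega>) g"
  shows "aeq N (\<lambda>\<omega>. d2 (mix N c b f \<omega>)) (mix N c b (gauged f))"
  unfolding aeq_def using H2_d2(2)[OF mix_H2(1)[OF f]] by auto

lemma mix_regular:
  assumes f: "\<And>\<omega>. \<omega> \<in> Idx N \<Longrightarrow> \<exists>g. H2rep (f \<omega>) g" and l: "l2fam N f" "l2fam N (\<lambda>\<omega>. d2 (f \<omega>))"
  shows "\<And>\<omega>. \<omega> \<in> Idx N \<Longrightarrow> \<exists>g. H2rep (mix N c b f \<omega>) g" "l2fam N (mix N c b f)" "l2fam N (\<lambda>\<omega>. d2 (mix N c b f \<omega>))"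
proof -
  show "\<exists>g. H2rep (mix N c b f \<omega>) g" if "\<omega> \<in> Idx N" for \<omega>
  proof -
    obtain n j m where \<omega>: "\<omega> = (n, j, m)" by (cases \<omega>) auto
    have "H2rep (mix N c b f (n, j, m)) (mix N c b (gauged f) (n, j, m))"
      by (rule mix_H2(1)[OF f]) (use that \<omega> in auto)
    then show ?thesis unfolding \<omega> by blast
  qed
  show "l2fam N (mix N c b f)" by (rule mix_l2fam[OF l(1)])
  have "aeq N (mix N c b (gauged f)) (\<lambda>\<omega>. d2 (mix N c b f \<omega>))"
    using mix_d2[OF f] by (simp add: aeq_def eq_commute)
  moreover have "l2fam N (gauged f)" by (rule gauged_l2fam[OF f l])
  ultimately show "l2fam N (\<lambda>\<omega>. d2 (mix N c b f \<omega>))" using l2fam_aeq mix_l2fam by blast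
qed

end

section \<open>The discrete Fourier transform in the rotation index\<close>

definition rootN :: "nat \<Rightarrow> complex" where "rootN N = exp (2 * pi * \<i> / of_nat N)"

lemma rootN_power: "rootN N ^ k = exp (2 * of_real pi * \<i> * of_nat k / of_nat N)"
  unfolding rootN_def exp_of_nat_mult[symmetric] by (simp add: algebra_simps)

lemma rootN_N: "N \<ge> 1 \<Longrightarrow> rootN N ^ N = 1"
  unfolding rootN_power by simp

lemma rootN_inj:
  assumes "k < N" "l < N" "rootN N ^ k = rootN N ^ l" shows "k = l"
  using complex_root_unity_eq[of N k l] assms unfolding rootN_power by simp

lemma rootN_cnj: "rootN N * cnj (rootN N) = 1"
proof -
  have "cmod (rootN N) = 1" unfolding rootN_def norm_exp_eq_Re by simp
  then show ?thesis using complex_norm_square[of "rootN N"] by simp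
qed

text \<open>The root of the cardinality makes the matrix unitary; the positive exponent makes the
  rotation act as the factor \<open>s^k\<close> that occurs in \<open>BC\<close>.\<close>

definition dft :: "nat \<Rightarrow> nat \<Rightarrow> nat \<Rightarrow> complex" where
  "dft N m k = rootN N ^ (m * k) / of_real (sqrt (real N))"

lemma dft_commute: "dft N m k = dft N k m"
  by (simp add: dft_def mult.commute)

lemma dft_unitary:
  assumes "k < N" "l < N"
  shows "(\<Sum>m<N. dft N m k * cnj (dft N m l)) = (if k = l then 1 else 0)"
proof -
  let ?s = "rootN N"
  \<comment> \<open>The sum becomes geometric with ratio \<open>z\<close>, an \<open>N\<close>-th
    root of unity that equals 1 only for \<open>k = l\<close>.\<close>
  define z where "z = ?s ^ k * cnj (?s ^ l)"
  have N: "N \<ge> 1" using assms by simp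
  have sq: "complex_of_real (sqrt (real N)) * complex_of_real (sqrt (real N)) = of_nat N"
    by (simp flip: of_real_mult)
  have e: "dft N m k * cnj (dft N m l) = z ^ m / of_nat N" for m
  proof -
    have "dft N m k * cnj (dft N m l) = ?s ^ (m * k) * cnj (?s ^ (m * l)) / (complex_of_real (sqrt (real N)) * complex_of_real (sqrt (real N)))"
      by (simp add: dft_def)
    also have "?s ^ (m * k) * cnj (?s ^ (m * l)) = z ^ m"
      unfolding z_def by (simp add: power_mult_distrib power_mult mult.commute[of m])
    finally show ?thesis unfolding sq .
  qed
  have "z ^ N = (?s ^ N) ^ k * cnj ((?s ^ N) ^ l)"
    unfolding z_def by (simp add: power_mult_distrib flip: power_mult) (simp add: mult.commute)
  then have zN: "z ^ N = 1" by (simp add: rootN_N[OF N])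
  have ll: "?s ^ l * cnj (?s ^ l) = 1"
    using rootN_cnj[of N] by (simp flip: power_mult_distrib)
  have S: "(\<Sum>m<N. dft N m k * cnj (dft N m l)) = (\<Sum>m<N. z ^ m) / of_nat N"
    by (simp only: e sum_divide_distrib)
  show ?thesis unfolding S
  proof (cases "k = l")
    case True
    then have "z = 1" using ll by (simp add: z_def)
    then show "(\<Sum>m<N. z ^ m) / of_nat N = (if k = l then 1 else 0)" using True N by simp
  next
    case False
    have "z \<noteq> 1"
    proof
      assume "z = 1"
      then have "?s ^ k * (?s ^ l * cnj (?s ^ l)) = ?s ^ l" unfolding z_def by (metis mult.commute mult.left_commute mult.right_neutral)
      then have "?s ^ k = ?s ^ l" unfolding ll by simp
      then show False using rootN_inj[OF assms] False by blast
    qed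
    then have "(\<Sum>m<N. z ^ m) = 0" using zN by (simp add: geometric_sum)
    then show "(\<Sum>m<N. z ^ m) / of_nat N = (if k = l then 1 else 0)" using False by simp
  qed
qed

lemma dft_inject:
  "(\<forall>m<N. (\<Sum>k<N. dft N m k * X k) = (\<Sum>k<N. dft N m k * Y k)) \<longleftrightarrow> (\<forall>k<N. X k = Y k)"
proof
  have inv: "(\<Sum>m<N. cnj (dft N m l) * (\<Sum>k<N. dft N m k * X k)) = X l" if l: "l < N" for l X
  proof -
    have "(\<Sum>m<N. cnj (dft N m l) * (\<Sum>k<N. dft N m k * X k)) = (\<Sum>m<N. \<Sum>k<N. (dft N m k * cnj (dft N m l)) * X k)"
      unfolding sum_distrib_left by (intro sum.cong refl) simp
    also have "\<dots> = (\<Sum>k<N. \<Sum>m<N. (dft N m k * cnj (dft N m l)) * X k)" by (rule sum.swap)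
    also have "\<dots> = (\<Sum>k<N. (if k = l then 1 else 0) * X k)"
      unfolding sum_distrib_right[symmetric] using l by (intro sum.cong refl) (simp add: dft_unitary)
    also have "\<dots> = X l" using l by (simp add: if_distrib[of "\<lambda>x. x * _"] cong: if_cong)
    finally show ?thesis .
  qed
  assume *: "\<forall>m<N. (\<Sum>k<N. dft N m k * X k) = (\<Sum>k<N. dft N m k * Y k)"
  show "\<forall>k<N. X k = Y k"
  proof (intro allI impI)
    fix l assume l: "l < N"
    have "(\<Sum>m<N. cnj (dft N m l) * (\<Sum>k<N. dft N m k * X k)) = (\<Sum>m<N. cnj (dft N m l) * (\<Sum>k<N. dft N m k * Y k))"
      using * by (intro sum.cong refl) simp
    then show "X l = Y l" unfolding inv[OF l] .
  qed
qed simp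

lemma bij_shift:
  assumes "N \<ge> (1::nat)"
  shows "bij_betw (\<lambda>k. (k + 1) mod N) {..<N} {..<N}"
proof -
  have "inj_on (\<lambda>k. (k + 1) mod N) {..<N}"
    by (auto simp: inj_on_def mod_Suc split: if_splits)
  moreover have "(\<lambda>k. (k + 1) mod N) ` {..<N} \<subseteq> {..<N}" using assms by auto
  ultimately show ?thesis unfolding bij_betw_def using endo_inj_surj[of "{..<N}" "\<lambda>k. (k + 1) mod N"] by simp
qed

text \<open>Reindexing along the rotation, a bijection of the index set, multiplies the transform by
  a power of the root of unity; injectivity of the transform gives the equivalence.\<close>

lemma dft_shift:
  assumes "N \<ge> 1"
  shows "(\<forall>m<N. rootN N ^ m * (\<Sum>k<N. dft N m k * X k) = (\<Sum>k<N. dft N m k * Y k)) \<longleftrightarrow> (\<forall>k<N. X k = Y ((k + 1) mod N))"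
proof -
  have mod: "z ^ (k mod N) = z ^ k" if "z ^ N = 1" for z :: complex and k
  proof -
    have "z ^ k = z ^ (N * (k div N) + k mod N)" by simp
    also have "\<dots> = z ^ (k mod N)" unfolding power_add power_mult that by simp
    finally show ?thesis by simp
  qed
  have d: "dft N m ((k + 1) mod N) = rootN N ^ m * dft N m k" for m k
  proof -
    have "(rootN N ^ m) ^ N = 1" using rootN_N[OF assms] by (metis mult.commute power_mult power_one)
    from mod[OF this, of "k + 1"] show ?thesis unfolding dft_def power_mult by simp
  qed
  have "(\<Sum>k<N. dft N m k * Y k) = rootN N ^ m * (\<Sum>k<N. dft N m k * Y ((k + 1) mod N))" for m
  proof -
    have "(\<Sum>k<N. dft N m k * Y k) = (\<Sum>k<N. dft N m ((k + 1) mod N) * Y ((k + 1) mod N))"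
      using sum.reindex_bij_betw[OF bij_shift[OF assms], of "\<lambda>k. dft N m k * Y k"] by simp
    also have "\<dots> = rootN N ^ m * (\<Sum>k<N. dft N m k * Y ((k + 1) mod N))"
      unfolding d sum_distrib_left by (simp add: mult.assoc)
    finally show ?thesis .
  qed
  moreover have "rootN N \<noteq> 0" by (simp add: rootN_def)
  ultimately show ?thesis using dft_inject[of N X "\<lambda>k. Y ((k + 1) mod N)"] by simp
qed

text \<open>The constant tangential components of the vector potential, by type of edge. Edge 5 is
  the one traversed against the direction of increasing angle, hence the sign.\<close>

definition apot :: "real \<Rightarrow> real \<Rightarrow> nat \<Rightarrow> real" where
  "apot a1 a2 j = (if j = 2 \<or> j = 4 then a2 else if j = 5 then - a1 else a1)"

definition vertex_cond :: "nat \<Rightarrow> fam \<Rightarrow> bool" where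
  "vertex_cond N f \<longleftrightarrow> (\<forall>n. \<forall>k<N.
     f (n,1,k) 1 = f (n,2,k) 0 \<and> f (n,2,k) 0 = f (n,5,k) 0 \<and>
     f (n,2,k) 1 = f (n,3,k) 0 \<and> f (n,3,k) 0 = f (n,6,k) 0 \<and>
     f (n,3,k) 1 = f (n,4,k) 0 \<and> f (n,4,k) 0 = f (n-1,6,k) 1 \<and>
     f (n,4,k) 1 = f (n,1,(k + 1) mod N) 0 \<and> f (n,1,k) 0 = f (n-1,5,k) 1)"

definition kirchhoff :: "nat \<Rightarrow> fam \<Rightarrow> bool" where
  "kirchhoff N D \<longleftrightarrow> (\<forall>n. \<forall>k<N.
     D (n,1,k) 1 = D (n,2,k) 0 + D (n,5,k) 0 \<and>
     D (n,2,k) 1 = D (n,3,k) 0 + D (n,6,k) 0 \<and>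
     D (n,4,k) 0 = D (n,3,k) 1 + D (n-1,6,k) 1 \<and>
     D (n,4,k) 1 = D (n,1,(k + 1) mod N) 0 - D (n-1,5,(k + 1) mod N) 1)"

locale gauge =
  fixes N :: nat and a1 a2 :: real
  assumes N: "N \<ge> 1"
begin

definition bU :: "nat \<Rightarrow> complex" where "bU j = - \<i> * of_real (apot a1 a2 j)"
definition bV :: "nat \<Rightarrow> complex" where "bV j = \<i> * of_real (apot a1 a2 j)"

definition U :: "fam \<Rightarrow> fam" where "U = mix N (dft N) bU"
definition V :: "fam \<Rightarrow> fam" where "V = mix N (\<lambda>k m. cnj (dft N m k)) bV"

lemma bV_eq: "bV = (\<lambda>j. - bU j)" "bU = (\<lambda>j. - bV j)"
  by (auto simp: bU_def bV_def)

sublocale U: mixing N "dft N" bU "max \<bar>a1\<bar> \<bar>a2\<bar>"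
  by unfold_locales (auto simp: bU_def apot_def norm_mult dft_unitary)

sublocale V: mixing N "\<lambda>k m. cnj (dft N m k)" bV "max \<bar>a1\<bar> \<bar>a2\<bar>"
proof
  show "(\<Sum>m<N. cnj (dft N k m) * cnj (cnj (dft N l m))) = (if k = l then 1 else 0)" if "k < N" "l < N" for k l
  proof -
    have "(\<Sum>m<N. cnj (dft N k m) * cnj (cnj (dft N l m))) = cnj (\<Sum>m<N. dft N m k * cnj (dft N m l))"
      by (simp add: dft_commute[of N _ k] dft_commute[of N _ l])
    then show ?thesis by (simp add: dft_unitary that)
  qed
qed (auto simp: bV_def apot_def norm_mult)

text \<open>\<open>mix_inverse\<close> yields left inverses. Applied to \<open>V\<close>, whose
  matrix is the adjoint and whose gauge has the opposite sign, it makes \<open>V\<close> a right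
  inverse of \<open>U\<close> and thus gives surjectivity.\<close>

lemma UV: "\<omega> \<in> Idx N \<Longrightarrow> U (V f) \<omega> = f \<omega>"
proof -
  assume w: "\<omega> \<in> Idx N"
  have "mix N (\<lambda>k m. cnj (cnj (dft N k m))) (\<lambda>j. - bV j) (V f) \<omega> = f \<omega>"
    unfolding V_def using V.mix_inverse w by (cases \<omega>) auto
  then show ?thesis unfolding U_def bV_eq(2)[symmetric] by simp
qed

definition gder :: "fam \<Rightarrow> fam" where
  "gder f = (\<lambda>\<omega> t. dv (f \<omega>) t + bU (fst (snd \<omega>)) * f \<omega> t)"

text \<open>The gauge factor at the right end of an edge cancels the phase that \<open>BC\<close>
  attaches to that end, so each condition becomes an equality between Fourier sums. Ten of the
  twelve are settled by injectivity of the transform; the two at the right end of edge 4 involve the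
  rotation and need \<open>dft_shift\<close>.\<close>

lemma BC_iff_vertex:
  assumes f: "\<And>\<omega>. \<omega> \<in> Idx N \<Longrightarrow> \<exists>g. H2rep (f \<omega>) g"
  shows "(\<forall>m<N. BC N a1 a2 m (\<lambda>n j. U f (n, j, m))) \<longleftrightarrow> vertex_cond N f \<and> kirchhoff N (gder f)"
proof -
  define SS where "SS = (\<lambda>m X. \<Sum>k<N. dft N m k * (X k :: complex))"
  have v0: "U f (n, j, m) 0 = SS m (\<lambda>k. f (n, j, k) 0)" for n j m
    by (simp add: U_def mix_apply SS_def)
  have v1: "U f (n, j, m) 1 = exp (bU j) * SS m (\<lambda>k. f (n, j, k) 1)" for n j m
    unfolding U_def mix_apply SS_def sum_distrib_left by (intro sum.cong refl) simp
  have w: "(n, j, m) \<in> Idx N" if "m < N" "j \<in> {1..6}" for n j m using that by (simp add: Idx_def)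
  have d0: "dv (U f (n, j, m)) 0 = SS m (\<lambda>k. gder f (n, j, k) 0)" if "m < N" "j \<in> {1..6}" for n j m
  proof -
    have "dv (U f (n, j, m)) 0 = (\<Sum>k<N. dft N m k * (exp (bU j * of_real 0) * (dv (f (n, j, k)) 0 + bU j * f (n, j, k) 0)))"
      unfolding U_def by (rule U.mix_H2(2)[OF f w[OF that]]) auto
    then show ?thesis unfolding SS_def gder_def by simp
  qed
  have d1: "dv (U f (n, j, m)) 1 = exp (bU j) * SS m (\<lambda>k. gder f (n, j, k) 1)" if "m < N" "j \<in> {1..6}" for n j m
  proof -
    have "dv (U f (n, j, m)) 1 = (\<Sum>k<N. dft N m k * (exp (bU j * of_real 1) * (dv (f (n, j, k)) 1 + bU j * f (n, j, k) 1)))"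
      unfolding U_def by (rule U.mix_H2(2)[OF f w[OF that]]) auto
    then show ?thesis unfolding SS_def gder_def sum_distrib_left by (simp add: algebra_simps)
  qed
  have j: "(1::nat) \<in> {1..6}" "(2::nat) \<in> {1..6}" "(3::nat) \<in> {1..6}" "(4::nat) \<in> {1..6}" "(5::nat) \<in> {1..6}" "(6::nat) \<in> {1..6}" by auto
  have x: "exp (\<i> * of_real a1) * (exp (bU 1) * X) = X" "exp (\<i> * of_real a2) * (exp (bU 2) * X) = X"
    "exp (\<i> * of_real a1) * (exp (bU 3) * X) = X" "exp (\<i> * of_real a2) * S * (exp (bU 4) * X) = S * X"
    "exp (- \<i> * of_real a1) * (exp (bU 5) * X) = X" "exp (\<i> * of_real a1) * (exp (bU 6) * X) = X" for X S
    by (simp_all add: bU_def apot_def exp_minus)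
  have SSd: "SS m (\<lambda>k. A k - B k) = SS m A - SS m B" and SSa: "SS m (\<lambda>k. A k + B k) = SS m A + SS m B" for m A B
    by (simp_all add: SS_def algebra_simps sum.distrib sum_subtractf)
  have inj: "(\<forall>m<N. SS m X = SS m Y) \<longleftrightarrow> (\<forall>k<N. X k = Y k)" for X Y
    unfolding SS_def by (rule dft_inject)
  have shift: "(\<forall>m<N. rootN N ^ m * SS m X = SS m Y) \<longleftrightarrow> (\<forall>k<N. X k = Y ((k + 1) mod N))" for X Y
    unfolding SS_def by (rule dft_shift[OF N])
  have "BC N a1 a2 m (\<lambda>n j. U f (n, j, m)) \<longleftrightarrow> (\<forall>n.
     SS m (\<lambda>k. f (n,1,k) 1) = SS m (\<lambda>k. f (n,2,k) 0) \<and> SS m (\<lambda>k. f (n,2,k) 0) = SS m (\<lambda>k. f (n,5,k) 0) \<and>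
     SS m (\<lambda>k. f (n,2,k) 1) = SS m (\<lambda>k. f (n,3,k) 0) \<and> SS m (\<lambda>k. f (n,3,k) 0) = SS m (\<lambda>k. f (n,6,k) 0) \<and>
     SS m (\<lambda>k. f (n,3,k) 1) = SS m (\<lambda>k. f (n,4,k) 0) \<and> SS m (\<lambda>k. f (n,4,k) 0) = SS m (\<lambda>k. f (n-1,6,k) 1) \<and>
     rootN N ^ m * SS m (\<lambda>k. f (n,4,k) 1) = SS m (\<lambda>k. f (n,1,k) 0) \<and> SS m (\<lambda>k. f (n,1,k) 0) = SS m (\<lambda>k. f (n-1,5,k) 1) \<and>
     SS m (\<lambda>k. gder f (n,1,k) 1) = SS m (\<lambda>k. gder f (n,2,k) 0 + gder f (n,5,k) 0) \<and>
     SS m (\<lambda>k. gder f (n,2,k) 1) = SS m (\<lambda>k. gder f (n,3,k) 0 + gder f (n,6,k) 0) \<and>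
     SS m (\<lambda>k. gder f (n,4,k) 0) = SS m (\<lambda>k. gder f (n,3,k) 1 + gder f (n-1,6,k) 1) \<and>
     rootN N ^ m * SS m (\<lambda>k. gder f (n,4,k) 1) = SS m (\<lambda>k. gder f (n,1,k) 0 - gder f (n-1,5,k) 1))" if m: "m < N" for m
  proof -
    have iff: "(a - b - c = 0) = (a = b + c)" "(a - b + c = 0) = (b = a + c)" for a b c :: complex
      by (auto simp: algebra_simps)
    have iff2: "(a = b - c) = (b = a + c)" for a b c :: complex
      by (auto simp: algebra_simps)
    show ?thesis
      unfolding BC_def Let_def rootN_def[symmetric] v0 v1 d0[OF m j(1)] d0[OF m j(2)] d0[OF m j(3)] d0[OF m j(4)] d0[OF m j(5)] d0[OF m j(6)]
        d1[OF m j(1)] d1[OF m j(2)] d1[OF m j(3)] d1[OF m j(4)] d1[OF m j(5)] d1[OF m j(6)] x iff(1) SSa SSd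
      by (simp add: iff(2) iff2)
  qed
  note BC = this
  \<comment> \<open>Exchanges the quantifiers over \<open>m\<close> and \<open>n\<close>, because
    \<open>inj\<close> and \<open>shift\<close> act on a single condition stated for all
    \<open>m\<close> at once.\<close>
  have distr: "(\<forall>m<N. B m) \<longleftrightarrow> (\<forall>n. (\<forall>m<N. P1 m n) \<and> (\<forall>m<N. P2 m n) \<and> (\<forall>m<N. P3 m n) \<and> (\<forall>m<N. P4 m n) \<and> (\<forall>m<N. P5 m n) \<and> (\<forall>m<N. P6 m n)
      \<and> (\<forall>m<N. P7 m n) \<and> (\<forall>m<N. P8 m n) \<and> (\<forall>m<N. P9 m n) \<and> (\<forall>m<N. P10 m n) \<and> (\<forall>m<N. P11 m n) \<and> (\<forall>m<N. P12 m n))"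
    if "\<And>m. m < N \<Longrightarrow> B m \<longleftrightarrow> (\<forall>n :: int. P1 m n \<and> P2 m n \<and> P3 m n \<and> P4 m n \<and> P5 m n \<and> P6 m n \<and> P7 m n \<and> P8 m n \<and> P9 m n \<and> P10 m n \<and> P11 m n \<and> P12 m n)"
    for B P1 P2 P3 P4 P5 P6 P7 P8 P9 P10 P11 P12
  proof -
    have "(\<forall>m<N. B m) \<longleftrightarrow> (\<forall>m<N. \<forall>n. P1 m n \<and> P2 m n \<and> P3 m n \<and> P4 m n \<and> P5 m n \<and> P6 m n \<and> P7 m n \<and> P8 m n \<and> P9 m n \<and> P10 m n \<and> P11 m n \<and> P12 m n)"
      using that by simp
    also have "\<dots> \<longleftrightarrow> (\<forall>n. (\<forall>m<N. P1 m n) \<and> (\<forall>m<N. P2 m n) \<and> (\<forall>m<N. P3 m n) \<and> (\<forall>m<N. P4 m n) \<and> (\<forall>m<N. P5 m n) \<and> (\<forall>m<N. P6 m n)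
      \<and> (\<forall>m<N. P7 m n) \<and> (\<forall>m<N. P8 m n) \<and> (\<forall>m<N. P9 m n) \<and> (\<forall>m<N. P10 m n) \<and> (\<forall>m<N. P11 m n) \<and> (\<forall>m<N. P12 m n))"
    proof -
      have swap: "(\<forall>m. m < N \<longrightarrow> (\<forall>n :: int. P m n)) = (\<forall>n. \<forall>m. m < N \<longrightarrow> P m n)" for P by blast
      show ?thesis unfolding all_conj_distrib imp_conjR
        by (intro arg_cong2[where f = "(\<and>)"] swap)
    qed
    finally show ?thesis .
  qed
  show ?thesis
    by (rule trans[OF distr], erule BC)
      (simp only: inj shift vertex_cond_def kirchhoff_def all_conj_distrib imp_conjR conj_assoc)
qed

end

section \<open>Geometry of the nanotube\<close>

lemma cis_eq_iff:
  assumes "cis x = cis y" "\<bar>x - y\<bar> < 2 * pi" shows "x = y"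
proof -
  have "cis (x - y) = 1" using assms(1) by (metis cis_divide cis_neq_zero divide_self)
  then have "cos (x - y) = 1" by (simp add: complex_eq_iff)
  then obtain n :: int where n: "x - y = of_int n * 2 * pi" using cos_one_2pi_int by blast
  then have "\<bar>of_int n\<bar> * (2 * pi) < 1 * (2 * pi)" using assms(2) by (simp add: abs_mult)
  then have "\<bar>real_of_int n\<bar> < 1" using mult_less_cancel_right_pos[of "2 * pi" "\<bar>real_of_int n\<bar>" 1] pi_gt_zero by simp
  then have "n = 0" by linarith
  then show ?thesis using n by simp
qed

section \<open>Polar angles along a chord\<close>

lemma chord_polar:
  assumes d: "A < D" "D < A + pi" and u: "0 < u" "u < 1"
  obtains \<rho> \<theta> where "\<rho> > 0" "A < \<theta>" "\<theta> < D" "of_real (1 - u) * cis A + of_real u * cis D = of_real \<rho> * cis \<theta>"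
proof -
  define w where "w = of_real (1 - u) + of_real u * cis (D - A)"
  have sd: "sin (D - A) > 0" using d by (intro sin_gt_zero) auto
  have "Im w = u * sin (D - A)" by (simp add: w_def)
  then have iw: "Im w > 0" using sd u by simp
  then have w0: "w \<noteq> 0" by auto
  have a1: "0 < Arg w" "Arg w < pi" using iw Arg_lt_pi[of w] by auto
  have "Im (w * cis (A - D)) = - (1 - u) * sin (D - A)"
  proof -
    have "w * cis (A - D) = of_real (1 - u) * cis (A - D) + of_real u * cis ((D - A) + (A - D))"
      unfolding w_def cis_mult[symmetric] by (simp add: algebra_simps)
    then have "Im (w * cis (A - D)) = (1 - u) * sin (A - D)" by (simp only:) simp
    also have "sin (A - D) = - sin (D - A)" by (metis minus_diff_eq sin_minus)
    finally show ?thesis by (simp only: mult_minus_left mult_minus_right)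
  qed
  then have neg: "Im (w * cis (A - D)) < 0" using sd u by (simp add: mult_neg_pos)
  have pol: "w = of_real (cmod w) * cis (Arg w)" by (metis rcis_cmod_Arg rcis_def)
  have "Im (w * cis (A - D)) = cmod w * sin (Arg w + (A - D))"
  proof -
    have "w * cis (A - D) = of_real (cmod w) * cis (Arg w + (A - D))"
      by (subst pol) (simp add: cis_mult mult.assoc)
    then show ?thesis by simp
  qed
  then have "sin (Arg w + (A - D)) < 0" using neg w0 by (metis mult_less_0_iff norm_ge_zero not_less zero_less_norm_iff)
  moreover have "sin (Arg w + (A - D)) \<ge> 0" if "Arg w \<ge> D - A"
    using that a1 d by (intro sin_ge_zero) auto
  ultimately have a2: "Arg w < D - A" by force
  have "of_real (1 - u) * cis A + of_real u * cis D = w * cis A"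
    by (simp add: w_def algebra_simps cis_mult)
  also have "\<dots> = of_real (cmod w) * cis (A + Arg w)"
    by (subst pol) (simp add: cis_mult mult.assoc add.commute)
  finally show ?thesis using that[of "cmod w" "A + Arg w"] w0 a1 a2 by simp
qed

lemma polar_cis_eq:
  assumes "of_real \<rho> * cis \<theta> = of_real \<rho>' * cis \<theta>'" "\<rho> > 0" "\<rho>' > 0"
  shows "cis \<theta> = cis \<theta>'"
proof -
  have "cmod (of_real \<rho> * cis \<theta>) = cmod (of_real \<rho>' * cis \<theta>')" using assms(1) by simp
  then have "\<rho> = \<rho>'" using assms(2,3) by (simp add: norm_mult)
  then show ?thesis using assms by simp
qed

lemma quad_div_mod:
  "Suc (4 * k) div 4 = k" "Suc (4 * k) mod 4 = 1" "Suc (Suc (4 * k)) div 4 = k" "Suc (Suc (4 * k)) mod 4 = 2"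
  "(4 * k + 3) div 4 = k" "(4 * k + 3) mod 4 = 3"
  by presburger+

text \<open>For \<open>N \<ge> 2\<close> the sine of \<open>pi / N\<close> is positive, which gives
  the tube a radius, and its cosine is nonnegative, which settles the signs below.\<close>

locale geometry =
  fixes N :: nat
  assumes N2: "N \<ge> 2"
begin

abbreviation R :: real where "R \<equiv> Rad N"
abbreviation al :: real where "al \<equiv> alphaN N"
abbreviation be :: real where "be \<equiv> betaN N"

lemma cos_sin_N: "0 \<le> cos (pi / N)" "0 < sin (pi / N)" "(sin (pi / N))\<^sup>2 = 1 - (cos (pi / N))\<^sup>2"
proof -
  have "0 < pi / N" "pi / N \<le> pi / 2" "pi / N < pi" using N2 by (auto simp: field_simps)
  then show "0 \<le> cos (pi / N)" "0 < sin (pi / N)" by (auto intro!: cos_ge_zero sin_gt_zero)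
  show "(sin (pi / N))\<^sup>2 = 1 - (cos (pi / N))\<^sup>2" by (simp add: sin_squared_eq)
qed

lemma R_pos: "R > 0" and R_sq: "R\<^sup>2 = (cos (pi / N) + 5 / 4) / (sin (pi / N))\<^sup>2"
proof -
  have p: "0 < cos (pi / N) + 5 / 4" using cos_sin_N(1) by linarith
  then show "R > 0" unfolding Rad_def using cos_sin_N(2) by (intro divide_pos_pos) auto
  show "R\<^sup>2 = (cos (pi / N) + 5 / 4) / (sin (pi / N))\<^sup>2" unfolding Rad_def power_divide using p by simp
qed

text \<open>Both radicands are perfect squares; this is the effect of the constant
  \<open>5 / 4\<close> in the radius.\<close>

lemma Rp_1: "Rp N 1 = (cos (pi / N) + 1 / 2) / sin (pi / N)" (is ?A)
  and Rp_2: "Rp N 2 = (cos (pi / N) + 2) / sin (pi / N)" (is ?B)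
proof -
  let ?c = "cos (pi / N)" and ?s = "sin (pi / N)"
  have s: "?s > 0" "?s\<^sup>2 = 1 - ?c\<^sup>2" and c: "?c \<ge> 0" using cos_sin_N by auto
  have nz: "1 - ?c\<^sup>2 \<noteq> 0" using s by (metis less_irrefl zero_eq_power2)
  have "(1 * R)\<^sup>2 - 1 = ((?c + 1 / 2) / ?s)\<^sup>2"
    unfolding power_mult_distrib R_sq power_divide s(2) using nz by (simp add: field_simps power2_eq_square)
  then show ?A unfolding Rp_def using s c by (simp add: real_sqrt_unique)
  have "(2 * R)\<^sup>2 - 1 = ((?c + 2) / ?s)\<^sup>2"
    unfolding power_mult_distrib R_sq power_divide s(2) using nz by (simp add: field_simps power2_eq_square)
  then show ?B unfolding Rp_def using s c by (simp add: real_sqrt_unique)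
qed

lemma R_gt_1: "R > 1"
proof -
  have "0 < (Rp N 1)\<^sup>2" unfolding Rp_1 using cos_sin_N by (simp add: add_nonneg_pos)
  moreover have "(Rp N 1)\<^sup>2 = R\<^sup>2 - 1 \<or> Rp N 1 \<le> 0" unfolding Rp_def by (cases "0 \<le> R\<^sup>2 - 1") auto
  moreover have "0 < Rp N 1" unfolding Rp_1 using cos_sin_N by (simp add: add_nonneg_pos)
  ultimately have "1 < R\<^sup>2" by linarith
  then show ?thesis using R_pos power2_less_imp_less[of 1 R] by simp
qed

lemma trig_alpha_beta:
  "sin be = 1 / R" "cos be = Rp N 1 / R" "sin al = 1 / (2 * R)" "cos al = Rp N 2 / (2 * R)"
  "0 < al" "al < be" "be < pi / 2"
proof -
  have 1: "-1 \<le> 1 / R" "1 / R < 1" "0 < 1 / R" "0 < 1 / (2 * R)" "1 / (2 * R) < 1 / R" "-1 \<le> 1 / (2 * R)" "1 / (2 * R) \<le> 1"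
    using R_gt_1 by (auto simp: field_simps intro: order_trans[of _ 0])
  show "sin be = 1 / R" "sin al = 1 / (2 * R)" unfolding betaN_def alphaN_def using 1 by (auto intro!: sin_arcsin)
  have "cos be = sqrt (1 - (1 / R)\<^sup>2)" unfolding betaN_def using 1 by (intro cos_arcsin) auto
  also have "1 - (1 / R)\<^sup>2 = ((1 * R)\<^sup>2 - 1) / R\<^sup>2" using R_pos by (simp add: field_simps power2_eq_square)
  finally show "cos be = Rp N 1 / R" unfolding Rp_def using R_pos by (simp add: real_sqrt_divide)
  have "cos al = sqrt (1 - (1 / (2 * R))\<^sup>2)" unfolding alphaN_def using 1 by (intro cos_arcsin) auto
  also have "1 - (1 / (2 * R))\<^sup>2 = ((2 * R)\<^sup>2 - 1) / (2 * R)\<^sup>2" using R_pos by (simp add: field_simps power2_eq_square)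
  finally have "cos al = Rp N 2 / sqrt ((2 * R)\<^sup>2)" unfolding Rp_def by (simp only: real_sqrt_divide)
  moreover have "sqrt ((2 * R)\<^sup>2) = 2 * R" unfolding real_sqrt_abs using R_pos by simp
  ultimately show "cos al = Rp N 2 / (2 * R)" by simp
  have "arcsin 0 < arcsin (1 / (2 * R))" using 1 by (intro arcsin_less_arcsin) auto
  then show "0 < al" unfolding alphaN_def by simp
  show "al < be" unfolding alphaN_def betaN_def using 1 by (intro arcsin_less_arcsin) auto
  have "arcsin (1 / R) < arcsin 1" using 1 by (intro arcsin_less_arcsin) auto
  then show "be < pi / 2" unfolding betaN_def by simp
qed

text \<open>The addition theorem for \<open>cos (al + be)\<close>, multiplied by
  \<open>2 * R^2\<close>.\<close>

lemma Rp_prod: "Rp N 1 * Rp N 2 - 1 = 2 * R\<^sup>2 * cos (pi / N)"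
proof -
  let ?c = "cos (pi / N)" and ?s = "sin (pi / N)"
  have s: "?s > 0" "?s * ?s = 1 - ?c * ?c" using cos_sin_N by (auto simp: power2_eq_square)
  have "Rp N 1 * Rp N 2 - 1 = ((?c + 1 / 2) * (?c + 2) - ?s * ?s) / (?s * ?s)"
    unfolding Rp_1 Rp_2 using s(1) by (simp add: field_simps)
  also have "(?c + 1 / 2) * (?c + 2) - ?s * ?s = 2 * (?c + 5 / 4) * ?c" unfolding s(2) by (simp add: algebra_simps)
  finally show ?thesis unfolding R_sq by (simp add: power2_eq_square)
qed

lemma alpha_plus_beta: "al + be = pi / N"
proof (rule cos_inj_pi)
  have "cos (al + be) = (Rp N 1 * Rp N 2 - 1) / (2 * R\<^sup>2)"
    unfolding cos_add trig_alpha_beta using R_pos by (simp add: field_simps power2_eq_square)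
  also have "\<dots> = cos (pi / N)" unfolding Rp_prod using R_pos by simp
  finally show "cos (al + be) = cos (pi / N)" .
  show "0 \<le> al + be" "al + be \<le> pi" using trig_alpha_beta(5-7) by auto
  show "0 \<le> pi / N" "pi / N \<le> pi" using N2 by (auto simp: field_simps)
qed

text \<open>With \<open>c = cos (pi / N)\<close> the radicand reduces to
  \<open>(c + 1 / 2) / (1 + c)\<close>. A nonzero height is what allows levels to be compared as
  integers.\<close>

lemma h_pos: "hN N > 0"
proof -
  let ?c = "cos (pi / N)" and ?s = "sin (pi / N)"
  have s: "?s > 0" "?s\<^sup>2 = 1 - ?c\<^sup>2" and c: "?c \<ge> 0" using cos_sin_N by auto
  have "?c\<^sup>2 < 1" using s zero_less_power[of ?s 2] by simp
  then have c1: "?c < 1" using power2_less_imp_less[of ?c 1] by simp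
  have "2 + Rp N 1 * Rp N 2 - 2 * R\<^sup>2 = 3 - 2 * R\<^sup>2 * (1 - ?c)" using Rp_prod by (simp add: algebra_simps)
  also have "2 * R\<^sup>2 * (1 - ?c) = 2 * (?c + 5 / 4) / (1 + ?c)"
  proof -
    have "1 - ?c\<^sup>2 = (1 - ?c) * (1 + ?c)" by (simp add: algebra_simps power2_eq_square)
    then show ?thesis unfolding R_sq s(2) using c c1 by simp
  qed
  also have "3 - 2 * (?c + 5 / 4) / (1 + ?c) = (?c + 1 / 2) / (1 + ?c)" using c by (simp add: field_simps)
  finally have "2 + Rp N 1 * Rp N 2 - 2 * R\<^sup>2 > 0" using c by (simp add: add_nonneg_pos)
  then show ?thesis unfolding hN_def by simp
qed

text \<open>The vertices project to the corners of a convex \<open>4N\<close>-gon; \<open>corner q\<close> is the polar angle of the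
  \<open>q\<close>-th corner, so that \<open>corner (4 * N) = 2 * pi\<close>.\<close>

definition corner :: "nat \<Rightarrow> real" where
  "corner q = phiN N (2 * real (q div 4)) + (if q mod 4 = 0 then 0 else if q mod 4 = 1 then be - al else if q mod 4 = 2 then be + al else 2 * be)"

lemma phi_odd: "phiN N (2 * real k + 1) = be + al + phiN N (2 * real k)"
proof -
  have "phiN N (2 * real k + 1) = pi / N + phiN N (2 * real k)" by (simp add: phiN_def ring_distribs add_divide_distrib)
  then show ?thesis using alpha_plus_beta by simp
qed

lemma corner_simps:
  "corner (4 * k) = phiN N (2 * real k)" "corner (Suc (4 * k)) = be - al + phiN N (2 * real k)"
  "corner (Suc (Suc (4 * k))) = be + al + phiN N (2 * real k)" "corner (4 * k + 3) = 2 * be + phiN N (2 * real k)"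
  "corner (4 * k + 4) = 2 * be + 2 * al + phiN N (2 * real k)"
proof -
  have "4 * k + 4 = 4 * Suc k" by simp
  then have "corner (4 * k + 4) = phiN N (2 * real (Suc k))" unfolding corner_def by simp
  also have "\<dots> = 2 * (pi / N) + phiN N (2 * real k)" by (simp add: phiN_def ring_distribs add_divide_distrib)
  finally show "corner (4 * k + 4) = 2 * be + 2 * al + phiN N (2 * real k)"
    unfolding alpha_plus_beta[symmetric] by simp
qed (simp_all add: corner_def quad_div_mod)

text \<open>The gaps between consecutive corners are alternately \<open>be - al\<close> and
  \<open>2 * al\<close>, both positive and smaller than pi.\<close>

lemma corner_step: "corner q < corner (Suc q)" "corner (Suc q) < corner q + pi"
proof -
  define k where "k = q div 4"
  have "(q = 4 * k \<and> Suc q = Suc (4 * k)) \<or> (q = Suc (4 * k) \<and> Suc q = Suc (Suc (4 * k))) \<or>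
      (q = Suc (Suc (4 * k)) \<and> Suc q = 4 * k + 3) \<or> (q = 4 * k + 3 \<and> Suc q = 4 * k + 4)"
    unfolding k_def by presburger
  then have "corner q < corner (Suc q) \<and> corner (Suc q) < corner q + pi"
  proof (elim disjE conjE)
    assume q: "q = 4 * k" "Suc q = Suc (4 * k)"
    show ?thesis unfolding q(2) unfolding q(1) corner_simps using trig_alpha_beta(5-7) by simp
  next
    assume q: "q = Suc (4 * k)" "Suc q = Suc (Suc (4 * k))"
    show ?thesis unfolding q(2) unfolding q(1) corner_simps using trig_alpha_beta(5-7) by simp
  next
    assume q: "q = Suc (Suc (4 * k))" "Suc q = 4 * k + 3"
    show ?thesis unfolding q(2) unfolding q(1) corner_simps using trig_alpha_beta(5-7) by simp
  next
    assume q: "q = 4 * k + 3" "Suc q = 4 * k + 4"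
    show ?thesis unfolding q(2) unfolding q(1) corner_simps using trig_alpha_beta(5-7) by simp
  qed
  then show "corner q < corner (Suc q)" "corner (Suc q) < corner q + pi" by auto
qed

lemma corner_mono: "corner p < corner q \<longleftrightarrow> p < q" "corner p \<le> corner q \<longleftrightarrow> p \<le> q"
proof -
  have "strict_mono corner" using corner_step(1) by (rule strict_mono_Suc_iff[THEN iffD2, rule_format])
  then show "corner p < corner q \<longleftrightarrow> p < q" "corner p \<le> corner q \<longleftrightarrow> p \<le> q"
    by (auto simp: strict_mono_less strict_mono_less_eq)
qed

lemma corner_ends: "corner 0 = 0" "corner (4 * N) = 2 * pi"
  using N2 by (auto simp: corner_def phiN_def)

definition chord_pt :: "nat \<Rightarrow> real \<Rightarrow> complex" where
  "chord_pt q u = of_real (1 - u) * cis (corner q) + of_real u * cis (corner (Suc q))"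

lemma chord_pt_polar:
  assumes u: "u \<in> {0..1}"
  obtains \<rho> \<theta> where "\<rho> > 0" "corner q \<le> \<theta>" "\<theta> \<le> corner (Suc q)"
    "chord_pt q u = of_real \<rho> * cis \<theta>"
proof -
  consider "u = 0" | "u = 1" | "0 < u" "u < 1" using u by fastforce
  then show ?thesis
  proof cases
    case 1
    then show ?thesis using that[of 1 "corner q"] corner_step(1)[of q] by (simp add: chord_pt_def)
  next
    case 2
    then show ?thesis using that[of 1 "corner (Suc q)"] corner_step(1)[of q] by (simp add: chord_pt_def)
  next
    case 3
    obtain \<rho> \<theta> where "\<rho> > 0" "corner q < \<theta>" "\<theta> < corner (Suc q)" "chord_pt q u = of_real \<rho> * cis \<theta>"
      unfolding chord_pt_def using chord_polar[OF corner_step 3] by blast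
    then show ?thesis using that[of \<rho> \<theta>] by (simp add: less_imp_le)
  qed
qed

text \<open>An interior point of a chord has its angle strictly between consecutive corners, any
  point of another chord has its angle in a closed gap. This identifies the chord, and distinctness
  of its ends identifies the parameter.\<close>

lemma chord_pt_inj:
  assumes q: "q < 4 * N" "q' < 4 * N" and u: "0 < u" "u < 1" "u' \<in> {0..1}" and eq: "chord_pt q u = chord_pt q' u'"
  shows "q = q'" "u = u'"
proof -
  obtain \<rho> \<theta> where 1: "\<rho> > 0" "corner q < \<theta>" "\<theta> < corner (Suc q)" "chord_pt q u = of_real \<rho> * cis \<theta>"
    unfolding chord_pt_def using chord_polar[OF corner_step u(1,2)] by blast
  obtain \<rho>' \<theta>' where 2: "\<rho>' > 0" "corner q' \<le> \<theta>'" "\<theta>' \<le> corner (Suc q')" "chord_pt q' u' = of_real \<rho>' * cis \<theta>'"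
    using chord_pt_polar[OF u(3)] by blast
  have "cis \<theta> = cis \<theta>'" using polar_cis_eq 1 2 eq by metis
  moreover have r: "0 \<le> corner q" "corner (Suc q) \<le> 2 * pi" "0 \<le> corner q'" "corner (Suc q') \<le> 2 * pi"
    using corner_mono(2)[of 0 q] corner_mono(2)[of 0 q'] corner_mono(2)[of "Suc q" "4 * N"] corner_mono(2)[of "Suc q'" "4 * N"] q
    by (auto simp: corner_ends)
  \<comment> \<open>\<open>\<theta>\<close> lies strictly inside \<open>(0, 2 pi)\<close>, so the
    difference stays below \<open>2 pi\<close> even if \<open>\<theta>'\<close> is one of the two
    ends.\<close>
  moreover have "\<bar>\<theta> - \<theta>'\<bar> < 2 * pi" using r 1 2 by linarith
  ultimately have th: "\<theta> = \<theta>'" using cis_eq_iff by blast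
  have "corner q < corner (Suc q')" "corner q' < corner (Suc q)" using 1 2 th by linarith+
  then show qq: "q = q'" unfolding corner_mono by simp
  have ne: "cis (corner (Suc q)) \<noteq> cis (corner q)"
  proof
    assume *: "cis (corner (Suc q)) = cis (corner q)"
    have "\<bar>corner (Suc q) - corner q\<bar> < 2 * pi" using corner_step[of q] pi_gt_zero by linarith
    then show False using cis_eq_iff[OF *] corner_step(1)[of q] by simp
  qed
  have "of_real (u - u') * (cis (corner (Suc q)) - cis (corner q)) = chord_pt q u - chord_pt q u'"
    unfolding chord_pt_def by (simp add: algebra_simps)
  also have "\<dots> = 0" using eq qq by simp
  finally show "u = u'" using ne by simp
qed

text \<open>Among the corners 0 to \<open>4 * N\<close> the only repeated direction is that of the
  last, which closes the polygon at the first.\<close>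

lemma corner_cis_inj:
  assumes "cis (corner q) = cis (corner q')" "q \<le> 4 * N" "q' \<le> 4 * N"
  shows "q mod (4 * N) = q' mod (4 * N)"
proof -
  have r: "0 \<le> corner p" "corner p \<le> 2 * pi" if "p \<le> 4 * N" for p
    using corner_mono(2)[of 0 p] corner_mono(2)[of p "4 * N"] that by (auto simp: corner_ends)
  have lt: "corner p < 2 * pi" if "p < 4 * N" for p using corner_mono(1)[of p "4 * N"] that by (simp add: corner_ends)
  have inj: "p = p'" if "corner p = corner p'" for p p' using corner_mono(2)[of p p'] corner_mono(2)[of p' p] that by simp
  have small: "p = p'" if "cis (corner p) = cis (corner p')" "p < 4 * N" "p' < 4 * N" for p p'
  proof -
    have "\<bar>corner p - corner p'\<bar> < 2 * pi" using r[of p] r[of p'] lt[of p] lt[of p'] that by linarith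
    then show ?thesis using cis_eq_iff[OF that(1)] inj by blast
  qed
  have top: "cis (corner (4 * N)) = cis (corner 0)" by (simp add: corner_ends)
  have red: "cis (corner (p mod (4 * N))) = cis (corner p) \<and> p mod (4 * N) < 4 * N" if "p \<le> 4 * N" for p
  proof (cases "p = 4 * N")
    case True
    then show ?thesis using top N2 by simp
  next
    case False
    then show ?thesis using that by simp
  qed
  show ?thesis using small[of "q mod (4 * N)" "q' mod (4 * N)"] red[OF assms(2)] red[OF assms(3)] assms(1) by simp
qed

text \<open>Each edge as an oriented chord: corner numbers of start and end, then heights in units
  of \<open>hN N\<close>. Edge 4 ends at the first corner of the next index, which for the last
  \<open>k\<close> is \<open>4 * N\<close>; edge 5 alone runs against the numbering.\<close>

definition sq :: "nat \<Rightarrow> nat \<Rightarrow> nat" where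
  "sq j k = 4 * k + (if j = 1 then 0 else if j = 2 \<or> j = 5 then 1 else if j = 4 then 3 else 2)"
definition tq :: "nat \<Rightarrow> nat \<Rightarrow> nat" where
  "tq j k = 4 * k + (if j = 1 then 1 else if j = 2 then 2 else if j = 4 then 4 else if j = 5 then 0 else 3)"
definition sz :: "int \<Rightarrow> nat \<Rightarrow> int" where
  "sz n j = 2 * n + (if j = 1 \<or> j = 4 then 0 else 1)"
definition ez :: "int \<Rightarrow> nat \<Rightarrow> int" where
  "ez n j = 2 * n + (if j = 1 \<or> j = 2 then 1 else if j = 3 \<or> j = 4 then 0 else 2)"

definition corner_pt :: "nat \<Rightarrow> int \<Rightarrow> point3" where
  "corner_pt q z = circ_pt N (of_int z * hN N) (corner q)"

lemma Idx_cases: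
  assumes "(n, j, k) \<in> Idx N"
  shows "j = 1 \<or> j = 2 \<or> j = 3 \<or> j = 4 \<or> j = 5 \<or> j = 6" "k < N"
  using assms by (auto simp: Idx_def)

lemma corner_pt_wrap:
  assumes "k < N" shows "corner_pt (4 * k + 4) z = corner_pt (4 * ((k + 1) mod N)) z"
proof (cases "k + 1 = N")
  case True
  then have *: "4 * k + 4 = 4 * N" by simp
  show ?thesis unfolding * using True by (simp add: corner_pt_def circ_pt_def corner_ends)
next
  case False
  then have "4 * k + 4 = 4 * ((k + 1) mod N)" using assms by simp
  then show ?thesis by (simp only:)
qed

lemma vertex_start: "(n, j, k) \<in> Idx N \<Longrightarrow> vertex N (n, j, k) = corner_pt (sq j k) (sz n j)"
  using Idx_cases(1)[of n j k] by (auto simp: vertex_def corner_pt_def sq_def sz_def phi_odd corner_simps)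

lemma vertex_end:
  assumes w: "(n, j, k) \<in> Idx N" shows "vertex N (n, j, k) + edge_vec N (n, j, k) = corner_pt (tq j k) (ez n j)"
proof -
  have k: "k < N" "(k + 1) mod N < N" using Idx_cases[OF w] N2 by auto
  have i: "(n', j', k') \<in> Idx N" if "j' \<in> {1..6}" "k' < N" for n' j' k' using that by (auto simp: Idx_def)
  note vs = vertex_start[OF i]
  have "j = 1 \<or> j = 2 \<or> j = 3 \<or> j = 4 \<or> j = 5 \<or> j = 6" using Idx_cases[OF w] by simp
  then show ?thesis
  proof (elim disjE)
    assume "j = 4"
    then show ?thesis using vs[of 1 "(k + 1) mod N" n] k corner_pt_wrap[OF k(1), of "2 * n"]
      by (simp add: edge_vec_def sq_def sz_def tq_def ez_def)
  qed (use vs[of _ k] k in \<open>simp_all add: edge_vec_def sq_def sz_def tq_def ez_def\<close>)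
qed

lemma edge_pt_convex:
  assumes w: "(n, j, k) \<in> Idx N"
  shows "edge_pt N (n, j, k) t = (1 - t) *\<^sub>R corner_pt (sq j k) (sz n j) + t *\<^sub>R corner_pt (tq j k) (ez n j)"
proof -
  have "edge_vec N (n, j, k) = corner_pt (tq j k) (ez n j) - corner_pt (sq j k) (sz n j)"
    using vertex_end[OF w] vertex_start[OF w] by (simp add: eq_diff_eq add.commute)
  then show ?thesis unfolding edge_pt_def vertex_start[OF w] by (simp only:) (simp add: algebra_simps)
qed

lemma edge_pt_ends:
  assumes w: "(n, j, k) \<in> Idx N"
  shows "edge_pt N (n, j, k) 0 = corner_pt (sq j k) (sz n j)" "edge_pt N (n, j, k) 1 = corner_pt (tq j k) (ez n j)"
  unfolding edge_pt_convex[OF w] by simp_all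

text \<open>The potential is \<open>B / 2\<close> times the horizontal position turned by a right
  angle, so its product with the edge vector is a planar cross product, unchanged along the edge. It
  equals \<open>R^2\<close> times the sine of the angle swept, which is \<open>be - al\<close>,
  \<open>2 * al\<close>, or \<open>al - be\<close> on edge 5.\<close>

lemma mag_pot_const:
  assumes w: "(n, j, k) \<in> Idx N"
  shows "mag_pot N B (n, j, k) t = apot (B * (Rp N 2 - Rp N 1) / 4) (B * Rp N 2 / 4) j"
proof -
  have e: "edge_vec N (n, j, k) = corner_pt (tq j k) (ez n j) - corner_pt (sq j k) (sz n j)"
    using vertex_end[OF w] vertex_start[OF w] by (simp add: eq_diff_eq add.commute)
  have "mag_pot N B (n, j, k) t = B / 2 * (R\<^sup>2 * sin (corner (tq j k) - corner (sq j k)))"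
    unfolding mag_pot_def edge_pt_convex[OF w] e sin_diff
    by (simp add: inner3_def vec_pot_def corner_pt_def circ_pt_def power2_eq_square algebra_simps)
  moreover have s1: "R\<^sup>2 * sin (be - al) = (Rp N 2 - Rp N 1) / 2"
    unfolding sin_diff trig_alpha_beta using R_pos by (simp add: field_simps power2_eq_square)
  moreover have s2: "R\<^sup>2 * sin (2 * al) = Rp N 2 / 2"
    unfolding sin_double trig_alpha_beta using R_pos by (simp add: field_simps power2_eq_square)
  moreover have "corner (tq j k) - corner (sq j k) = (if j = 2 \<or> j = 4 then 2 * al else if j = 5 then al - be else be - al)"
    using Idx_cases[OF w] by (auto simp: sq_def tq_def corner_simps)
  moreover have "R\<^sup>2 * sin (al - be) = (Rp N 1 - Rp N 2) / 2"
    unfolding sin_diff trig_alpha_beta using R_pos by (simp add: field_simps power2_eq_square)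
  ultimately have "mag_pot N B (n, j, k) t = B / 2 * (if j = 2 \<or> j = 4 then Rp N 2 / 2 else if j = 5 then (Rp N 1 - Rp N 2) / 2 else (Rp N 2 - Rp N 1) / 2)"
    by simp
  then show ?thesis unfolding apot_def by (simp only:) (simp add: field_simps)
qed

text \<open>For the nontrivial direction two coinciding edge points are compared by their
  projections. An interior point determines its chord and its place on it, and the height then
  separates distinct edges over one chord; end points are compared as corners with a height.\<close>

lemma continuity_iff_vertex:
  "(\<forall>\<omega>\<in>Idx N. \<forall>\<omega>'\<in>Idx N. \<forall>t\<in>{0..1}. \<forall>t'\<in>{0..1}. edge_pt N \<omega> t = edge_pt N \<omega>' t' \<longrightarrow> f \<omega> t = f \<omega>' t') \<longleftrightarrow> vertex_cond N f"
  (is "?C \<longleftrightarrow> _")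
proof
  assume C: ?C
  have i: "(n, j, k) \<in> Idx N" if "j \<in> {1..6}" "k < N" for n j k using that by (auto simp: Idx_def)
  have c: "f (n, j, k) t = f (n', j', k') t'"
    if "j \<in> {1..6}" "j' \<in> {1..6}" "k < N" "k' < N" "t \<in> {0..1}" "t' \<in> {0..1}" "edge_pt N (n, j, k) t = edge_pt N (n', j', k') t'" for n n' j j' k k' t t'
    using C i that by blast
  show "vertex_cond N f" unfolding vertex_cond_def
  proof (intro allI impI)
    fix n k assume k: "k < N"
    have k': "(k + 1) mod N < N" using N2 by simp
    show "f (n,1,k) 1 = f (n,2,k) 0 \<and> f (n,2,k) 0 = f (n,5,k) 0 \<and>
     f (n,2,k) 1 = f (n,3,k) 0 \<and> f (n,3,k) 0 = f (n,6,k) 0 \<and>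
     f (n,3,k) 1 = f (n,4,k) 0 \<and> f (n,4,k) 0 = f (n-1,6,k) 1 \<and>
     f (n,4,k) 1 = f (n,1,(k + 1) mod N) 0 \<and> f (n,1,k) 0 = f (n-1,5,k) 1"
      using k k' corner_pt_wrap[OF k, of "2 * n"]
      by (intro conjI; intro c; simp add: edge_pt_ends i; simp add: sq_def tq_def sz_def ez_def)
  qed
next
  assume V: "vertex_cond N f"
  \<comment> \<open>One value for each corner and height. Heights are \<open>2 * n\<close> or
    \<open>2 * n + 1\<close> according to the corner, so \<open>z div 2\<close> recovers the level
    in both cases.\<close>
  define F where "F = (\<lambda>q z. if q mod 4 = 0 then f (z div 2, 1, q div 4) 0 else if q mod 4 = 1 then f (z div 2, 2, q div 4) 0
     else if q mod 4 = 2 then f (z div 2, 3, q div 4) 0 else f (z div 2, 4, q div 4) (0::real))"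
  have F: "F (4 * k) (2 * n) = f (n, 1, k) 0" "F (4 * k + 1) (2 * n + 1) = f (n, 2, k) 0"
    "F (4 * k + 2) (2 * n + 1) = f (n, 3, k) 0" "F (4 * k + 3) (2 * n) = f (n, 4, k) 0" for k n
    unfolding F_def by (simp_all add: quad_div_mod)
  note v = V[unfolded vertex_cond_def, rule_format]
  have wrap: "(4 * k + 4) mod (4 * N) = 4 * ((k + 1) mod N)" for k
    using mult_mod_right[of 4 "k + 1" N] by (simp add: add.commute)
  have F0: "f (n, j, k) 0 = F (sq j k mod (4 * N)) (sz n j)" if w: "(n, j, k) \<in> Idx N" for n j k
  proof -
    have "sq j k < 4 * N" using Idx_cases[OF w] by (auto simp: sq_def)
    then have "sq j k mod (4 * N) = sq j k" by simp
    then show ?thesis using Idx_cases[OF w] v[of k n] F[of k n] by (auto simp: sq_def sz_def)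
  qed
  have F1: "f (n, j, k) 1 = F (tq j k mod (4 * N)) (ez n j)" if w: "(n, j, k) \<in> Idx N" for n j k
  proof (cases "j = 4")
    case True
    have "f (n, 4, k) 1 = f (n, 1, (k + 1) mod N) 0" using v[of k n] Idx_cases[OF w] by simp
    then show ?thesis using True F(1)[of "(k + 1) mod N" n] wrap[of k] by (simp add: tq_def ez_def)
  next
    case False
    then have "tq j k < 4 * N" using Idx_cases[OF w] by (auto simp: tq_def)
    then have "tq j k mod (4 * N) = tq j k" by simp
    moreover have "2 * n + 2 = 2 * (n + 1)" by simp
    ultimately show ?thesis using Idx_cases[OF w] v[of k n] v[of k "n + 1"] F[of k n] F[of k "n + 1"] False by (auto simp: tq_def ez_def)
  qed
  show ?C
  proof (intro ballI impI)
    fix \<omega> \<omega>' and t t' :: real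
    assume w: "\<omega> \<in> Idx N" and w': "\<omega>' \<in> Idx N" and t: "t \<in> {0..1}" and t': "t' \<in> {0..1}" and e: "edge_pt N \<omega> t = edge_pt N \<omega>' t'"
    obtain n j k where o: "\<omega> = (n, j, k)" by (cases \<omega>) auto
    obtain n' j' k' where o': "\<omega>' = (n', j', k')" by (cases \<omega>') auto
    \<comment> \<open>Edge 5 traverses its chord backwards; \<open>base\<close> and
      \<open>par\<close> restore the orientation so that every edge projects to
      \<open>chord_pt\<close>.\<close>
    define base where "base = (\<lambda>j k. if j = 5 then tq j k else sq j k)"
    define par where "par = (\<lambda>j t. if j = (5::nat) then 1 - t else (t::real))"
    have bs: "base j k < 4 * N" if "(n, j, k) \<in> Idx N" for n j k
      using Idx_cases[OF that] by (auto simp: base_def sq_def tq_def)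
    have proj: "Complex (fst (edge_pt N (n, j, k) t)) (fst (snd (edge_pt N (n, j, k) t))) = of_real R * chord_pt (base j k) (par j t)"
      and hgt: "snd (snd (edge_pt N (n, j, k) t)) = ((1 - t) * of_int (sz n j) + t * of_int (ez n j)) * hN N"
      if w: "(n, j, k) \<in> Idx N" for n j k t
    proof -
      show "snd (snd (edge_pt N (n, j, k) t)) = ((1 - t) * of_int (sz n j) + t * of_int (ez n j)) * hN N"
        unfolding edge_pt_convex[OF w] by (simp add: corner_pt_def circ_pt_def algebra_simps)
      have s: "tq j k = Suc (sq j k)" if "j \<noteq> 5" using Idx_cases[OF w] that by (auto simp: sq_def tq_def)
      have s5: "sq j k = Suc (tq j k)" if "j = 5" using that by (auto simp: sq_def tq_def)
      show "Complex (fst (edge_pt N (n, j, k) t)) (fst (snd (edge_pt N (n, j, k) t))) = of_real R * chord_pt (base j k) (par j t)"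
        unfolding edge_pt_convex[OF w] chord_pt_def base_def par_def using s s5
        by (cases "j = 5") (simp_all add: corner_pt_def circ_pt_def complex_eq_iff algebra_simps)
    qed
    have ch: "chord_pt (base j k) (par j t) = chord_pt (base j' k') (par j' t')"
      using proj[OF w[unfolded o], of t] proj[OF w'[unfolded o'], of t'] e R_pos unfolding o o' by simp
    have hh: "(1 - t) * of_int (sz n j) + t * of_int (ez n j) = (1 - t') * of_int (sz n' j') + t' * of_int (ez n' j')"
      using hgt[OF w[unfolded o], of t] hgt[OF w'[unfolded o'], of t'] e h_pos unfolding o o' by simp
    have par01: "par j t \<in> {0..1}" "par j' t' \<in> {0..1}" using t t' by (auto simp: par_def)
    show "f \<omega> t = f \<omega>' t'"
    proof (cases "(0 < t \<and> t < 1) \<or> (0 < t' \<and> t' < 1)")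
      case True
      have "base j k = base j' k' \<and> par j t = par j' t'"
      proof (cases "0 < t \<and> t < 1")
        case True
        then have "0 < par j t" "par j t < 1" by (auto simp: par_def)
        from chord_pt_inj[OF bs[OF w[unfolded o]] bs[OF w'[unfolded o']] this par01(2) ch] show ?thesis by blast
      next
        case False
        with True have "0 < par j' t'" "par j' t' < 1" by (auto simp: par_def)
        from chord_pt_inj[OF bs[OF w'[unfolded o']] bs[OF w[unfolded o]] this par01(1) ch[symmetric]] show ?thesis by auto
      qed
      then have b: "base j k = base j' k'" and p: "par j t = par j' t'" by auto
      have int: "0 < t \<and> t < 1" using True p by (auto simp: par_def split: if_splits)
      have noint: "t \<noteq> of_int m" for m :: int
      proof
        assume "t = of_int m"
        then have "0 < m \<and> m < 1" using int by simp
        then show False by presburger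
      qed
      have j: "j = 1 \<or> j = 2 \<or> j = 3 \<or> j = 4 \<or> j = 5 \<or> j = 6" "j' = 1 \<or> j' = 2 \<or> j' = 3 \<or> j' = 4 \<or> j' = 5 \<or> j' = 6"
        using Idx_cases w w' o o' by auto
      \<comment> \<open>Only the edges 1 and 5, or 3 and 6, lie over a common chord. At a common
        parameter \<open>s\<close> their heights are \<open>m + s\<close> and \<open>m' - s\<close>
        with integers \<open>m\<close>, \<open>m'\<close> of equal parity, so a crossing would make
        \<open>s\<close> an integer, against \<open>noint\<close>.\<close>
      have "k = k' \<and> (j = j' \<or> (j = 1 \<and> j' = 5) \<or> (j = 5 \<and> j' = 1) \<or> (j = 3 \<and> j' = 6) \<or> (j = 6 \<and> j' = 3))"
        using b j unfolding base_def sq_def tq_def by (elim disjE; simp; presburger)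
      then have kk: "k = k'" and cases: "j = j' \<or> (j = 1 \<and> j' = 5) \<or> (j = 5 \<and> j' = 1) \<or> (j = 3 \<and> j' = 6) \<or> (j = 6 \<and> j' = 3)" by auto
      from cases show ?thesis
      proof (elim disjE conjE)
        assume jj: "j = j'"
        then have tt: "t = t'" using p by (auto simp: par_def split: if_splits)
        have "real_of_int (2 * n) = real_of_int (2 * n')"
          using hh unfolding jj tt sz_def ez_def by (simp add: algebra_simps)
        then have "n = n'" by linarith
        then show ?thesis unfolding o o' using jj kk tt by simp
      next
        assume "j = 1" "j' = 5"
        then have "t = of_int (n' - n + 1)" using hh p by (simp add: sz_def ez_def par_def algebra_simps)
        then show ?thesis using noint by blast
      next
        assume "j = 5" "j' = 1"
        then have "t = of_int (n' - n)" using hh p by (simp add: sz_def ez_def par_def algebra_simps)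
        then show ?thesis using noint by blast
      next
        assume "j = 3" "j' = 6"
        then have "t = of_int (n - n')" using hh p by (simp add: sz_def ez_def par_def algebra_simps)
        then show ?thesis using noint by blast
      next
        assume "j = 6" "j' = 3"
        then have "t = of_int (n' - n)" using hh p by (simp add: sz_def ez_def par_def algebra_simps)
        then show ?thesis using noint by blast
      qed
    next
      case False
      then have ends: "t = 0 \<or> t = 1" "t' = 0 \<or> t' = 1" using t t' by auto
      \<comment> \<open>At end points both sides are values of \<open>F\<close>; the reduction
        modulo \<open>4 * N\<close> identifies the closing corner with corner 0.\<close>
      define Q where "Q = (if t = 0 then sq j k else tq j k)"
      define Z where "Z = (if t = 0 then sz n j else ez n j)"
      define Q' where "Q' = (if t' = 0 then sq j' k' else tq j' k')"
      define Z' where "Z' = (if t' = 0 then sz n' j' else ez n' j')"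
      have f1: "f \<omega> t = F (Q mod (4 * N)) Z" "edge_pt N \<omega> t = corner_pt Q Z"
        using ends(1) F0[OF w[unfolded o]] F1[OF w[unfolded o]] edge_pt_ends[OF w[unfolded o]] unfolding o Q_def Z_def by auto
      have f2: "f \<omega>' t' = F (Q' mod (4 * N)) Z'" "edge_pt N \<omega>' t' = corner_pt Q' Z'"
        using ends(2) F0[OF w'[unfolded o']] F1[OF w'[unfolded o']] edge_pt_ends[OF w'[unfolded o']] unfolding o' Q'_def Z'_def by auto
      have le: "sq j k \<le> 4 * N" "tq j k \<le> 4 * N" if "(n, j, k) \<in> Idx N" for n j k
        using Idx_cases[OF that] by (auto simp: sq_def tq_def)
      have "Q \<le> 4 * N" "Q' \<le> 4 * N" using le w w' o o' by (auto simp: Q_def Q'_def)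
      moreover have "corner_pt Q Z = corner_pt Q' Z'" using e f1 f2 by simp
      then have "cis (corner Q) = cis (corner Q')" "Z = Z'"
        using R_pos h_pos by (auto simp: corner_pt_def circ_pt_def complex_eq_iff)
      ultimately have "Q mod (4 * N) = Q' mod (4 * N)" using corner_cis_inj by blast
      then show ?thesis using f1 f2 \<open>Z = Z'\<close> by simp
    qed
  qed
qed

end

section \<open>Unitary equivalence\<close>

text \<open>Families are total in \<open>j\<close>, while \<open>U (V f')\<close> and
  \<open>f'\<close> are known to agree only for \<open>j\<close> from 1 to 6.\<close>

lemma BC_cong:
  assumes "\<And>n j. j \<in> {1..6} \<Longrightarrow> y n j = z n j" "BC N a1 a2 k y"
  shows "BC N a1 a2 k z"
proof -
  have "y n 1 = z n 1" "y n 2 = z n 2" "y n 3 = z n 3" "y n 4 = z n 4" "y n 5 = z n 5" "y n 6 = z n 6" for n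
    by (rule assms(1), simp)+
  note e = this
  show ?thesis using assms(2) unfolding BC_def Let_def e .
qed

lemma HB_unitarily_equiv_Ha:
  assumes N2: "N \<ge> 2"
  shows "unitarily_equiv N (graph_HB N B q) (graph_Ha N (B * (Rp N 2 - Rp N 1) / 4) (B * Rp N 2 / 4) q)"
proof -
  define a1 a2 where "a1 = B * (Rp N 2 - Rp N 1) / 4" and "a2 = B * Rp N 2 / 4"
  interpret geometry N by unfold_locales (rule N2)
  interpret gauge N a1 a2 using N2 by unfold_locales simp
  have mp: "mag_pot N B \<omega> t = apot a1 a2 (fst (snd \<omega>))" if "\<omega> \<in> Idx N" for \<omega> t
    using mag_pot_const that unfolding a1_def a2_def by (cases \<omega>) auto
  have iw: "(n, j, k) \<in> Idx N" if "j \<in> {1..6}" "k < N" for n j k using that by (auto simp: Idx_def)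
  have md: "mder N B f \<omega> t = gder f \<omega> t" if "\<omega> \<in> Idx N" for f \<omega> t
    unfolding mder_def gder_def mp[OF that] bU_def by simp
  have HB: "HB_op N B q f \<omega> t = - U.gauged f \<omega> t + complex_of_real (q t) * f \<omega> t" if "\<omega> \<in> Idx N" for f \<omega> t
  proof -
    have "mag_pot N B \<omega> = (\<lambda>t. apot a1 a2 (fst (snd \<omega>)))" using mp[OF that] by blast
    then show ?thesis unfolding HB_op_def Let_def U.gauged_def bU_def by (simp add: power_mult_distrib)
  qed
  have kirch: "kirchhoff N (gder f) \<longleftrightarrow> (\<forall>n. \<forall>k<N. let k' = (k + 1) mod N; D = mder N B f in
        D (n,2,k) 0 - D (n,1,k) 1 + D (n,5,k) 0 = 0 \<and>
        D (n,3,k) 0 - D (n,2,k) 1 + D (n,6,k) 0 = 0 \<and>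
        - D (n,3,k) 1 + D (n,4,k) 0 - D (n-1,6,k) 1 = 0 \<and>
        - D (n,4,k) 1 + D (n,1,k') 0 - D (n-1,5,k') 1 = 0)" for f
  proof -
    have m: "(k + 1) mod N < N" for k using N2 by simp
    have iff: "(a = b + c) = (b - a + c = 0)" "(b = a + c) = (- a + b - c = 0)" "(a = b - c) = (- a + b - c = 0)" for a b c :: complex
      by (auto simp: algebra_simps)
    show ?thesis unfolding kirchhoff_def Let_def
    proof (intro iff_allI imp_cong refl)
      fix n k assume k: "k < N"
      have e: "mder N B f (n', j, k) t = gder f (n', j, k) t" "mder N B f (n', j, (k + 1) mod N) t = gder f (n', j, (k + 1) mod N) t"
        if "j \<in> {1..6}" for n' j t
        using md[OF iw[OF that k]] md[OF iw[OF that m]] by auto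
      show "(gder f (n,1,k) 1 = gder f (n,2,k) 0 + gder f (n,5,k) 0 \<and>
          gder f (n,2,k) 1 = gder f (n,3,k) 0 + gder f (n,6,k) 0 \<and>
          gder f (n,4,k) 0 = gder f (n,3,k) 1 + gder f (n-1,6,k) 1 \<and>
          gder f (n,4,k) 1 = gder f (n,1,(k + 1) mod N) 0 - gder f (n-1,5,(k + 1) mod N) 1) =
         (mder N B f (n,2,k) 0 - mder N B f (n,1,k) 1 + mder N B f (n,5,k) 0 = 0 \<and>
          mder N B f (n,3,k) 0 - mder N B f (n,2,k) 1 + mder N B f (n,6,k) 0 = 0 \<and>
          - mder N B f (n,3,k) 1 + mder N B f (n,4,k) 0 - mder N B f (n-1,6,k) 1 = 0 \<and>
          - mder N B f (n,4,k) 1 + mder N B f (n,1,(k + 1) mod N) 0 - mder N B f (n-1,5,(k + 1) mod N) 1 = 0)"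
        by (intro arg_cong2[where f = "(\<and>)"]; subst e, simp; subst e, simp; subst e, simp; (rule iff)?)
    qed
  qed
  \<comment> \<open>Given second derivatives, continuity and Kirchhoff conditions for
    \<open>f\<close> together amount to \<open>BC\<close> for the transform. Regularity and
    summability are left as conditions on \<open>f\<close>, since \<open>U\<close> and
    \<open>V\<close> preserve them.\<close>
  have domHB: "dom_HB N B f \<longleftrightarrow> (\<forall>\<omega>\<in>Idx N. \<exists>g. H2rep (f \<omega>) g) \<and> l2fam N f \<and> l2fam N (\<lambda>\<omega>. d2 (f \<omega>)) \<and>
      (\<forall>m<N. BC N a1 a2 m (\<lambda>n j. U f (n, j, m)))" for f
  proof (cases "\<forall>\<omega>\<in>Idx N. \<exists>g. H2rep (f \<omega>) g")
    case True
    then show ?thesis unfolding dom_HB_def continuity_iff_vertex kirch[symmetric] using BC_iff_vertex[of f] by blast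
  next
    case False
    then show ?thesis unfolding dom_HB_def by blast
  qed
  \<comment> \<open>The intertwining relation. The two sides can differ only where the chosen
    \<open>d2\<close> of the transform differs from the transformed \<open>gauged\<close> family, a
    null set on each edge.\<close>
  have core: "aeq N (U (HB_op N B q f)) (Ha_op q (U f))" if f: "\<And>\<omega>. \<omega> \<in> Idx N \<Longrightarrow> \<exists>g. H2rep (f \<omega>) g" for f
    unfolding aeq_def
  proof
    fix \<omega> assume w: "\<omega> \<in> Idx N"
    obtain n j m where o: "\<omega> = (n, j, m)" by (cases \<omega>) auto
    have "U (HB_op N B q f) \<omega> t = - mix N (dft N) bU (U.gauged f) \<omega> t + complex_of_real (q t) * U f \<omega> t" for t
    proof -
      have "U (HB_op N B q f) \<omega> t = (\<Sum>k<N. dft N m k * (exp (bU j * of_real t) * (- U.gauged f (n, j, k) t + complex_of_real (q t) * f (n, j, k) t)))"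
        unfolding U_def o mix_apply using w unfolding o by (intro sum.cong refl) (simp add: HB Idx_iff)
      also have "\<dots> = - mix N (dft N) bU (U.gauged f) \<omega> t + complex_of_real (q t) * U f \<omega> t"
        unfolding U_def o mix_apply sum_distrib_left sum_negf[symmetric] sum.distrib[symmetric]
        by (intro sum.cong refl) (simp add: algebra_simps)
      finally show ?thesis .
    qed
    then have "{t \<in> {0..1}. U (HB_op N B q f) \<omega> t \<noteq> Ha_op q (U f) \<omega> t} \<subseteq> {t \<in> {0..1}. d2 (mix N (dft N) bU f \<omega>) t \<noteq> mix N (dft N) bU (U.gauged f) \<omega> t}"
      unfolding Ha_op_def U_def by auto
    moreover have "aeq N (\<lambda>\<omega>. d2 (mix N (dft N) bU f \<omega>)) (mix N (dft N) bU (U.gauged f))"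
      by (rule U.mix_d2[OF f])
    ultimately show "negligible {t \<in> {0..1}. U (HB_op N B q f) \<omega> t \<noteq> Ha_op q (U f) \<omega> t}"
      using w negligible_subset unfolding aeq_def by blast
  qed
  have aeq_eq: "aeq N f g" if "\<And>\<omega>. \<omega> \<in> Idx N \<Longrightarrow> f \<omega> = g \<omega>" for f g
    unfolding aeq_def using that by simp
  show ?thesis
    unfolding unitarily_equiv_def a1_def[symmetric] a2_def[symmetric]
  proof (intro exI[of _ U] conjI allI impI)
    show "l2fam N (U f)" if "l2fam N f" for f unfolding U_def by (rule U.mix_l2fam[OF that])
    show "aeq N (U (\<lambda>\<omega> t. c * f \<omega> t + g \<omega> t)) (\<lambda>\<omega> t. c * U f \<omega> t + U g \<omega> t)" for f g c
      by (rule aeq_eq) (auto simp: U_def U.mix_add)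
    show "inner_fam N (U f) (U g) = inner_fam N f g" if "l2fam N f" "l2fam N g" for f g
      unfolding U_def by (rule U.mix_inner[OF that])
    show "\<exists>f. l2fam N f \<and> aeq N (U f) h" if "l2fam N h" for h
    proof (intro exI conjI)
      show "l2fam N (V h)" unfolding V_def by (rule V.mix_l2fam[OF that])
      show "aeq N (U (V h)) h" by (rule aeq_eq[OF UV])
    qed
    show "\<forall>(f, g)\<in>graph_HB N B q. \<exists>(f', g')\<in>graph_Ha N a1 a2 q. aeq N (U f) f' \<and> aeq N (U g) g'"
    proof (clarify)
      fix f g assume "(f, g) \<in> graph_HB N B q"
      then have g: "g = HB_op N B q f" and d: "dom_HB N B f" by (auto simp: graph_HB_def)
      have h: "\<And>\<omega>. \<omega> \<in> Idx N \<Longrightarrow> \<exists>g. H2rep (f \<omega>) g" and l: "l2fam N f" "l2fam N (\<lambda>\<omega>. d2 (f \<omega>))"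
        and bc: "\<forall>m<N. BC N a1 a2 m (\<lambda>n j. U f (n, j, m))"
        using d unfolding domHB by auto
      have "dom_Ha N a1 a2 (U f)"
        unfolding dom_Ha_def using U.mix_regular[OF h l] bc unfolding U_def by blast
      then have "(U f, Ha_op q (U f)) \<in> graph_Ha N a1 a2 q" by (auto simp: graph_Ha_def)
      moreover have "aeq N (U f) (U f)" by (rule aeq_eq) simp
      moreover have "aeq N (U g) (Ha_op q (U f))" unfolding g by (rule core[OF h])
      ultimately show "\<exists>(f', g')\<in>graph_Ha N a1 a2 q. aeq N (U f) f' \<and> aeq N (U g) g'" by blast
    qed
    show "\<forall>(f', g')\<in>graph_Ha N a1 a2 q. \<exists>(f, g)\<in>graph_HB N B q. aeq N (U f) f' \<and> aeq N (U g) g'"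
    proof (clarify)
      fix f' g' assume "(f', g') \<in> graph_Ha N a1 a2 q"
      then have g': "g' = Ha_op q f'" and d: "dom_Ha N a1 a2 f'" by (auto simp: graph_Ha_def)
      have h': "\<And>\<omega>. \<omega> \<in> Idx N \<Longrightarrow> \<exists>g. H2rep (f' \<omega>) g" and l': "l2fam N f'" "l2fam N (\<lambda>\<omega>. d2 (f' \<omega>))"
        and bc': "\<forall>m<N. BC N a1 a2 m (\<lambda>n j. f' (n, j, m))"
        using d unfolding dom_Ha_def by auto
      have r: "\<And>\<omega>. \<omega> \<in> Idx N \<Longrightarrow> \<exists>g. H2rep (V f' \<omega>) g" "l2fam N (V f')" "l2fam N (\<lambda>\<omega>. d2 (V f' \<omega>))"
        using V.mix_regular[OF h' l'] unfolding V_def by blast+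
      \<comment> \<open>The preimage is \<open>V f'\<close>; on the tube \<open>U (V f')\<close>
        equals \<open>f'\<close> as a function and not merely almost everywhere, so boundary values
        carry over.\<close>
      have "BC N a1 a2 m (\<lambda>n j. U (V f') (n, j, m))" if m: "m < N" for m
      proof (rule BC_cong)
        show "BC N a1 a2 m (\<lambda>n j. f' (n, j, m))" using bc' m by blast
        show "f' (n, j, m) = U (V f') (n, j, m)" if "j \<in> {1..6}" for n j
          using UV[OF iw[OF that m]] by simp
      qed
      then have "dom_HB N B (V f')" unfolding domHB using r by blast
      then have "(V f', HB_op N B q (V f')) \<in> graph_HB N B q" by (auto simp: graph_HB_def)
      moreover have "aeq N (U (V f')) f'" by (rule aeq_eq[OF UV])
      moreover have "aeq N (U (HB_op N B q (V f'))) g'"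
      proof -
        have "Ha_op q (U (V f')) \<omega> = g' \<omega>" if "\<omega> \<in> Idx N" for \<omega>
          unfolding g' Ha_op_def using UV[OF that, of f'] by simp
        moreover have "aeq N (U (HB_op N B q (V f'))) (Ha_op q (U (V f')))" by (rule core[OF r(1)])
        ultimately show ?thesis unfolding aeq_def by simp
      qed
      ultimately show "\<exists>(f, g)\<in>graph_HB N B q. aeq N (U f) f' \<and> aeq N (U g) g'" by blast
    qed
  qed
qed

theorem theorem1p1:
  fixes N :: nat and q :: "real \<Rightarrow> real"
  assumes N: "N \<ge> 1"
    and q: "L2_01_real q"
  shows
    "(N \<ge> 2 \<longrightarrow> (\<forall>B :: real.
        unitarily_equiv N (graph_HB N B q)
          (graph_Ha N (B * (Rp N 2 - Rp N 1) / 4) (B * Rp N 2 / 4) q)))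
     \<and>
     (\<forall>a1 a2 :: real. \<forall>k < N. \<exists>Th Ph :: nat \<Rightarrow> complex \<Rightarrow> gfam.
        (\<forall>lam. lam \<notin> dirichlet_spec q \<longrightarrow> (\<forall>\<nu>\<in>{1,2}.
            fund_theta N q a1 a2 k lam \<nu> (Th \<nu> lam) \<and>
            (\<forall>y. fund_theta N q a1 a2 k lam \<nu> y \<longrightarrow> agree y (Th \<nu> lam)) \<and>
            fund_phi N q a1 a2 k lam \<nu> (Ph \<nu> lam) \<and>
            (\<forall>y. fund_phi N q a1 a2 k lam \<nu> y \<longrightarrow> agree y (Ph \<nu> lam)))) \<and>
        (\<forall>\<nu>\<in>{1,2}. \<forall>n. \<forall>j\<in>{1..6}. \<forall>x\<in>{0..1}.
            (\<lambda>lam. Th \<nu> lam n j x) analytic_on (- dirichlet_spec q) \<and>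
            (\<lambda>lam. Ph \<nu> lam n j x) analytic_on (- dirichlet_spec q)) \<and>
        (\<forall>lam. lam \<notin> dirichlet_spec q \<longrightarrow>
            (let M = monodromy (\<lambda>\<nu>. Th \<nu> lam) (\<lambda>\<nu>. Ph \<nu> lam) in
              (\<exists>\<tau>1 \<tau>2 :: complex. \<tau>1 \<noteq> 0 \<and> \<tau>2 \<noteq> 0 \<and>
                 char_poly M = [:- \<tau>1, 1:] * [:- inverse \<tau>1, 1:] * [:- \<tau>2, 1:] * [:- inverse \<tau>2, 1:]) \<and>
              Determinant.det M = 1 \<and>
              transpose_mat M * Jsymp * M = Jsymp)) \<and>
        (\<exists>F :: complex \<Rightarrow> complex mat.
            (\<forall>i<4. \<forall>j<4. (\<lambda>lam. F lam $$ (i, j)) holomorphic_on UNIV) \<and>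
            (\<forall>lam. lam \<notin> dirichlet_spec q \<longrightarrow>
               F lam = Rmat q lam * monodromy (\<lambda>\<nu>. Th \<nu> lam) (\<lambda>\<nu>. Ph \<nu> lam) * mat_inv (Rmat q lam))))"
proof (intro conjI impI allI, goal_cases)
  case (1 B)
  then show ?case by (rule HB_unitarily_equiv_Ha)
next
  case (2 a1 a2 k)
  interpret tube q N k a1 a2 by unfold_locales (rule q)
  have M: "(\<exists>\<tau>1 \<tau>2 :: complex. \<tau>1 \<noteq> 0 \<and> \<tau>2 \<noteq> 0 \<and>
        char_poly (monmat lam) = [:- \<tau>1, 1:] * [:- inverse \<tau>1, 1:] * [:- \<tau>2, 1:] * [:- inverse \<tau>2, 1:]) \<and>
      Determinant.det (monmat lam) = 1 \<and> transpose_mat (monmat lam) * Jsymp * monmat lam = Jsymp"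
    if "lam \<notin> dirichlet_spec q" for lam
    using char_poly_similar[OF mono_similar[OF that]] tmat_char_poly[of lam] mono_det[OF that] mono_symplectic[OF that]
    by simp
  \<comment> \<open>This product contains no division by \<open>ph lam 1\<close>, so it extends the
    conjugated monodromy matrix across the Dirichlet spectrum, where \<open>Rmat q lam\<close> is
    singular.\<close>
  let ?F = "\<lambda>lam. lmat (dv (ph lam) 1) (- 1) * tmat lam * lmat (dv (ph lam) 1) (- 1)"
  have "holo_mat ?F"
    by (rule holo_mat_mult[OF holo_mat_mult[OF holo_mat_factors(2,1)] holo_mat_factors(2)])
  then have F: "\<exists>F. (\<forall>i<4. \<forall>j<4. (\<lambda>lam. F lam $$ (i, j)) holomorphic_on UNIV) \<and>
      (\<forall>lam. lam \<notin> dirichlet_spec q \<longrightarrow> F lam = Rmat q lam * monmat lam * mat_inv (Rmat q lam))"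
    using mono_conjugate unfolding holo_mat_def by (intro exI[of _ ?F]) simp
  have an: "(\<lambda>lam. Th \<nu> lam n j x) analytic_on - dirichlet_spec q \<and> (\<lambda>lam. Ph \<nu> lam n j x) analytic_on - dirichlet_spec q"
    if "x \<in> {0..1}" for \<nu> n j x
    unfolding Th_def Ph_def using gs_analytic[OF that] by blast
  show ?case
    unfolding Let_def
  proof (rule exI[of _ Th], rule exI[of _ Ph], intro conjI, goal_cases)
    case 1
    show ?case using fundamental_solutions by blast
  next
    case 2
    show ?case using an by blast
  next
    case 3
    show ?case using M by blast
  next
    case 4
    show ?case by (rule F)
  qed
qed

end
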